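(* Let $p\in[2,n)$ and let $\varphi\in C_{\rm c}^\infty(B(\mathbf 0,1))$ be nonzero. For every $\varepsilon\in(0,1)$ choose $R_\varepsilon\in(0,\infty)$ such that $$\sup_{|y|\ge R_\varepsilon/4}|U(y)|\le\varepsilon^2,$$ and let $f_\varepsilon:=U+\varepsilon\,\varphi(\cdot-R_\varepsilon\mathbf e_1)$. Then there are positive constants $c$ and $C$, depending only on $n$, $p$, $U$, and $\varphi$, such that, for every $\varepsilon\in(0,c)$, $$\inf_{v\in\mathcal M_{\rm aff}^{(1)},\,B\in\operatorname{SL}(n)}\|\nabla(f_\varepsilon\circ B-v)\|_p\ \ge\ \inf_{v\in\mathcal M_{\rm aff},\,B\in\operatorname{SL}(n)}\|\nabla(f_\varepsilon\circ B-v)\|_p\ \ge\ C\varepsilon.$$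
   Context: All functions are real-valued on $\mathbb R^n$, and $\|\cdot\|_p$ is the $L^p(\mathbb R^n)$-norm. $\mathbf e_1=(1,0,\dots,0)$; $B(x,r)$ is the open ball. $p'=p/(p-1)$, $p^*=np/(n-p)$. $U(x)=c_0(1+|x|^{p'})^{(p-n)/p}$, with $c_0>0$ chosen so that $\|U\|_{p^*}=1$. $\dot W^{1,p}$ is the homogeneous Sobolev space of all weakly differentiable $f$ with $\nabla f\in L^p$ and $|\{|f|>\lambda\}|<\infty$ for every $\lambda>0$. For $\xi\in\mathbb S^{n-1}$, $\nabla_\xi f=\xi\cdot\nabla f$, and $\mathcal E_p(f)=\left[\int_{\mathbb S^{n-1}}\|\nabla_\xi f\|_p^{-n}\,d\xi\right]^{-1/n}$ ($d\xi$ = surface measure). $S_{\rm aff}>0$ is the best (largest) constant in $\mathcal E_p(f)\ge S_{\rm aff}\|f\|_{p^*}$, $f\in\dot W^{1,p}$. $\mathcal M_{\rm aff}=\{f\in\dot W^{1,p}\setminus\{\mathbf 0\}:\mathcal E_p(f)=S_{\rm aff}\|f\|_{p^*}\}$ and $\mathcal M_{\rm aff}^{(1)}=\{f\in\mathcal M_{\rm aff}:\|f\|_{p^*}=1\}$. $\operatorname{SL}(n)$ is the group of real $n\times n$ matrices of determinant $1$, and $(f\circ B)(x)=f(Bx)$. *)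

theory Defs
  imports "HOL-Analysis.Analysis"
begin

text \<open>
  Everything lives on \<open>real ^ 'n\<close> with \<open>n = CARD('n)\<close>. Norms, energies and infima take values in
  \<^typ>\<open>ennreal\<close>, so that integrals that may diverge, and infima, carry their usual meaning.
\<close>

text \<open>Real powers on \<open>[0,\<infinity>]\<close>: for \<open>a < 0\<close> one has \<open>0\<^sup>a = \<infinity>\<close> and \<open>\<infinity>\<^sup>a = 0\<close>.\<close>

definition ennpowr :: "ennreal \<Rightarrow> real \<Rightarrow> ennreal"  (infixr "epowr" 80) where
  "x epowr a =
     (if a = 0 then 1
      else if x = 0 then (if 0 < a then 0 else \<infinity>)
      else if x = \<infinity> then (if 0 < a then \<infinity> else 0)
      else ennreal (enn2real x powr a))"

definition Lp_norm :: "real \<Rightarrow> (real ^ 'n \<Rightarrow> 'b::real_normed_vector) \<Rightarrow> ennreal" where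
  "Lp_norm p f = (\<integral>\<^sup>+ x. ennreal (norm (f x)) epowr p \<partial>lebesgue) epowr (1 / p)"

text \<open>
  Partial derivatives are taken as values of the Frechet derivative; a function is \<open>C\<^sup>k\<^sup>+\<^sup>1\<close> iff it is
  differentiable with all partial derivatives in \<open>C\<^sup>k\<close>.
\<close>

definition partial_deriv :: "'n \<Rightarrow> (real ^ 'n \<Rightarrow> real) \<Rightarrow> real ^ 'n \<Rightarrow> real" where
  "partial_deriv i f x = frechet_derivative f (at x) (axis i 1)"

primrec Ck :: "nat \<Rightarrow> (real ^ 'n \<Rightarrow> real) \<Rightarrow> bool" where
  "Ck 0 f \<longleftrightarrow> continuous_on UNIV f"
| "Ck (Suc k) f \<longleftrightarrow> f differentiable_on UNIV \<and> (\<forall>i. Ck k (partial_deriv i f))"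

definition Cc_infinity :: "(real ^ 'n) set \<Rightarrow> (real ^ 'n \<Rightarrow> real) set" where
  "Cc_infinity \<Omega> =
     {f. (\<forall>k. Ck k f) \<and> compact (closure {x. f x \<noteq> 0}) \<and> closure {x. f x \<noteq> 0} \<subseteq> \<Omega>}"

definition L1_loc :: "(real ^ 'n \<Rightarrow> 'b::euclidean_space) \<Rightarrow> bool" where
  "L1_loc f \<longleftrightarrow> (\<forall>K. compact K \<longrightarrow> set_integrable lebesgue K f)"

definition is_weak_gradient :: "(real ^ 'n \<Rightarrow> real) \<Rightarrow> (real ^ 'n \<Rightarrow> real ^ 'n) \<Rightarrow> bool" where
  "is_weak_gradient f g \<longleftrightarrow> L1_loc f \<and> L1_loc g \<and>
     (\<forall>\<psi> \<in> Cc_infinity UNIV. \<forall>i.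
        (\<integral>x. f x * partial_deriv i \<psi> x \<partial>lebesgue) = - (\<integral>x. g x $ i * \<psi> x \<partial>lebesgue))"

text \<open>Weak gradients are unique up to null sets, so norms of the chosen representative do not depend
  on the choice.\<close>

definition weak_gradient :: "(real ^ 'n \<Rightarrow> real) \<Rightarrow> real ^ 'n \<Rightarrow> real ^ 'n" where
  "weak_gradient f = (SOME g. is_weak_gradient f g)"

definition weakly_differentiable :: "(real ^ 'n \<Rightarrow> real) \<Rightarrow> bool" where
  "weakly_differentiable f \<longleftrightarrow> (\<exists>g. is_weak_gradient f g)"

text \<open>Elements of the homogeneous Sobolev space are functions, not classes modulo null sets; the
  zero element is therefore represented by every function vanishing almost everywhere.\<close>

definition W_hom :: "real \<Rightarrow> (real ^ 'n \<Rightarrow> real) set" where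
  "W_hom p =
     {f. weakly_differentiable f \<and> Lp_norm p (weak_gradient f) < \<infinity> \<and>
         (\<forall>t>0. emeasure lebesgue {x. \<bar>f x\<bar> > t} < \<infinity>)}"

text \<open>
  Surface measure on the unit sphere, by polar coordinates: the measure of \<open>A\<close> is \<open>n\<close> times the
  Lebesgue measure of the cone \<open>{r \<xi> | 0 < r < 1, \<xi> \<in> A}\<close>.
\<close>

definition sphere_measure :: "(real ^ 'n) measure" where
  "sphere_measure =
     scale_measure (of_nat CARD('n))
       (distr (restrict_space lborel (ball 0 1 - {0})) (restrict_space borel (sphere 0 1))
          (\<lambda>x. x /\<^sub>R norm x))"

definition affine_energy :: "real \<Rightarrow> (real ^ 'n \<Rightarrow> real) \<Rightarrow> ennreal" where
  "affine_energy p f =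
     (\<integral>\<^sup>+ \<xi>. Lp_norm p (\<lambda>x. \<xi> \<bullet> weak_gradient f x) epowr (- real CARD('n)) \<partial>sphere_measure)
       epowr (- 1 / real CARD('n))"

definition sobolev_exp :: "real \<Rightarrow> real \<Rightarrow> real" where
  "sobolev_exp n p = n * p / (n - p)"

text \<open>The type argument carries the dimension, which the value does not mention otherwise.\<close>

definition S_aff :: "'n::finite itself \<Rightarrow> real \<Rightarrow> ennreal" where
  "S_aff _ p =
     Sup {S. \<forall>f \<in> (W_hom p :: (real ^ 'n \<Rightarrow> real) set).
               S * Lp_norm (sobolev_exp (real CARD('n)) p) f \<le> affine_energy p f}"

definition M_aff :: "real \<Rightarrow> (real ^ 'n \<Rightarrow> real) set" where
  "M_aff p =
     {f \<in> W_hom p. \<not> (AE x in lebesgue. f x = 0) \<and>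
        affine_energy p f = S_aff TYPE('n) p * Lp_norm (sobolev_exp (real CARD('n)) p) f}"

definition M_aff1 :: "real \<Rightarrow> (real ^ 'n \<Rightarrow> real) set" where
  "M_aff1 p = {f \<in> M_aff p. Lp_norm (sobolev_exp (real CARD('n)) p) f = 1}"

definition SL :: "(real ^ 'n ^ 'n) set" where
  "SL = {B. det B = 1}"

text \<open>The profile \<open>c\<^sub>0 (1 + |x|\<^bsup>p'\<^esup>)\<^bsup>(p-n)/p\<^esup>\<close> with \<open>p' = p / (p - 1)\<close>.\<close>

definition U_profile :: "real \<Rightarrow> real \<Rightarrow> real ^ 'n \<Rightarrow> real" where
  "U_profile c\<^sub>0 p x =
     c\<^sub>0 * (1 + norm x powr (p / (p - 1))) powr ((p - real CARD('n)) / p)"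

end

theory Submission
  imports Defs
begin

text \<open>
  Suppose that an extremal \<open>v\<close> satisfies \<open>\<parallel>\<nabla>(f\<^sub>\<epsilon> \<circ> B - v)\<parallel>\<^sub>p < C \<epsilon>\<close> with a small \<open>C\<close>. By \<open>SL(n)\<close>-invariance
  \<open>w = v \<circ> B\<^sup>-\<^sup>1\<close> is an extremal, and the affine Sobolev inequality turns the assumption into
  \<open>\<parallel>f\<^sub>\<epsilon> - w\<parallel>\<^sub>q \<le> \<delta> \<epsilon>\<close> for \<open>q = p\<^sup>*\<close>. No information on the shape of the extremals is needed to contradict this.
  Cut \<open>w\<close> off in a ball of large radius \<open>M\<close> around the bump. In every direction this saves at least a
  fixed multiple of \<open>\<epsilon>\<^sup>p\<close> of energy, because \<open>w\<close> is close to \<open>\<epsilon> \<phi>(\<cdot> - R e\<^sub>1)\<close> there, while the cutoff costs only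
  \<open>O(M\<^sup>-\<^sup>p \<epsilon>\<^sup>p)\<close>. The loss of \<open>L\<^sup>q\<close>-mass is \<open>O(\<epsilon>\<^sup>q)\<close>, and \<open>q > p\<close>; so the truncated function would
  violate the affine Sobolev inequality.

  If the best constant were \<open>0\<close> or \<open>\<infinity>\<close>, there would be no extremals at all, since a nonzero function in the
  Sobolev space has finite positive affine energy.
\<close>

section \<open>Linear changes of variables\<close>

text \<open>Composition with \<open>B\<close> can distort gradient norms by an arbitrarily large
  factor, so a bound for the gradient of \<open>f \<circ> B - v\<close> gives no uniform bound for
  the gradient of \<open>f - w\<close>. What survives uniformly in \<open>B\<close> is the distance
  in the Lebesgue norm of exponent \<open>q\<close>, and everything afterwards rests on that alone.
  The energy that \<open>w\<close> carries near the bump has to be recovered by duality, testing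
  against a second directional derivative of the bump. A second obstacle is the form of the affine
  energy, an integral of negative powers of directional energies. The saving must be available in
  every direction with one constant, and an additive saving must become a relative one although
  directional energies are not bounded above uniformly; a threshold between large and moderate
  energies does this in \<open>powr_neg_gain\<close>. The truncation factor is
  \<open>1 - Z ^ k\<close> with \<open>k\<close> at least \<open>p\<close>. The power makes
  convexity applicable and absorbs the division by \<open>Z\<close>. The constants depend on each
  other in this order: \<open>k\<close> and the constants of the bump, the cutoff scale
  \<open>M\<close>, the volume of the cutoff ball, and only then \<delta> and the bound for
  \<epsilon>.\<close>

lemma nn_integral_lborel_translation:
  fixes t :: "'a::euclidean_space"
  assumes [measurable]: "f \<in> borel_measurable borel"
  shows "(\<integral>\<^sup>+x. f (x + t) \<partial>lborel) = (\<integral>\<^sup>+x. f x \<partial>lborel)"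
proof -
  have "(\<integral>\<^sup>+x. f x \<partial>lborel) = (\<integral>\<^sup>+x. f x \<partial>distr lborel borel ((+) t))"
    by (simp add: lborel_distr_plus)
  also have "\<dots> = (\<integral>\<^sup>+x. f (t + x) \<partial>lborel)"
    by (subst nn_integral_distr) auto
  finally show ?thesis by (simp add: add.commute)
qed

lemma measurable_matrix_vector_mult [measurable]:
  "(\<lambda>x. (A::real^'n^'m) *v x) \<in> borel \<rightarrow>\<^sub>M borel"
  by (intro borel_measurable_continuous_onI linear_continuous_on)
     (simp add: linear_conv_bounded_linear[symmetric])

text \<open>The usual argument for the uniqueness of Haar measure, in the form of a double integral.\<close>

lemma lborel_linear_uniqueness:
  fixes A :: "real^'n^'n"
  assumes "invertible A" and [measurable]: "S \<in> sets borel" "T \<in> sets borel"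
  shows "emeasure lborel S * (\<integral>\<^sup>+y. indicator T (A *v y) \<partial>lborel)
       = emeasure lborel T * (\<integral>\<^sup>+y. indicator S (- (A *v y)) \<partial>lborel)"
proof -
  obtain A' where A': "A ** A' = mat 1" "A' ** A = mat 1"
    using assms(1) unfolding invertible_def by auto
  have AA': "A *v (A' *v x) = x" for x
    using A' by (simp add: matrix_vector_mul_assoc)
  have "emeasure lborel S * (\<integral>\<^sup>+y. indicator T (A *v y) \<partial>lborel)
      = (\<integral>\<^sup>+x. \<integral>\<^sup>+y. indicator S x * indicator T (A *v y) \<partial>lborel \<partial>lborel)"
    by (simp add: nn_integral_cmult nn_integral_multc)
  \<comment> \<open>The inner integral in \<open>y\<close> is shifted by \<open>A' *v x\<close>.
    After Fubini the inner integral in \<open>x\<close> is shifted by \<open>A *v y\<close>, and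
    after a second Fubini again the one in \<open>y\<close>; this separates \<open>S\<close> from
    \<open>T\<close>.\<close>
  also have "\<dots> = (\<integral>\<^sup>+x. \<integral>\<^sup>+y. indicator S x * indicator T (A *v y + x) \<partial>lborel \<partial>lborel)"
  proof (rule nn_integral_cong)
    fix x :: "real^'n"
    have "(\<integral>\<^sup>+y. indicator S x * indicator T (A *v (y + A' *v x)) \<partial>lborel)
        = (\<integral>\<^sup>+y. indicator S x * indicator T (A *v y) \<partial>lborel)"
      by (rule nn_integral_lborel_translation[of "\<lambda>y. indicator S x * indicator T (A *v y)"]) measurable
    then show "(\<integral>\<^sup>+y. indicator S x * indicator T (A *v y) \<partial>lborel)
      = (\<integral>\<^sup>+y. indicator S x * indicator T (A *v y + x) \<partial>lborel)"
      by (simp add: matrix_vector_right_distrib AA')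
  qed
  also have "\<dots> = (\<integral>\<^sup>+y. \<integral>\<^sup>+x. indicator S x * indicator T (A *v y + x) \<partial>lborel \<partial>lborel)"
    by (rule lborel_pair.Fubini') measurable
  also have "\<dots> = (\<integral>\<^sup>+y. \<integral>\<^sup>+x. indicator S (x - A *v y) * indicator T x \<partial>lborel \<partial>lborel)"
  proof (rule nn_integral_cong)
    fix y :: "real^'n"
    show "(\<integral>\<^sup>+x. indicator S x * indicator T (A *v y + x) \<partial>lborel)
      = (\<integral>\<^sup>+x. indicator S (x - A *v y) * indicator T x \<partial>lborel)"
      using nn_integral_lborel_translation[of "\<lambda>x. indicator S (x - A *v y) * indicator T x" "A *v y"]
      by (simp add: add.commute)
  qed
  also have "\<dots> = (\<integral>\<^sup>+x. \<integral>\<^sup>+y. indicator S (x - A *v y) * indicator T x \<partial>lborel \<partial>lborel)"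
    by (rule lborel_pair.Fubini') measurable
  also have "\<dots> = (\<integral>\<^sup>+x. \<integral>\<^sup>+y. indicator S (- (A *v y)) * indicator T x \<partial>lborel \<partial>lborel)"
  proof (rule nn_integral_cong)
    fix x :: "real^'n"
    have "(\<integral>\<^sup>+y. indicator S (x - A *v (y + A' *v x)) * indicator T x \<partial>lborel)
        = (\<integral>\<^sup>+y. indicator S (x - A *v y) * indicator T x \<partial>lborel)"
      by (rule nn_integral_lborel_translation[of "\<lambda>y. indicator S (x - A *v y) * indicator T x"]) measurable
    then show "(\<integral>\<^sup>+y. indicator S (x - A *v y) * indicator T x \<partial>lborel)
       = (\<integral>\<^sup>+y. indicator S (- (A *v y)) * indicator T x \<partial>lborel)"
      by (simp add: matrix_vector_right_distrib AA')
  qed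
  also have "\<dots> = emeasure lborel T * (\<integral>\<^sup>+y. indicator S (- (A *v y)) \<partial>lborel)"
    by (simp add: nn_integral_cmult nn_integral_multc mult.commute)
  finally show ?thesis .
qed

lemma emeasure_lborel_symmetric_unit_box:
  "emeasure lborel (box (-1) (1::real^'n)) = ennreal (2 ^ CARD('n))"
proof -
  have 1: "(1::real^'n) \<bullet> b = 1" if "b \<in> Basis" for b
    using that by (auto simp: Basis_vec_def inner_axis)
  have "((1::real^'n) - -1) \<bullet> b = 2" if "b \<in> Basis" for b
    using 1[OF that] by (simp only: inner_diff_left inner_minus_left)
  then show ?thesis
    by (subst emeasure_lborel_box) (simp_all add: 1 del: diff_minus_eq_add)
qed

text \<open>With \<open>S\<close> fixed as a box, the uniqueness identity says that the push-forward
  of Lebesgue measure is a multiple of it. The set \<open>D\<close> is bounded, open and contains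
  \<open>0\<close>, so the factor is finite and positive. Its value stays unknown here and is
  computed later for elementary matrices only.\<close>

lemma distr_lborel_linear_scale:
  fixes A :: "real^'n^'n"
  assumes "invertible A"
  obtains c where "0 < c"
    "\<And>f. f \<in> borel_measurable borel \<Longrightarrow> (\<integral>\<^sup>+x. f (A *v x) \<partial>lborel) = ennreal c * (\<integral>\<^sup>+x. f x \<partial>lborel)"
proof -
  let ?S = "box (-1) (1::real^'n)"
  let ?J = "\<integral>\<^sup>+y. indicator ?S (- (A *v y)) \<partial>lborel"
  obtain A' where A': "A ** A' = mat 1" "A' ** A = mat 1"
    using assms(1) unfolding invertible_def by auto
  have A'A: "A' *v (A *v x) = x" for x
    using A' by (simp add: matrix_vector_mul_assoc)
  define D where "D = {y. - (A *v y) \<in> ?S}"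
  have bij: "D = (\<lambda>x. - (A' *v x)) ` ?S"
  proof -
    have "y = - (A' *v (- (A *v y)))" for y
      by (simp add: A'A vec.neg)
    moreover have "- (A *v (- (A' *v x))) = x" for x
      using A' by (simp add: vec.neg matrix_vector_mul_assoc)
    ultimately show ?thesis unfolding D_def by (auto simp: image_iff) 
  qed
  have lin: "bounded_linear (\<lambda>x. - (A' *v x))"
    by (intro bounded_linear_minus) (simp add: linear_conv_bounded_linear[symmetric])
  have "bounded D"
    unfolding bij by (rule bounded_linear_image[OF bounded_box lin])
  have "open D"
  proof -
    have "continuous_on UNIV (\<lambda>y. - (A *v y))"
      by (intro continuous_intros linear_continuous_on) (simp add: linear_conv_bounded_linear[symmetric])
    then show ?thesis
      unfolding D_def using open_vimage[of ?S "\<lambda>y. - (A *v y)"] open_box by (auto simp: vimage_def)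
  qed
  have "0 \<in> D" unfolding D_def by (simp add: mem_box_cart)
  have Dm[measurable]: "D \<in> sets borel" using \<open>open D\<close> by auto
  have J: "?J = emeasure lborel D"
  proof -
    have "?J = (\<integral>\<^sup>+y. indicator D y \<partial>lborel)"
      by (intro nn_integral_cong) (simp add: D_def indicator_def)
    then show ?thesis by simp
  qed
  have J_fin: "?J < \<infinity>"
    unfolding J using emeasure_bounded_finite[OF \<open>bounded D\<close>] by simp
  have "negligible D \<Longrightarrow> False"
    using open_not_negligible[OF \<open>open D\<close>] \<open>0 \<in> D\<close> by auto
  then have J_pos: "0 < ?J"
  proof -
    have "D \<in> sets lebesgue" using Dm by simp
    then have "emeasure lebesgue D \<noteq> 0"
      using \<open>negligible D \<Longrightarrow> False\<close> negligible_iff_emeasure0 by blast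
    then show ?thesis unfolding J using Dm by (simp add: zero_less_iff_neq_zero)
  qed
  have S: "0 < emeasure lborel ?S" "emeasure lborel ?S < \<infinity>"
  proof -
    have "emeasure lborel ?S = ennreal (2 ^ CARD('n))"
      by (rule emeasure_lborel_symmetric_unit_box)
    then show "0 < emeasure lborel ?S" "emeasure lborel ?S < \<infinity>" by auto
  qed
  define s where "s = enn2real (emeasure lborel ?S)"
  define j where "j = enn2real ?J"
  have s: "emeasure lborel ?S = ennreal s" "s > 0"
    using S by (auto simp: s_def enn2real_positive_iff)
  have j: "?J = ennreal j" "j > 0"
    using J_pos J_fin by (auto simp: j_def enn2real_positive_iff)
  have sets: "(\<integral>\<^sup>+y. indicator T (A *v y) \<partial>lborel) = ennreal (j / s) * emeasure lborel T"
    if [measurable]: "T \<in> sets borel" for T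
  proof -
    have "ennreal s * (\<integral>\<^sup>+y. indicator T (A *v y) \<partial>lborel) = emeasure lborel T * ennreal j"
      using lborel_linear_uniqueness[OF assms, of ?S T] that unfolding j s by simp
    then have "ennreal (1/s) * (ennreal s * (\<integral>\<^sup>+y. indicator T (A *v y) \<partial>lborel))
        = ennreal (1/s) * (emeasure lborel T * ennreal j)" by simp
    then show ?thesis using s j
      by (simp add: mult.assoc[symmetric] ennreal_mult[symmetric])
         (simp add: divide_inverse ennreal_mult ac_simps)
  qed
  have eq: "distr lborel borel ((*v) A) = scale_measure (ennreal (j/s)) lborel"
  proof (rule measure_eqI)
    fix T assume "T \<in> sets (distr lborel borel ((*v) A))"
    then have T[measurable]: "T \<in> sets borel" by simp
    have "emeasure (distr lborel borel ((*v) A)) T = (\<integral>\<^sup>+y. indicator T y \<partial>distr lborel borel ((*v) A))"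
      by simp
    also have "\<dots> = (\<integral>\<^sup>+y. indicator T (A *v y) \<partial>lborel)"
      by (subst nn_integral_distr) auto
    finally show "emeasure (distr lborel borel ((*v) A)) T = emeasure (scale_measure (ennreal (j/s)) lborel) T"
      using sets[OF T] by simp
  qed simp
  show ?thesis
  proof (rule that[of "j / s"])
    show "0 < j / s" using s j by simp
    fix f :: "real^'n \<Rightarrow> ennreal" assume [measurable]: "f \<in> borel_measurable borel"
    have "(\<integral>\<^sup>+x. f (A *v x) \<partial>lborel) = (\<integral>\<^sup>+x. f x \<partial>distr lborel borel ((*v) A))"
      by (subst nn_integral_distr) auto
    also have "\<dots> = ennreal (j/s) * (\<integral>\<^sup>+x. f x \<partial>lborel)"
      unfolding eq by (subst nn_integral_scale_measure) auto
    finally show "(\<integral>\<^sup>+x. f (A *v x) \<partial>lborel) = ennreal (j/s) * (\<integral>\<^sup>+x. f x \<partial>lborel)" .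
  qed
qed

text \<open>The scaling factor of \<open>A\<close>, applied twice, must be the factor of the
  identity; hence its square is 1, and it is positive. Swaps of coordinates are involutions, and
  shears turn out to be products of two.\<close>

lemma nn_integral_lborel_involution:
  fixes A :: "real^'n^'n"
  assumes "A ** A = mat 1" and [measurable]: "f \<in> borel_measurable borel"
  shows "(\<integral>\<^sup>+x. f (A *v x) \<partial>lborel) = (\<integral>\<^sup>+x. f x \<partial>lborel)"
proof -
  have "invertible A" using assms unfolding invertible_def by auto
  then obtain c where c: "0 < c" "\<And>f. f \<in> borel_measurable borel \<Longrightarrow>
      (\<integral>\<^sup>+x. f (A *v x) \<partial>lborel) = ennreal c * (\<integral>\<^sup>+x. f x \<partial>lborel)"
    using distr_lborel_linear_scale by blast
  let ?S = "box (-1) (1::real^'n)"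
  let ?g = "indicator ?S :: _ \<Rightarrow> ennreal"
  have S: "emeasure lborel ?S = ennreal (2 ^ CARD('n))"
    by (rule emeasure_lborel_symmetric_unit_box)
  have "(\<integral>\<^sup>+x. ?g (A *v (A *v x)) \<partial>lborel) = ennreal c * (\<integral>\<^sup>+x. ?g (A *v x) \<partial>lborel)"
    by (rule c(2)) measurable
  also have "\<dots> = ennreal c * (ennreal c * (\<integral>\<^sup>+x. ?g x \<partial>lborel))"
    by (subst c(2)) auto
  finally have "ennreal (2 ^ CARD('n)) = ennreal (c * c * 2 ^ CARD('n))"
    using c(1) assms(1) S by (simp add: matrix_vector_mul_assoc ennreal_mult[symmetric] ac_simps)
  then have "c * c = 1" using c(1) by (subst (asm) ennreal_inj) auto
  then have "c = 1" using c(1) by (metis abs_of_pos abs_square_eq_1 power2_eq_square)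
  then show ?thesis using c(2)[OF assms(2)] by simp
qed

lemma nn_integral_lborel_swap:
  assumes "m \<noteq> n" "f \<in> borel_measurable borel"
  shows "(\<integral>\<^sup>+x. f ((\<chi> i j. mat 1 $ i $ Transposition.transpose m n j) *v (x::real^'n)) \<partial>lborel) = (\<integral>\<^sup>+x. f x \<partial>lborel)"
proof (rule nn_integral_lborel_involution[OF _ assms(2)])
  let ?T = "\<chi> i j. (mat 1 :: real^'n^'n) $ i $ Transposition.transpose m n j"
  have "?T *v x = (\<chi> i. x $ Transposition.transpose m n i)" for x
  proof -
    have "(\<Sum>j\<in>UNIV. (if i = Transposition.transpose m n j then 1 else 0) * x $ j) = x $ Transposition.transpose m n i" for i
    proof -
      have "(i = Transposition.transpose m n j) = (Transposition.transpose m n i = j)" for j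
        by (metis transpose_involutory)
      then show ?thesis by (simp add: if_distrib[of "\<lambda>c. c * _"] sum.delta' cong: if_cong)
    qed
    then show ?thesis
      by (simp add: matrix_vector_mult_def mat_def vec_eq_iff)
  qed
  then have "?T *v (?T *v x) = x" for x
    by (simp add: vec_eq_iff)
  then show "?T ** ?T = mat 1"
    by (simp add: matrix_eq matrix_vector_mul_assoc)
qed

lemma nn_integral_lborel_diagonal:
  fixes A :: "real^'n^'n"
  assumes A: "\<And>i j. i \<noteq> j \<Longrightarrow> A $ i $ j = 0" "det A \<noteq> 0" and [measurable]: "f \<in> borel_measurable borel"
  shows "(\<integral>\<^sup>+x. f x \<partial>lborel) = ennreal \<bar>det A\<bar> * (\<integral>\<^sup>+x. f (A *v x) \<partial>lborel)"
proof -
  define c where "c = (\<lambda>b::real^'n. (A *v b) \<bullet> b)"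
  have c_axis: "c (axis i 1) = A $ i $ i" for i
    by (simp add: c_def matrix_vector_mult_basis inner_axis column_def)
  have det: "det A = (\<Prod>i\<in>UNIV. A $ i $ i)"
    using A(1) by (rule det_diagonal)
  have B: "(Basis :: (real^'n) set) = (\<lambda>i. axis i 1) ` UNIV"
    by (auto simp: Basis_vec_def)
  have inj: "inj (\<lambda>i::'n. axis i (1::real))"
    by (auto simp: inj_on_def axis_eq_axis)
  have prod: "(\<Prod>j\<in>Basis. \<bar>c j\<bar>) = \<bar>det A\<bar>"
    unfolding B by (subst prod.reindex[OF inj]) (simp add: c_axis det abs_prod)
  have nz: "c j \<noteq> 0" if "j \<in> Basis" for j
    using that A(2) unfolding B det by (auto simp: c_axis)
  have T: "(\<Sum>j\<in>Basis. (c j * (x \<bullet> j)) *\<^sub>R j) = A *v x" for x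
  proof -
    have "(\<Sum>j\<in>Basis. (c j * (x \<bullet> j)) *\<^sub>R j) = (\<Sum>i\<in>UNIV. (A $ i $ i * x $ i) *\<^sub>R axis i 1)"
      unfolding B by (subst sum.reindex[OF inj]) (simp add: c_axis inner_axis)
    moreover have "(\<Sum>j\<in>UNIV. A $ k $ j * x $ j) = A $ k $ k * x $ k" for k
      by (subst sum.remove[of _ k]) (auto simp: A(1) intro!: sum.neutral)
    moreover have "(\<Sum>i\<in>UNIV. (A $ i $ i * x $ i) * axis i 1 $ k) = A $ k $ k * x $ k" for k
      by (subst sum.remove[of _ k]) (auto simp: axis_def intro!: sum.neutral)
    ultimately show ?thesis by (simp add: vec_eq_iff matrix_vector_mult_def)
  qed
  have "(\<integral>\<^sup>+x. f x \<partial>lborel) = (\<integral>\<^sup>+x. f x \<partial>density (distr lborel borel (\<lambda>x. 0 + (\<Sum>j\<in>Basis. (c j * (x \<bullet> j)) *\<^sub>R j)))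
        (\<lambda>_. (\<Prod>j\<in>Basis. \<bar>c j\<bar>)))"
    using lborel_affine_euclidean[of c 0] nz by simp
  also have "\<dots> = ennreal \<bar>det A\<bar> * (\<integral>\<^sup>+x. f (A *v x) \<partial>lborel)"
    unfolding T prod by (simp add: nn_integral_density nn_integral_distr nn_integral_cmult)
  finally show ?thesis .
qed

text \<open>The matrix \<open>D\<close> negates coordinate \<open>m\<close>, and
  \<open>A ** D\<close> sends it to its negative plus coordinate \<open>n\<close>. Both are
  involutions, and \<open>A\<close> is the product of \<open>A ** D\<close> and \<open>D\<close>, so
  two applications of the previous principle suffice and no volume is computed.\<close>

lemma nn_integral_lborel_shear:
  fixes m n :: "'n::finite"
  assumes mn: "m \<noteq> n" and [measurable]: "f \<in> borel_measurable borel"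
  defines "A \<equiv> (\<chi> i j. of_bool (i = m \<and> j = n \<or> i = j)) :: real^'n^'n"
  shows "(\<integral>\<^sup>+x. f (A *v x) \<partial>lborel) = (\<integral>\<^sup>+x. f x \<partial>lborel)"
proof -
  define D :: "real^'n^'n" where "D = (\<chi> i j. if i = j then if i = m then -1 else 1 else 0)"
  have Av: "A *v x = (\<chi> i. if i = m then x $ m + x $ n else x $ i)" for x
  proof -
    have "(\<Sum>j\<in>UNIV. of_bool (i = m \<and> j = n \<or> i = j) * x $ j) = (if i = m then x $ m + x $ n else x $ i)" for i
    proof -
      have "(\<Sum>j\<in>UNIV. of_bool (i = m \<and> j = n \<or> i = j) * x $ j)
         = (\<Sum>j\<in>UNIV. (if j = n then if i = m then x $ j else 0 else 0) + (if j = i then x $ j else 0))"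
        by (rule sum.cong) (use mn in auto)
      then show ?thesis by (simp add: sum.distrib)
    qed
    then show ?thesis by (simp add: A_def matrix_vector_mult_def vec_eq_iff)
  qed
  have Dv: "D *v x = (\<chi> i. if i = m then - x $ m else x $ i)" for x
    by (simp add: D_def matrix_vector_mult_def vec_eq_iff if_distrib[of "\<lambda>c. c * _"] sum.delta cong: if_cong)
  have DD: "D ** D = mat 1"
    by (simp add: matrix_eq matrix_vector_mul_assoc[symmetric] Dv vec_eq_iff)
  let ?E = "A ** D"
  have EE: "?E ** ?E = mat 1"
    using mn by (simp add: matrix_eq matrix_vector_mul_assoc[symmetric] Dv Av vec_eq_iff)
  have "A *v x = ?E *v (D *v x)" for x
    using DD by (simp add: matrix_vector_mul_assoc matrix_mul_assoc[symmetric])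
  then have "(\<integral>\<^sup>+x. f (A *v x) \<partial>lborel) = (\<integral>\<^sup>+x. f (?E *v (D *v x)) \<partial>lborel)" by simp
  also have "\<dots> = (\<integral>\<^sup>+x. f (?E *v x) \<partial>lborel)"
    by (rule nn_integral_lborel_involution[OF DD]) measurable
  also have "\<dots> = (\<integral>\<^sup>+x. f x \<partial>lborel)"
    by (rule nn_integral_lborel_involution[OF EE]) measurable
  finally show ?thesis .
qed

text \<open>Both sides are multiplicative in \<open>A\<close>, so a factorization into elementary
  matrices reduces the claim to diagonal matrices, swaps and shears. Matrices with a zero row are
  excluded by the determinant.\<close>

lemma nn_integral_lborel_linear:
  fixes A :: "real^'n^'n"
  assumes "det A \<noteq> 0" and "f \<in> borel_measurable borel"
  shows "(\<integral>\<^sup>+x. f x \<partial>lborel) = ennreal \<bar>det A\<bar> * (\<integral>\<^sup>+x. f (A *v x) \<partial>lborel)"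
proof -
  have "det A \<noteq> 0 \<longrightarrow> (\<forall>f\<in>borel_measurable borel.
    (\<integral>\<^sup>+x. f x \<partial>lborel) = ennreal \<bar>det A\<bar> * (\<integral>\<^sup>+x. f (A *v x) \<partial>lborel))"
  proof (induction A rule: induct_matrix_elementary_alt)
    case (1 A B)
    show ?case
    proof (intro impI ballI)
      fix f :: "real^'n \<Rightarrow> ennreal"
      assume d: "det (A ** B) \<noteq> 0" and f[measurable]: "f \<in> borel_measurable borel"
      have "(\<integral>\<^sup>+x. f x \<partial>lborel) = ennreal \<bar>det A\<bar> * (\<integral>\<^sup>+x. f (A *v x) \<partial>lborel)"
        using 1(1)[THEN mp, THEN bspec, OF _ f] d by (simp add: det_mul)
      also have "(\<integral>\<^sup>+x. f (A *v x) \<partial>lborel) = ennreal \<bar>det B\<bar> * (\<integral>\<^sup>+x. f (A *v (B *v x)) \<partial>lborel)"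
        using 1(2)[THEN mp, THEN bspec, of "\<lambda>x. f (A *v x)"] d by (simp add: det_mul)
      finally show "(\<integral>\<^sup>+x. f x \<partial>lborel) = ennreal \<bar>det (A ** B)\<bar> * (\<integral>\<^sup>+x. f (A ** B *v x) \<partial>lborel)"
        by (simp add: det_mul abs_mult ennreal_mult mult.assoc matrix_vector_mul_assoc)
    qed
  next
    case (2 A i)
    then show ?case using det_zero_row(1) by blast
  next
    case (3 A)
    then show ?case using nn_integral_lborel_diagonal by blast
  next
    case (4 m n)
    have "\<bar>det (\<chi> i j. mat 1 $ i $ Transposition.transpose m n j :: real^'n^'n)\<bar> = 1"
      by (simp add: det_permute_columns permutes_swap_id sign_swap_id abs_mult)
    then show ?case using nn_integral_lborel_swap[OF 4] by simp
  next
    case (5 m n)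
    let ?A = "\<chi> i j. of_bool (i = m \<and> j = n \<or> i = j) :: real^'n^'n"
    have "?A = (\<chi> k. if k = m then row m (mat 1) + 1 *s row n (mat 1) else row k (mat 1))"
      using 5 by (auto simp: vec_eq_iff row_def mat_def)
    then have "det ?A = 1" using det_row_operation[OF 5, of "mat 1" 1] by simp
    then show ?case using nn_integral_lborel_shear[OF 5] by simp
  qed
  then show ?thesis using assms by blast
qed

text \<open>For the completed measures even measurability is a claim about null sets: preimages of
  Lebesgue null sets must be measurable, which holds because \<open>T\<close> preserves
  \<open>lborel\<close> and hence its null sets.\<close>

lemma
  fixes T :: "'a::euclidean_space \<Rightarrow> 'a"
  assumes T[measurable]: "T \<in> borel \<rightarrow>\<^sub>M borel" and eq: "distr lborel borel T = lborel"
  shows lebesgue_measurable_preserving: "T \<in> lebesgue \<rightarrow>\<^sub>M lebesgue"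
    and distr_lebesgue_preserving: "distr lebesgue lebesgue T = lebesgue"
proof -
  have "distr lebesgue lborel T = lborel"
    using eq T by (simp add: distr_completion cong: distr_cong)
  then have n: "null_sets lborel = null_sets (distr lebesgue lborel T)" by simp
  show "T \<in> lebesgue \<rightarrow>\<^sub>M lebesgue"
    using T by (simp add: completion.measurable_completion2 n measurable_completion)
  have "distr lebesgue lebesgue T = completion (distr lebesgue lborel T)"
    by (subst completion.completion_distr_eq) (use n in \<open>auto simp: measurable_completion\<close>)
  also have "\<dots> = lebesgue" using \<open>distr lebesgue lborel T = lborel\<close> by simp
  finally show "distr lebesgue lebesgue T = lebesgue" .
qed

lemma
  fixes A :: "real^'n^'n"
  assumes "det A = 1"
  shows lebesgue_measurable_unimodular: "(\<lambda>x. A *v x) \<in> lebesgue \<rightarrow>\<^sub>M lebesgue"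
    and distr_lebesgue_unimodular: "distr lebesgue lebesgue (\<lambda>x. A *v x) = lebesgue"
proof -
  have eq: "distr lborel borel (\<lambda>x. A *v x) = lborel"
  proof (rule measure_eqI)
    fix S assume "S \<in> sets (distr lborel borel ((*v) A))"
    then have [measurable]: "S \<in> sets borel" by simp
    have "emeasure (distr lborel borel ((*v) A)) S = (\<integral>\<^sup>+y. indicator S y \<partial>distr lborel borel ((*v) A))"
      by simp
    also have "\<dots> = (\<integral>\<^sup>+y. indicator S (A *v y) \<partial>lborel)"
      by (subst nn_integral_distr) auto
    also have "\<dots> = emeasure lborel S"
      using nn_integral_lborel_linear[of A "indicator S"] assms by simp
    finally show "emeasure (distr lborel borel ((*v) A)) S = emeasure lborel S" .
  qed simp
  show "(\<lambda>x. A *v x) \<in> lebesgue \<rightarrow>\<^sub>M lebesgue" "distr lebesgue lebesgue (\<lambda>x. A *v x) = lebesgue"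
    using lebesgue_measurable_preserving[OF _ eq] distr_lebesgue_preserving[OF _ eq] by auto
qed

lemma
  fixes t :: "'a::euclidean_space"
  shows lebesgue_measurable_translation: "(\<lambda>x. x + t) \<in> lebesgue \<rightarrow>\<^sub>M lebesgue"
    and distr_lebesgue_translation: "distr lebesgue lebesgue (\<lambda>x. x + t) = lebesgue"
proof -
  have eq: "distr lborel borel (\<lambda>x. x + t) = lborel"
  proof -
    have "(+) t = (\<lambda>x. x + t)" by (simp add: fun_eq_iff add.commute)
    then show ?thesis using lborel_distr_plus[of t] by simp
  qed
  show "(\<lambda>x. x + t) \<in> lebesgue \<rightarrow>\<^sub>M lebesgue" "distr lebesgue lebesgue (\<lambda>x. x + t) = lebesgue"
    using lebesgue_measurable_preserving[OF _ eq] distr_lebesgue_preserving[OF _ eq] by auto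
qed

section \<open>Extended real powers and integrals of powers\<close>

lemma epowr_ennreal: "0 \<le> r \<Longrightarrow> 0 < a \<Longrightarrow> ennreal r epowr a = ennreal (r powr a)"
  by (auto simp: ennpowr_def ennreal_eq_0_iff)

lemma epowr_ennreal_pos: "0 < r \<Longrightarrow> ennreal r epowr a = ennreal (r powr a)"
  by (auto simp: ennpowr_def ennreal_eq_0_iff)

lemma epowr_0_left: "0 epowr a = (if a = 0 then 1 else if 0 < a then 0 else \<infinity>)"
  by (simp add: ennpowr_def)

lemma epowr_top: "top epowr a = (if a = 0 then 1 else if 0 < a then \<infinity> else 0)"
  by (simp add: ennpowr_def)

lemma ennreal_cases3:
  obtains "x = 0" | r where "x = ennreal r" "0 < r" | "x = (\<infinity> :: ennreal)"
  by (metis ennreal_cases ennreal_0 infinity_ennreal_def less_eq_real_def)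

lemma epowr_1 [simp]: "x epowr 1 = x"
  by (cases x rule: ennreal_cases3) (auto simp: epowr_ennreal_pos epowr_0_left epowr_top)

lemma epowr_epowr: "(x epowr a) epowr b = x epowr (a * b)"
proof (cases x rule: ennreal_cases3)
  case (2 r)
  then have "0 < r powr a" by simp
  with 2 show ?thesis by (simp add: epowr_ennreal_pos powr_powr)
qed (auto simp: ennpowr_def zero_less_mult_iff)

lemma epowr_mono:
  assumes "0 \<le> a" "x \<le> y"
  shows "x epowr a \<le> y epowr a"
proof (cases "a = 0 \<or> x = 0 \<or> y = \<infinity>")
  case True
  then show ?thesis using assms by (auto simp: ennpowr_def)
next
  case False
  then obtain r s where "x = ennreal r" "0 < r" "y = ennreal s" "0 < s"
    using assms(2) by (cases x rule: ennreal_cases3; cases y rule: ennreal_cases3) (auto simp: top_unique)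
  then show ?thesis using assms by (simp add: epowr_ennreal_pos ennreal_le_iff powr_mono2)
qed

lemma epowr_antimono:
  assumes "a \<le> 0" "x \<le> y"
  shows "y epowr a \<le> x epowr a"
proof (cases "a = 0 \<or> x = 0 \<or> y = \<infinity>")
  case True
  then show ?thesis using assms by (auto simp: ennpowr_def)
next
  case False
  then obtain r s where "x = ennreal r" "0 < r" "y = ennreal s" "0 < s"
    using assms(2) by (cases x rule: ennreal_cases3; cases y rule: ennreal_cases3) (auto simp: top_unique)
  then show ?thesis using assms by (simp add: epowr_ennreal_pos ennreal_le_iff powr_mono2')
qed

lemma epowr_cmult: "0 < r \<Longrightarrow> (ennreal r * x) epowr a = ennreal (r powr a) * x epowr a"
  by (cases x rule: ennreal_cases3)
     (auto simp: epowr_0_left epowr_top epowr_ennreal_pos ennreal_mult[symmetric] powr_mult ennreal_mult_top)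

lemma measurable_epowr [measurable]:
  assumes [measurable]: "f \<in> borel_measurable M"
  shows "(\<lambda>x. f x epowr a) \<in> borel_measurable M"
  unfolding ennpowr_def by measurable

text \<open>The \<open>p\<close>-th power of the norm. Estimates are made at this level because
  integrals add up, whereas the root taken in \<open>Lp_norm\<close> would have to be removed each
  time.\<close>

definition Lp_integral :: "real \<Rightarrow> (real ^ 'n \<Rightarrow> 'b::real_normed_vector) \<Rightarrow> ennreal" where
  "Lp_integral p f = (\<integral>\<^sup>+ x. ennreal (norm (f x) powr p) \<partial>lebesgue)"

lemma Lp_norm_eq: "0 < p \<Longrightarrow> Lp_norm p f = Lp_integral p f epowr (1 / p)"
  by (simp add: Lp_norm_def Lp_integral_def epowr_ennreal)

lemma Lp_norm_epowr: "0 < p \<Longrightarrow> Lp_norm p f epowr a = Lp_integral p f epowr (a / p)"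
  by (simp add: Lp_norm_eq epowr_epowr)

lemma Lp_integral_cong_AE: "AE x in lebesgue. f x = g x \<Longrightarrow> Lp_integral p f = Lp_integral p g"
  unfolding Lp_integral_def by (rule nn_integral_cong_AE) auto

lemma Lp_norm_cong_AE: "AE x in lebesgue. f x = g x \<Longrightarrow> Lp_norm p f = Lp_norm p g"
  unfolding Lp_norm_def by (intro arg_cong[where f="\<lambda>x. x epowr _"] nn_integral_cong_AE) auto

lemma Lp_integral_unimodular:
  fixes A :: "real^'n^'n" and f :: "real^'n \<Rightarrow> 'b::euclidean_space"
  assumes A: "det A = 1" and [measurable]: "f \<in> borel_measurable lebesgue"
  shows "Lp_integral p (\<lambda>x. f (A *v x)) = Lp_integral p f"
proof -
  have "Lp_integral p f = (\<integral>\<^sup>+ x. ennreal (norm (f x) powr p) \<partial>distr lebesgue lebesgue (\<lambda>x. A *v x))"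
    by (simp add: Lp_integral_def distr_lebesgue_unimodular[OF A])
  also have "\<dots> = Lp_integral p (\<lambda>x. f (A *v x))"
    unfolding Lp_integral_def
    by (subst nn_integral_distr) (use lebesgue_measurable_unimodular[OF A] in auto)
  finally show ?thesis by simp
qed

section \<open>Smooth functions and test functions\<close>

definition grad :: "(real ^ 'n \<Rightarrow> real) \<Rightarrow> real ^ 'n \<Rightarrow> real ^ 'n" where
  "grad f x = (\<chi> i. partial_deriv i f x)"

lemma grad_nth [simp]: "grad f x $ i = partial_deriv i f x"
  by (simp add: grad_def)

lemma grad_eqI:
  assumes "(f has_derivative (\<lambda>v. v \<bullet> g)) (at x)"
  shows "grad f x = g"
  using frechet_derivative_at[OF assms, symmetric]
  by (simp add: vec_eq_iff partial_deriv_def inner_axis')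

lemma differentiable_has_derivative_grad:
  assumes "f differentiable (at x)"
  shows "(f has_derivative (\<lambda>v. v \<bullet> grad f x)) (at x)"
proof -
  let ?D = "frechet_derivative f (at x)"
  have D: "(f has_derivative ?D) (at x)"
    using assms by (simp add: frechet_derivative_works)
  have lin: "linear ?D" using D by (rule has_derivative_linear)
  have "?D v = v \<bullet> grad f x" for v
  proof -
    have "?D v = ?D (\<Sum>i\<in>UNIV. (v $ i) *\<^sub>R axis i 1)"
      by (simp add: vector_matrix_mul_rid[symmetric] basis_expansion[of v, unfolded scalar_mult_eq_scaleR])
    also have "\<dots> = (\<Sum>i\<in>UNIV. v $ i * ?D (axis i 1))"
      by (simp add: linear_sum[OF lin] linear_scale[OF lin])
    finally show ?thesis by (simp add: inner_vec_def partial_deriv_def)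
  qed
  then have "?D = (\<lambda>v. v \<bullet> grad f x)" by auto
  with D show ?thesis by simp
qed

lemma Ck_has_derivative: "Ck (Suc k) f \<Longrightarrow> (f has_derivative (\<lambda>v. v \<bullet> grad f x)) (at x)"
  by (rule differentiable_has_derivative_grad) (auto simp: differentiable_on_def)

lemma Ck_SucI:
  assumes "\<And>x. (f has_derivative (\<lambda>v. v \<bullet> g x)) (at x)" "\<And>i. Ck k (\<lambda>x. g x $ i)"
  shows "Ck (Suc k) f"
proof -
  have "f differentiable_on UNIV"
    using assms(1) unfolding differentiable_on_def differentiable_def by blast
  moreover have "partial_deriv i f = (\<lambda>x. g x $ i)" for i
    using grad_eqI[OF assms(1)] by (metis grad_nth ext)
  ultimately show ?thesis using assms(2) by simp
qed

lemma Ck_Suc_partial: "Ck (Suc k) f \<Longrightarrow> Ck k (partial_deriv i f)"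
  by simp

lemma Ck_continuous_on: "Ck k f \<Longrightarrow> continuous_on UNIV f"
  by (cases k) (simp_all add: differentiable_imp_continuous_on)

lemma Ck_continuous_grad: "Ck (Suc k) f \<Longrightarrow> continuous_on UNIV (grad f)"
  unfolding grad_def by (intro continuous_on_vec_lambda) (auto intro: Ck_continuous_on)

lemma Ck_antimono_Suc: "Ck (Suc k) f \<Longrightarrow> Ck k f"
proof (induction k arbitrary: f)
  case 0
  then show ?case using Ck_continuous_on[OF 0] by simp
qed simp

lemma Ck_const: "Ck k (\<lambda>x::real^'n. c)"
proof (induction k arbitrary: c)
  case (Suc k)
  have "Ck k (\<lambda>x::real^'n. 0)" by (rule Suc)
  then show ?case by (intro Ck_SucI[of _ "\<lambda>_. 0"]) auto
qed simp

lemma Ck_add: "Ck k f \<Longrightarrow> Ck k g \<Longrightarrow> Ck k (\<lambda>x. f x + g x)"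
proof (induction k arbitrary: f g)
  case 0
  then show ?case by (auto intro: continuous_intros)
next
  case (Suc k)
  show ?case
  proof (rule Ck_SucI)
    show "((\<lambda>x. f x + g x) has_derivative (\<lambda>v. v \<bullet> (grad f x + grad g x))) (at x)" for x
      unfolding inner_add_right
      using has_derivative_add[OF Ck_has_derivative[OF Suc.prems(1)] Ck_has_derivative[OF Suc.prems(2)]] .
    show "Ck k (\<lambda>x. (grad f x + grad g x) $ i)" for i
      using Suc by simp
  qed
qed

lemma Ck_mult: "Ck k f \<Longrightarrow> Ck k g \<Longrightarrow> Ck k (\<lambda>x. f x * g x)"
proof (induction k arbitrary: f g)
  case 0
  then show ?case by (auto intro: continuous_intros)
next
  case (Suc k)
  show ?case
  proof (rule Ck_SucI)
    show "((\<lambda>x. f x * g x) has_derivative (\<lambda>v. v \<bullet> (f x *\<^sub>R grad g x + g x *\<^sub>R grad f x))) (at x)" for x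
      using has_derivative_mult[OF Ck_has_derivative[OF Suc.prems(1)] Ck_has_derivative[OF Suc.prems(2)], of x]
      by (simp add: inner_add_right mult.commute)
    show "Ck k (\<lambda>x. (f x *\<^sub>R grad g x + g x *\<^sub>R grad f x) $ i)" for i
      using Ck_add[OF Suc.IH[OF Ck_antimono_Suc[OF Suc.prems(1)] Ck_Suc_partial[OF Suc.prems(2)]]
          Suc.IH[OF Ck_antimono_Suc[OF Suc.prems(2)] Ck_Suc_partial[OF Suc.prems(1)]]] by simp
  qed
qed

lemma Ck_cmult: "Ck k f \<Longrightarrow> Ck k (\<lambda>x. c * f x)"
  by (intro Ck_mult Ck_const)

lemma Ck_sum: "(\<And>i. i \<in> I \<Longrightarrow> Ck k (f i)) \<Longrightarrow> Ck k (\<lambda>x. \<Sum>i\<in>I. f i x)"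
  by (induction I rule: infinite_finite_induct) (auto intro!: Ck_const Ck_add)

lemma Ck_prod: "(\<And>i. i \<in> I \<Longrightarrow> Ck k (f i)) \<Longrightarrow> Ck k (\<lambda>x. \<Prod>i\<in>I. f i x)"
  by (induction I rule: infinite_finite_induct) (auto intro!: Ck_const Ck_mult)

lemma Ck_power: "Ck k f \<Longrightarrow> Ck k (\<lambda>x. f x ^ m)"
  by (induction m) (auto intro!: Ck_const Ck_mult)

lemma inner_transpose_matrix_vector: "v \<bullet> (transpose A *v g) = (A *v v) \<bullet> (g :: real^'n)"
  by (metis dot_lmul_matrix inner_commute transpose_matrix_vector)

lemma Ck_affine: "Ck k f \<Longrightarrow> Ck k (\<lambda>x. f (A *v x + b))"
proof (induction k arbitrary: f)
  case 0
  have "continuous_on UNIV (\<lambda>x. A *v x + b)"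
    by (intro continuous_on_add linear_continuous_on continuous_on_const)
       (simp add: linear_conv_bounded_linear[symmetric])
  with 0 show ?case
    using continuous_on_compose2[of UNIV f UNIV "\<lambda>x. A *v x + b"] by simp
next
  case (Suc k)
  show ?case
  proof (rule Ck_SucI)
    fix x
    have "((\<lambda>x. A *v x + b) has_derivative (\<lambda>v. A *v v)) (at x)"
      by (auto intro!: derivative_eq_intros bounded_linear_imp_has_derivative
          simp: linear_conv_bounded_linear[symmetric])
    from has_derivative_compose[OF this Ck_has_derivative[OF Suc.prems, of "A *v x + b"]]
    show "((\<lambda>x. f (A *v x + b)) has_derivative (\<lambda>v. v \<bullet> (transpose A *v grad f (A *v x + b)))) (at x)"
      by (simp only: inner_transpose_matrix_vector)
    show "Ck k (\<lambda>x. (transpose A *v grad f (A *v x + b)) $ i)" for i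
      using Suc by (auto simp: matrix_vector_mult_def intro!: Ck_sum Ck_cmult)
  qed
qed

lemma grad_affine:
  assumes "f differentiable (at (A *v x + b))"
  shows "grad (\<lambda>x. f (A *v x + b)) x = transpose A *v grad f (A *v x + b)"
proof (rule grad_eqI)
  have "((\<lambda>x. A *v x + b) has_derivative (\<lambda>v. A *v v)) (at x)"
    by (auto intro!: derivative_eq_intros bounded_linear_imp_has_derivative
        simp: linear_conv_bounded_linear[symmetric])
  from has_derivative_compose[OF this differentiable_has_derivative_grad[OF assms]]
  show "((\<lambda>x. f (A *v x + b)) has_derivative (\<lambda>v. v \<bullet> (transpose A *v grad f (A *v x + b)))) (at x)"
    by (simp only: inner_transpose_matrix_vector)
qed

lemma grad_mult:
  assumes "f differentiable (at x)" "g differentiable (at x)"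
  shows "grad (\<lambda>x. f x * g x) x = f x *\<^sub>R grad g x + g x *\<^sub>R grad f x"
  using has_derivative_mult[OF assms[THEN differentiable_has_derivative_grad]]
  by (intro grad_eqI) (simp add: inner_add_right mult.commute)

definition smooth :: "(real ^ 'n \<Rightarrow> real) \<Rightarrow> bool" where
  "smooth f \<longleftrightarrow> (\<forall>k. Ck k f)"

lemma smooth_Ck: "smooth f \<Longrightarrow> Ck k f"
  by (simp add: smooth_def)

lemma smooth_partial_deriv: "smooth f \<Longrightarrow> smooth (partial_deriv i f)"
  unfolding smooth_def using Ck.simps(2) by blast

lemma smooth_differentiable: "smooth f \<Longrightarrow> f differentiable (at x)"
  using Ck_has_derivative[of 0 f x] by (auto simp: smooth_def differentiable_def)

lemma smooth_grad: "smooth f \<Longrightarrow> smooth (\<lambda>x. v \<bullet> grad f x)"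
  unfolding inner_vec_def smooth_def inner_real_def grad_nth
  by (intro allI Ck_sum Ck_cmult) (use Ck.simps(2) in blast)

lemma Cc_infinity_UNIV_iff: "\<psi> \<in> Cc_infinity UNIV \<longleftrightarrow> smooth \<psi> \<and> bounded {x. \<psi> x \<noteq> 0}"
  by (simp add: Cc_infinity_def smooth_def compact_closure)

lemma Cc_infinity_mult:
  assumes "smooth f" "\<psi> \<in> Cc_infinity UNIV"
  shows "(\<lambda>x. f x * \<psi> x) \<in> Cc_infinity UNIV"
  using assms unfolding Cc_infinity_UNIV_iff smooth_def
  by (auto intro: Ck_mult elim: bounded_subset)

lemma Cc_infinity_affine:
  assumes "det A \<noteq> 0" "\<psi> \<in> Cc_infinity UNIV"
  shows "(\<lambda>x. \<psi> (A *v x + b)) \<in> Cc_infinity UNIV"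
proof -
  obtain A' where A': "A' ** A = mat 1"
    using assms(1) invertible_det_nz unfolding invertible_def by blast
  have "{x. \<psi> (A *v x + b) \<noteq> 0} \<subseteq> (\<lambda>y. A' *v (y - b)) ` {x. \<psi> x \<noteq> 0}"
  proof
    fix x assume "x \<in> {x. \<psi> (A *v x + b) \<noteq> 0}"
    moreover have "x = A' *v ((A *v x + b) - b)"
      using A' by (simp add: matrix_vector_mul_assoc)
    ultimately show "x \<in> (\<lambda>y. A' *v (y - b)) ` {x. \<psi> x \<noteq> 0}" by blast
  qed
  moreover have "bounded ((\<lambda>y. A' *v (y - b)) ` {x. \<psi> x \<noteq> 0})"
  proof -
    have "bounded ((\<lambda>y. - b + y) ` {x. \<psi> x \<noteq> 0})"
      using assms(2) by (intro bounded_translation) (simp add: Cc_infinity_UNIV_iff)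
    from bounded_linear_image[OF this, of "\<lambda>x. A' *v x"] show ?thesis
      by (simp add: image_image linear_conv_bounded_linear[symmetric])
  qed
  ultimately show ?thesis
    using assms(2) unfolding Cc_infinity_UNIV_iff smooth_def
    by (auto intro: Ck_affine bounded_subset)
qed

lemma partial_deriv_eq_0:
  assumes "x \<notin> closure {x. \<psi> x \<noteq> 0}"
  shows "partial_deriv i \<psi> x = 0"
proof -
  have "(\<psi> has_derivative (\<lambda>_. 0)) (at x)"
  proof (rule has_derivative_transform_within_open[where f="\<lambda>_. 0" and s="- closure {x. \<psi> x \<noteq> 0}"])
    show "0 = \<psi> y" if "y \<in> - closure {x. \<psi> x \<noteq> 0}" for y
    proof -
      have "y \<notin> {x. \<psi> x \<noteq> 0}" 
        using that subsetD[OF closure_subset[of "{x. \<psi> x \<noteq> 0}"], of y] by auto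
      then show ?thesis by simp
    qed
  qed (use assms in auto)
  then show ?thesis
    using frechet_derivative_at unfolding partial_deriv_def by metis
qed

lemma bounded_support_partial_deriv:
  assumes "bounded {x. \<psi> x \<noteq> 0}"
  shows "bounded {x. partial_deriv i \<psi> x \<noteq> 0}"
proof (rule bounded_subset)
  show "bounded (closure {x. \<psi> x \<noteq> 0})" using assms by (rule bounded_closure)
  show "{x. partial_deriv i \<psi> x \<noteq> 0} \<subseteq> closure {x. \<psi> x \<noteq> 0}"
    using partial_deriv_eq_0 by blast
qed

lemma Cc_infinity_grad:
  assumes "\<psi> \<in> Cc_infinity UNIV"
  shows "(\<lambda>x. v \<bullet> grad \<psi> x) \<in> Cc_infinity UNIV"
proof -
  have "grad \<psi> x = 0" if "x \<notin> closure {x. \<psi> x \<noteq> 0}" for x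
    using partial_deriv_eq_0[OF that] by (simp add: vec_eq_iff)
  then have "{x. v \<bullet> grad \<psi> x \<noteq> 0} \<subseteq> closure {x. \<psi> x \<noteq> 0}" by force
  then show ?thesis
    using assms smooth_grad bounded_closure bounded_subset unfolding Cc_infinity_UNIV_iff by metis
qed

text \<open>For \<open>m = 0\<close> this is the standard flat function; its derivatives are linear combinations of the others.\<close>

definition flat :: "nat \<Rightarrow> real \<Rightarrow> real" where
  "flat m t = (if 0 < t then inverse t ^ m * exp (- inverse t) else 0)"

lemma flat_tendsto_0: "((\<lambda>h. flat m h) \<longlongrightarrow> 0) (at 0)"
proof -
  have "((\<lambda>h. flat m h) \<longlongrightarrow> 0) (at_left 0)"
    by (rule tendsto_eventually) (auto simp: flat_def eventually_at_filter)
  moreover have "((\<lambda>h. flat m h) \<longlongrightarrow> 0) (at_right 0)"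
    unfolding filterlim_at_right_to_top
  proof (rule Lim_transform_eventually)
    show "((\<lambda>x::real. x ^ m / exp x) \<longlongrightarrow> 0) at_top" by (rule tendsto_power_div_exp_0)
    show "\<forall>\<^sub>F x in at_top. x ^ m / exp x = flat m (inverse x)"
      using eventually_gt_at_top[of 0]
      by eventually_elim (simp add: flat_def exp_minus divide_inverse)
  qed
  ultimately show ?thesis by (simp add: filterlim_split_at_real)
qed

lemma flat_DERIV: "(flat m has_real_derivative (flat (m + 2) t - m * flat (m + 1) t)) (at t)"
proof (cases t "0::real" rule: linorder_cases)
  case less
  have "((\<lambda>_. 0) has_real_derivative 0) (at t)" by simp
  then have "(flat m has_real_derivative 0) (at t)"
    by (rule has_field_derivative_transform_within_open[where S="{..<0}"]) (use less in \<open>auto simp: flat_def\<close>)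
  then show ?thesis using less by (simp add: flat_def)
next
  case equal
  \<comment> \<open>At the origin the difference quotient is again a member of the family,
    \<open>flat (Suc m) h\<close>, so its limit is already known.\<close>
  have "((\<lambda>h. (flat m (0 + h) - flat m 0) / h) \<longlongrightarrow> 0) (at 0)"
  proof (rule Lim_transform_eventually[OF flat_tendsto_0[of "Suc m"]])
    show "\<forall>\<^sub>F h in at 0. flat (Suc m) h = (flat m (0 + h) - flat m 0) / h"
      by (rule always_eventually) (simp add: flat_def divide_inverse)
  qed
  then show ?thesis using equal by (simp add: DERIV_def flat_def)
next
  case greater
  have "((\<lambda>t. inverse t ^ m * exp (- inverse t)) has_real_derivative
      (flat (m + 2) t - m * flat (m + 1) t)) (at t)"
    using greater
    by (auto intro!: derivative_eq_intros simp: flat_def)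
       (cases m; simp add: field_simps power2_eq_square)
  then show ?thesis
    by (rule has_field_derivative_transform_within_open[where S="{0<..}"]) (use greater in \<open>auto simp: flat_def\<close>)
qed

lemma Ck_flat: "Ck k (\<lambda>x::real^'n. flat m (c * x $ i + d))"
proof (induction k arbitrary: m)
  case 0
  have "continuous_on UNIV (flat m)"
    by (rule DERIV_continuous_on) (rule has_field_derivative_at_within, rule flat_DERIV)
  then show ?case by (auto intro!: continuous_intros continuous_on_compose2[of UNIV "flat m"])
next
  case (Suc k)
  let ?g = "\<lambda>x::real^'n. (flat (m + 2) (c * x $ i + d) - m * flat (m + 1) (c * x $ i + d)) * c"
  show ?case
  proof (rule Ck_SucI)
    fix x :: "real^'n"
    have "((\<lambda>x. c * x $ i + d) has_derivative (\<lambda>v. c * v $ i)) (at x)"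
      by (auto intro!: derivative_eq_intros bounded_linear_imp_has_derivative[OF bounded_linear_vec_nth])
    from has_derivative_compose[OF this flat_DERIV[unfolded has_field_derivative_def]]
    show "((\<lambda>x. flat m (c * x $ i + d)) has_derivative (\<lambda>v. v \<bullet> (?g x *\<^sub>R axis i 1))) (at x)"
      by (simp add: inner_axis mult.assoc mult.left_commute)
    show "Ck k (\<lambda>x. (?g x *\<^sub>R axis i 1) $ j)" for j
    proof (cases "i = j")
      case True
      have "Ck k (\<lambda>x. c * flat (m + 2) (c * x $ i + d) + (- c * m) * flat (m + 1) (c * x $ i + d))"
        by (intro Ck_add Ck_cmult Suc)
      then show ?thesis using True by (simp add: algebra_simps)
    qed (auto simp: axis_def intro: Ck_const)
  qed
qed

section \<open>Smooth approximation of indicators of boxes\<close>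

lemma flat_0_bounds: "0 \<le> flat 0 t" "flat 0 t \<le> 1" "t \<le> 0 \<Longrightarrow> flat 0 t = 0"
  by (auto simp: flat_def)

lemma flat_0_LIMSEQ:
  assumes "0 < t"
  shows "(\<lambda>k. flat 0 (real (Suc k) * t)) \<longlonglongrightarrow> 1"
proof -
  have "(\<lambda>k. exp (- (inverse (real (Suc k)) * inverse t))) \<longlonglongrightarrow> exp (- (0 * inverse t))"
    by (intro tendsto_intros LIMSEQ_inverse_real_of_nat)
  then show ?thesis using assms by (simp add: flat_def)
qed

text \<open>The factor \<open>Suc k\<close> steepens the flat functions at the faces of the box, so
  that the bumps converge pointwise to the indicator of the open box while keeping their support
  inside it. This supplies test functions without convolution.\<close>

definition box_bump :: "nat \<Rightarrow> real^'n \<Rightarrow> real^'n \<Rightarrow> real^'n \<Rightarrow> real" where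
  "box_bump k a b x = (\<Prod>i\<in>UNIV. flat 0 (real (Suc k) * (x $ i - a $ i)) * flat 0 (real (Suc k) * (b $ i - x $ i)))"

lemma box_bump_outside:
  assumes "x \<notin> box a b"
  shows "box_bump k a b x = 0"
proof -
  obtain i where "x $ i \<le> a $ i \<or> b $ i \<le> x $ i"
    using assms by (auto simp: mem_box_cart not_less)
  then have "flat 0 (real (Suc k) * (x $ i - a $ i)) * flat 0 (real (Suc k) * (b $ i - x $ i)) = 0"
    by (auto simp: flat_def zero_less_mult_iff)
  then show ?thesis unfolding box_bump_def by (intro prod_zero) auto
qed

lemma box_bump_bounds: "0 \<le> box_bump k a b x" "box_bump k a b x \<le> 1"
  unfolding box_bump_def using flat_0_bounds
  by (auto intro!: prod_nonneg prod_le_1 mult_nonneg_nonneg mult_le_one)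

lemma box_bump_LIMSEQ: "(\<lambda>k. box_bump k a b x) \<longlonglongrightarrow> indicator (box a b) x"
proof (cases "x \<in> box a b")
  case True
  then have "(\<lambda>k. box_bump k a b x) \<longlonglongrightarrow> (\<Prod>i\<in>(UNIV::'a set). 1 * 1)"
    unfolding box_bump_def by (intro tendsto_prod tendsto_mult flat_0_LIMSEQ) (auto simp: mem_box_cart)
  with True show ?thesis by simp
qed (simp add: box_bump_outside)

lemma box_bump_Cc_infinity: "box_bump k a b \<in> Cc_infinity UNIV"
proof -
  have "smooth (box_bump k a b)"
    unfolding smooth_def box_bump_def
  proof (intro allI Ck_prod Ck_mult)
    fix l and i :: 'a
    show "Ck l (\<lambda>x. flat 0 (real (Suc k) * (x $ i - a $ i)))"
      using Ck_flat[of l 0 "real (Suc k)" i "- real (Suc k) * a $ i"] by (simp add: algebra_simps)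
    show "Ck l (\<lambda>x. flat 0 (real (Suc k) * (b $ i - x $ i)))"
      using Ck_flat[of l 0 "- real (Suc k)" i "real (Suc k) * b $ i"] by (simp add: algebra_simps)
  qed
  moreover have "{x. box_bump k a b x \<noteq> 0} \<subseteq> box a b"
    using box_bump_outside by blast
  ultimately show ?thesis
    unfolding Cc_infinity_UNIV_iff using bounded_subset bounded_box by blast
qed

section \<open>Weak gradients\<close>

lemma L1_loc_measurable:
  fixes f :: "real ^ 'n \<Rightarrow> 'b::euclidean_space"
  assumes "L1_loc f"
  shows "f \<in> borel_measurable lebesgue"
proof (rule borel_measurable_LIMSEQ_metric)
  fix k :: nat
  show "(\<lambda>x. indicator (cball 0 (real k)) x *\<^sub>R f x) \<in> borel_measurable lebesgue"
    by (rule borel_measurable_integrable) (use assms in \<open>simp add: L1_loc_def set_integrable_def\<close>)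
next
  fix x :: "real ^ 'n"
  obtain m where m: "norm x \<le> real m" using real_arch_simple by blast
  have "eventually (\<lambda>k. indicator (cball 0 (real k)) x *\<^sub>R f x = f x) sequentially"
    by (rule eventually_sequentiallyI[of m]) (use m in auto)
  then show "(\<lambda>k. indicator (cball 0 (real k)) x *\<^sub>R f x) \<longlonglongrightarrow> f x"
    by (rule tendsto_eventually)
qed

lemma L1_loc_mult_indicator:
  assumes "L1_loc f" "bounded S" "S \<in> sets lebesgue"
  shows "integrable lebesgue (\<lambda>x. indicator S x *\<^sub>R f x)"
proof -
  have "set_integrable lebesgue (closure S) f"
    using assms unfolding L1_loc_def by (simp add: compact_closure)
  then have "set_integrable lebesgue S f"
    by (rule set_integrable_subset) (use assms closure_subset in auto)
  then show ?thesis by (simp add: set_integrable_def)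
qed

lemma L1_loc_integrable_mult:
  fixes f g :: "real ^ 'n \<Rightarrow> real"
  assumes f: "L1_loc f" and g: "continuous_on UNIV g" "bounded {x. g x \<noteq> 0}"
  shows "integrable lebesgue (\<lambda>x. f x * g x)"
proof -
  let ?K = "closure {x. g x \<noteq> 0}"
  have K: "compact ?K" using g by (simp add: compact_closure)
  have gm: "g \<in> borel_measurable lebesgue"
    using g by (simp add: borel_measurable_continuous_onI measurable_completion)
  have "bounded (g ` ?K)"
    using K g by (intro compact_imp_bounded compact_continuous_image) (auto intro: continuous_on_subset)
  then obtain C where C: "\<And>x. x \<in> ?K \<Longrightarrow> \<bar>g x\<bar> \<le> C"
    unfolding bounded_iff by auto
  have fi: "integrable lebesgue (\<lambda>x. C * (indicator ?K x *\<^sub>R f x))"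
    using f K unfolding L1_loc_def set_integrable_def by (intro integrable_mult_right) auto
  show ?thesis
  proof (rule Bochner_Integration.integrable_bound[OF fi])
    show "(\<lambda>x. f x * g x) \<in> borel_measurable lebesgue"
      using L1_loc_measurable[OF f] gm by simp
    show "AE x in lebesgue. norm (f x * g x) \<le> norm (C * (indicator ?K x *\<^sub>R f x))"
    proof (rule always_eventually, rule allI)
      fix x
      show "norm (f x * g x) \<le> norm (C * (indicator ?K x *\<^sub>R f x))"
      proof (cases "x \<in> ?K")
        case True
        then have "\<bar>g x\<bar> \<le> \<bar>C\<bar>" using C by fastforce
        from mult_right_mono[OF this abs_ge_zero[of "f x"]] show ?thesis using True by (simp add: abs_mult mult.commute mult_right_mono)
      next
        case False
        then have "g x = 0"
          using subsetD[OF closure_subset[of "{x. g x \<noteq> 0}"], of x] by auto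
        then show ?thesis by simp
      qed
    qed
  qed
qed

lemma L1_loc_continuous:
  fixes f :: "real ^ 'n \<Rightarrow> 'b::euclidean_space"
  assumes "continuous_on UNIV f"
  shows "L1_loc f"
  unfolding L1_loc_def
proof (intro allI impI)
  fix K :: "(real^'n) set" assume "compact K"
  then have "set_integrable lborel K f"
    using borel_integrable_compact[of K f] assms
    by (auto simp: set_integrable_def indicator_scaleR_eq_if intro: continuous_on_subset)
  then show "set_integrable lebesgue K f"
    unfolding set_integrable_def using \<open>compact K\<close> by (simp add: integrable_completion)
qed

lemma L1_loc_continuous_mult:
  fixes f :: "real ^ 'n \<Rightarrow> 'b::euclidean_space" and h :: "real ^ 'n \<Rightarrow> 'c::euclidean_space"
  assumes f: "L1_loc f" and g: "continuous_on UNIV g" and h: "h \<in> borel_measurable lebesgue"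
    and le: "\<And>x. norm (h x) \<le> g x * norm (f x)"
  shows "L1_loc h"
  unfolding L1_loc_def set_integrable_def
proof (intro allI impI)
  fix K :: "(real^'n) set" assume K: "compact K"
  then have Km: "K \<in> sets lebesgue" by (simp add: borel_compact)
  have "bounded (g ` K)"
    using K g by (intro compact_imp_bounded compact_continuous_image) (auto intro: continuous_on_subset)
  then obtain C where C: "\<And>x. x \<in> K \<Longrightarrow> \<bar>g x\<bar> \<le> C"
    unfolding bounded_iff by auto
  have "integrable lebesgue (\<lambda>x. C *\<^sub>R (indicator K x *\<^sub>R f x))"
    using f K unfolding L1_loc_def set_integrable_def by (intro integrable_scaleR_right) auto
  then show "integrable lebesgue (\<lambda>x. indicator K x *\<^sub>R h x)"
  proof (rule Bochner_Integration.integrable_bound)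
    show "(\<lambda>x. indicator K x *\<^sub>R h x) \<in> borel_measurable lebesgue"
      using h Km by simp
    have "norm (h x) \<le> \<bar>C\<bar> * norm (f x)" if "x \<in> K" for x
      using le[of x] C[OF that] by (smt (verit) mult_right_mono norm_ge_zero)
    then show "AE x in lebesgue. norm (indicator K x *\<^sub>R h x) \<le> norm (C *\<^sub>R (indicator K x *\<^sub>R f x))"
      by (auto simp: indicator_def)
  qed
qed

lemma L1_loc_bounded_mult:
  fixes f :: "real ^ 'n \<Rightarrow> 'b::euclidean_space" and h :: "real ^ 'n \<Rightarrow> 'c::euclidean_space"
  assumes "L1_loc f" "h \<in> borel_measurable lebesgue" "\<And>x. norm (h x) \<le> C * norm (f x)"
  shows "L1_loc h"
  using assms by (rule L1_loc_continuous_mult[OF _ continuous_on_const])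

lemma L1_loc_add: "L1_loc f \<Longrightarrow> L1_loc g \<Longrightarrow> L1_loc (\<lambda>x. f x + g x)"
  unfolding L1_loc_def set_integrable_def scaleR_add_right by (auto intro: Bochner_Integration.integrable_add)

lemma borel_measurable_vec_nth_compose:
  fixes g :: "'a \<Rightarrow> real ^ 'n"
  assumes "g \<in> borel_measurable M"
  shows "(\<lambda>x. g x $ i) \<in> borel_measurable M"
  using measurable_compose[OF assms, of "\<lambda>x. x $ i" borel]
  by (simp add: borel_measurable_continuous_onI continuous_on_component)

lemma L1_loc_nth: "L1_loc g \<Longrightarrow> L1_loc (\<lambda>x. g x $ i :: real)"
  by (rule L1_loc_bounded_mult[where C=1])
     (auto dest: L1_loc_measurable intro!: borel_measurable_vec_nth_compose simp: component_le_norm_cart)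

section \<open>The fundamental lemma of the calculus of variations\<close>

lemma sigma_sets_box: "sigma_sets UNIV (range (\<lambda>(a, b). box a b :: (real^'n) set)) = sets borel"
  by (simp add: borel_eq_box)

text \<open>Boxes are stable under intersection and generate the Borel sets, and the Borel sets over
  which \<open>g\<close> integrates to zero are closed under complements and disjoint unions.
  Lebesgue sets differ from Borel sets by null sets only.\<close>

lemma integral_eq_0_imp_AE_0:
  fixes g :: "real ^ 'n \<Rightarrow> real"
  assumes g: "integrable lebesgue g"
    and box: "\<And>a b. (\<integral>x. indicator (box a b) x * g x \<partial>lebesgue) = 0"
  shows "AE x in lebesgue. g x = 0"
proof -
  have int: "integrable lebesgue (\<lambda>x. indicator A x * g x)" if "A \<in> sets lebesgue" for A
    using integrable_mult_indicator[OF that g] by simp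
  \<comment> \<open>The complement step of the induction subtracts from the integral over the whole
    space, which is not a box; it is obtained as a limit over growing boxes.\<close>
  have UNIV: "(\<integral>x. g x \<partial>lebesgue) = 0"
  proof -
    have "(\<lambda>k. \<integral>x. indicator (box (- (real k *\<^sub>R One)) (real k *\<^sub>R One)) x * g x \<partial>lebesgue) \<longlonglongrightarrow> (\<integral>x. g x \<partial>lebesgue)"
    proof (rule integral_dominated_convergence[where w="\<lambda>x. norm (g x)"])
      show "AE x in lebesgue. (\<lambda>k. indicator (box (- (real k *\<^sub>R One)) (real k *\<^sub>R One)) x * g x) \<longlonglongrightarrow> g x"
      proof (rule always_eventually, rule allI)
        fix x :: "real^'n"
        obtain k where k: "x \<in> box (- (real k *\<^sub>R One)) (real k *\<^sub>R One)"
          using UN_box_eq_UNIV by blast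
        have "eventually (\<lambda>m. indicator (box (- (real m *\<^sub>R One)) (real m *\<^sub>R One)) x * g x = g x) sequentially"
        proof (rule eventually_sequentiallyI[of k])
          fix m assume "k \<le> m"
          then have "x \<in> box (- (real m *\<^sub>R One)) (real m *\<^sub>R One)"
            using k unfolding mem_box by (force simp: inner_simps)
          then show "indicator (box (- (real m *\<^sub>R One)) (real m *\<^sub>R One)) x * g x = g x" by simp
        qed
        then show "(\<lambda>k. indicator (box (- (real k *\<^sub>R One)) (real k *\<^sub>R One)) x * g x) \<longlonglongrightarrow> g x"
          by (rule tendsto_eventually)
      qed
      show "(\<lambda>x. indicator (box (- (real k *\<^sub>R One)) (real k *\<^sub>R One)) x * g x) \<in> borel_measurable lebesgue" for k
        by (rule borel_measurable_integrable, rule int) simp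
    qed (use g in \<open>auto simp: indicator_def\<close>)
    then show ?thesis using box by (simp add: LIMSEQ_const_iff)
  qed
  have borel: "(\<integral>x. indicator A x * g x \<partial>lebesgue) = 0" if "A \<in> sets borel" for A
  proof -
    let ?E = "range (\<lambda>(a, b). box a b :: (real^'n) set)"
    have "Int_stable ?E" by (auto simp: Int_stable_def box_Int_box)
    moreover have "?E \<subseteq> Pow UNIV" by auto
    moreover have "A \<in> sigma_sets UNIV ?E" using that by (simp add: borel_eq_box)
    ultimately show ?thesis
    proof (induction rule: sigma_sets_induct_disjoint)
      case (basic A)
      then show ?case using box by auto
    next
      case empty
      then show ?case by simp
    next
      case (compl A)
      then have A: "A \<in> sets lebesgue" by (simp add: sigma_sets_box)
      have "(\<integral>x. indicator (UNIV - A) x * g x \<partial>lebesgue) = (\<integral>x. g x - indicator A x * g x \<partial>lebesgue)"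
        by (intro Bochner_Integration.integral_cong) (auto simp: indicator_def)
      also have "\<dots> = 0"
        using int[OF A] g UNIV compl by simp
      finally show ?case .
    next
      case (union A)
      then have A: "A i \<in> sets lebesgue" for i by (auto simp: sigma_sets_box)
      have "(\<lambda>x. indicator (\<Union>i. A i) x * g x) = (\<lambda>x. indicator (\<Union>i. A i) x *\<^sub>R g x)" by simp
      have "set_lebesgue_integral lebesgue (\<Union>i. A i) g = (\<Sum>i. set_lebesgue_integral lebesgue (A i) g)"
        using union A int[OF sets.countable_UN[of A UNIV], OF image_subsetI[OF A]]
        by (intro lebesgue_integral_countable_add) (auto simp: disjoint_family_on_def set_integrable_def)
      then show ?case using union by (simp add: set_lebesgue_integral_def)
    qed
  qed
  show ?thesis
  proof (rule density_unique_real[OF g])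
    show "integrable lebesgue (\<lambda>_::real^'n. 0::real)" by simp
    fix A :: "(real^'n) set" assume "A \<in> sets lebesgue"
    then obtain S N N' where S: "A = S \<union> N" "N \<subseteq> N'" "N' \<in> null_sets lborel" "S \<in> sets lborel"
      by (rule sets_completionE)
    have N: "AE x in lebesgue. x \<notin> N'"
      using S(3) by (intro AE_not_in null_sets_completionI)
    have "set_lebesgue_integral lebesgue A g = (\<integral>x. indicator S x * g x \<partial>lebesgue)"
      unfolding set_lebesgue_integral_def
    proof (rule integral_cong_AE)
      show "AE x in lebesgue. indicator A x *\<^sub>R g x = indicator S x * g x"
        using N by eventually_elim (use S in \<open>auto simp: indicator_def\<close>)
      show "(\<lambda>x. indicator S x * g x) \<in> borel_measurable lebesgue"
        by (rule borel_measurable_integrable, rule int) (use S(4) in simp)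
    qed (use \<open>A \<in> sets lebesgue\<close> g in auto)
    then show "set_lebesgue_integral lebesgue A g = set_lebesgue_integral lebesgue A (\<lambda>_. 0)"
      using borel S(4) by (simp add: set_lebesgue_integral_def)
  qed
qed

text \<open>Dominated convergence along \<open>box_bump\<close> transfers the hypothesis from test
  functions to boxes. Since \<open>g\<close> is integrable only locally, the criterion above is
  applied to its restrictions to the boxes of a countable exhaustion; intersections of boxes are
  boxes again.\<close>

lemma Cc_infinity_null_imp_AE_0:
  fixes g :: "real ^ 'n \<Rightarrow> real"
  assumes g: "L1_loc g" and 0: "\<And>\<psi>. \<psi> \<in> Cc_infinity UNIV \<Longrightarrow> (\<integral>x. g x * \<psi> x \<partial>lebesgue) = 0"
  shows "AE x in lebesgue. g x = 0"
proof -
  have box0: "(\<integral>x. indicator (box a b) x * g x \<partial>lebesgue) = 0" for a b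
  proof -
    have "(\<lambda>k. \<integral>x. g x * box_bump k a b x \<partial>lebesgue) \<longlonglongrightarrow> (\<integral>x. indicator (box a b) x * g x \<partial>lebesgue)"
    proof (rule integral_dominated_convergence[where w="\<lambda>x. norm (indicator (box a b) x *\<^sub>R g x)"])
      show "AE x in lebesgue. (\<lambda>k. g x * box_bump k a b x) \<longlonglongrightarrow> indicator (box a b) x * g x"
        unfolding mult.commute[of "g _"]
        by (intro always_eventually allI tendsto_mult tendsto_const box_bump_LIMSEQ)
      show "integrable lebesgue (\<lambda>x. norm (indicator (box a b) x *\<^sub>R g x))"
        by (intro integrable_norm L1_loc_mult_indicator g) auto
      show "AE x in lebesgue. norm (g x * box_bump k a b x) \<le> norm (indicator (box a b) x *\<^sub>R g x)" for k
      proof (rule always_eventually, rule allI)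
        fix x
        show "norm (g x * box_bump k a b x) \<le> norm (indicator (box a b) x *\<^sub>R g x)"
          using box_bump_bounds[of k a b x] box_bump_outside[of x a b k]
          by (cases "x \<in> box a b") (auto simp: abs_mult mult_left_le)
      qed
      show "(\<lambda>x. indicator (box a b) x * g x) \<in> borel_measurable lebesgue"
        by (intro borel_measurable_times borel_measurable_indicator L1_loc_measurable g) simp
      show "(\<lambda>x. g x * box_bump k a b x) \<in> borel_measurable lebesgue" for k
        using L1_loc_integrable_mult[OF g, of "box_bump k a b"] box_bump_Cc_infinity[of k a b]
        by (intro borel_measurable_integrable) (simp add: Cc_infinity_UNIV_iff Ck_continuous_on[OF smooth_Ck[of _ 0]])
    qed
    then show ?thesis using 0[OF box_bump_Cc_infinity] by (simp add: LIMSEQ_const_iff)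
  qed
  let ?B = "\<lambda>k. box (- (real k *\<^sub>R One)) (real k *\<^sub>R One) :: (real^'n) set"
  have "AE x in lebesgue. indicator (?B k) x * g x = 0" for k :: nat
  proof (rule integral_eq_0_imp_AE_0)
    show "integrable lebesgue (\<lambda>x. indicator (?B k) x * g x)"
      using L1_loc_mult_indicator[OF g, of "?B k"] by simp
    show "(\<integral>x. indicator (box a b) x * (indicator (?B k) x * g x) \<partial>lebesgue) = 0" for a b
    proof -
      obtain a' b' where "box a b \<inter> ?B k = box a' b'" using box_Int_box by blast
      then have "indicator (box a b) x * (indicator (?B k) x * g x) = indicator (box a' b') x * g x" for x
        by (auto simp: indicator_def split: if_splits)
      then show ?thesis using box0[of a' b'] by presburger
    qed
  qed
  then have "AE x in lebesgue. \<forall>k. indicator (?B k) x * g x = 0"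
    by (rule AE_all_countable[THEN iffD2, OF allI])
  then show ?thesis
  proof eventually_elim
    case (elim x)
    obtain k where "x \<in> ?B k" using UN_box_eq_UNIV by blast
    then show ?case using elim[rule_format, of k] by simp
  qed
qed

section \<open>Calculus of weak gradients\<close>

lemma is_weak_gradient_L1_loc: "is_weak_gradient f g \<Longrightarrow> L1_loc f" "is_weak_gradient f g \<Longrightarrow> L1_loc g"
  by (auto simp: is_weak_gradient_def)

lemma weakly_differentiable_weak_gradient:
  "weakly_differentiable f \<Longrightarrow> is_weak_gradient f (weak_gradient f)"
  unfolding weakly_differentiable_def weak_gradient_def by (rule someI_ex[of "is_weak_gradient f"])

lemma Cc_infinity_continuous: "\<psi> \<in> Cc_infinity UNIV \<Longrightarrow> continuous_on UNIV \<psi>"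
  by (auto simp: Cc_infinity_UNIV_iff intro: Ck_continuous_on[OF smooth_Ck[of _ 0]])

lemma Cc_infinity_integrable_mult:
  "L1_loc f \<Longrightarrow> \<psi> \<in> Cc_infinity UNIV \<Longrightarrow> integrable lebesgue (\<lambda>x. f x * \<psi> x)"
  by (intro L1_loc_integrable_mult Cc_infinity_continuous) (simp_all add: Cc_infinity_UNIV_iff)

lemma Cc_infinity_partial_deriv: "\<psi> \<in> Cc_infinity UNIV \<Longrightarrow> partial_deriv i \<psi> \<in> Cc_infinity UNIV"
  by (auto simp: Cc_infinity_UNIV_iff smooth_partial_deriv bounded_support_partial_deriv)

lemma is_weak_gradient_AE_unique:
  assumes g: "is_weak_gradient f g" and g': "is_weak_gradient f g'"
  shows "AE x in lebesgue. g x = g' x"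
proof -
  have "AE x in lebesgue. g x $ i + (- 1) * g' x $ i = 0" for i
  proof (rule Cc_infinity_null_imp_AE_0)
    have m: "L1_loc (\<lambda>x. (-1) * g' x $ i)"
      by (rule L1_loc_bounded_mult[where C=1, OF L1_loc_nth[OF is_weak_gradient_L1_loc(2)[OF g'], of i]])
         (use L1_loc_measurable[OF L1_loc_nth[OF is_weak_gradient_L1_loc(2)[OF g'], of i]] in auto)
    then show "L1_loc (\<lambda>x. g x $ i + (- 1) * g' x $ i)"
      by (intro L1_loc_add L1_loc_nth is_weak_gradient_L1_loc(2)[OF g])
    fix \<psi> :: "real^'a \<Rightarrow> real" assume \<psi>: "\<psi> \<in> Cc_infinity UNIV"
    have "(\<integral>x. (g x $ i + (- 1) * g' x $ i) * \<psi> x \<partial>lebesgue)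
        = (\<integral>x. g x $ i * \<psi> x - g' x $ i * \<psi> x \<partial>lebesgue)"
      by (simp add: algebra_simps)
    also have "\<dots> = (\<integral>x. g x $ i * \<psi> x \<partial>lebesgue) - (\<integral>x. g' x $ i * \<psi> x \<partial>lebesgue)"
      by (intro Bochner_Integration.integral_diff Cc_infinity_integrable_mult \<psi> L1_loc_nth
          is_weak_gradient_L1_loc(2)[OF g] is_weak_gradient_L1_loc(2)[OF g'])
    also have "\<dots> = 0"
    proof -
      have "(\<integral>x. f x * partial_deriv i \<psi> x \<partial>lebesgue) = - (\<integral>x. g x $ i * \<psi> x \<partial>lebesgue)"
        "(\<integral>x. f x * partial_deriv i \<psi> x \<partial>lebesgue) = - (\<integral>x. g' x $ i * \<psi> x \<partial>lebesgue)"
        using g g' \<psi> unfolding is_weak_gradient_def by blast+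
      then show ?thesis by linarith
    qed
    finally show "(\<integral>x. (g x $ i + (- 1) * g' x $ i) * \<psi> x \<partial>lebesgue) = 0" .
  qed
  then have "AE x in lebesgue. \<forall>i. g x $ i + (- 1) * g' x $ i = 0"
    by (simp add: AE_all_countable)
  then show ?thesis by eventually_elim (simp add: vec_eq_iff)
qed

lemma weak_gradient_AE_eq:
  assumes "is_weak_gradient f g"
  shows "AE x in lebesgue. weak_gradient f x = g x"
  using is_weak_gradient_AE_unique[OF weakly_differentiable_weak_gradient assms] assms
  by (auto simp: weakly_differentiable_def)

lemma is_weak_gradient_inner:
  assumes "is_weak_gradient f g" "\<psi> \<in> Cc_infinity UNIV"
  shows "(\<integral>x. f x * (v \<bullet> grad \<psi> x) \<partial>lebesgue) = - (\<integral>x. (v \<bullet> g x) * \<psi> x \<partial>lebesgue)"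
proof -
  note L = is_weak_gradient_L1_loc[OF assms(1)]
  have int: "integrable lebesgue (\<lambda>x. f x * partial_deriv i \<psi> x)" "integrable lebesgue (\<lambda>x. g x $ i * \<psi> x)" for i
    by (intro Cc_infinity_integrable_mult Cc_infinity_partial_deriv assms L L1_loc_nth)+
  have "(\<integral>x. f x * (v \<bullet> grad \<psi> x) \<partial>lebesgue) = (\<integral>x. (\<Sum>i\<in>UNIV. v $ i * (f x * partial_deriv i \<psi> x)) \<partial>lebesgue)"
    by (simp add: inner_vec_def sum_distrib_left mult.left_commute)
  also have "\<dots> = (\<Sum>i\<in>UNIV. v $ i * (\<integral>x. f x * partial_deriv i \<psi> x \<partial>lebesgue))"
    by (simp add: Bochner_Integration.integral_sum int)
  also have "\<dots> = (\<Sum>i\<in>UNIV. v $ i * - (\<integral>x. g x $ i * \<psi> x \<partial>lebesgue))"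
    using assms by (simp add: is_weak_gradient_def)
  also have "\<dots> = - (\<integral>x. (\<Sum>i\<in>UNIV. v $ i * (g x $ i * \<psi> x)) \<partial>lebesgue)"
    by (simp add: Bochner_Integration.integral_sum int sum_negf)
  also have "\<dots> = - (\<integral>x. (v \<bullet> g x) * \<psi> x \<partial>lebesgue)"
    by (simp add: inner_vec_def sum_distrib_right mult.assoc)
  finally show ?thesis .
qed

lemma is_weak_gradient_lincomb:
  assumes f: "is_weak_gradient f g" and f': "is_weak_gradient f' g'"
  shows "is_weak_gradient (\<lambda>x. f x + c * f' x) (\<lambda>x. g x + c *\<^sub>R g' x)"
  unfolding is_weak_gradient_def
proof (intro conjI ballI allI)
  note L = is_weak_gradient_L1_loc[OF f] is_weak_gradient_L1_loc[OF f']
  show "L1_loc (\<lambda>x. f x + c * f' x)"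
    by (intro L1_loc_add L(1), rule L1_loc_bounded_mult[where C="\<bar>c\<bar>", OF L(3)])
       (auto simp: abs_mult intro!: borel_measurable_times L1_loc_measurable[OF L(3)])
  show "L1_loc (\<lambda>x. g x + c *\<^sub>R g' x)"
    by (intro L1_loc_add L(2), rule L1_loc_bounded_mult[where C="\<bar>c\<bar>", OF L(4)])
       (auto intro!: borel_measurable_scaleR L1_loc_measurable[OF L(4)])
  fix \<psi> :: "real^'a \<Rightarrow> real" and i assume \<psi>: "\<psi> \<in> Cc_infinity UNIV"
  have "(\<integral>x. (f x + c * f' x) * partial_deriv i \<psi> x \<partial>lebesgue)
     = (\<integral>x. f x * partial_deriv i \<psi> x + c * (f' x * partial_deriv i \<psi> x) \<partial>lebesgue)"
    by (simp add: algebra_simps)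
  also have "\<dots> = (\<integral>x. f x * partial_deriv i \<psi> x \<partial>lebesgue) + c * (\<integral>x. f' x * partial_deriv i \<psi> x \<partial>lebesgue)"
    by (subst Bochner_Integration.integral_add)
       (auto intro!: Cc_infinity_integrable_mult Cc_infinity_partial_deriv \<psi> L)
  also have "\<dots> = - ((\<integral>x. g x $ i * \<psi> x \<partial>lebesgue) + c * (\<integral>x. g' x $ i * \<psi> x \<partial>lebesgue))"
    using f f' \<psi> by (simp add: is_weak_gradient_def)
  also have "\<dots> = - (\<integral>x. g x $ i * \<psi> x + c * (g' x $ i * \<psi> x) \<partial>lebesgue)"
    by (subst Bochner_Integration.integral_add)
       (auto intro!: Cc_infinity_integrable_mult L1_loc_nth \<psi> L)
  finally show "(\<integral>x. (f x + c * f' x) * partial_deriv i \<psi> x \<partial>lebesgue) = - (\<integral>x. (g x + c *\<^sub>R g' x) $ i * \<psi> x \<partial>lebesgue)"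
    by (simp add: algebra_simps)
qed

text \<open>The product of \<eta> and a test function \<psi> is again a test function, since \<psi>
  carries the bounded support. Inserting it into the definition for \<open>f\<close> and expanding
  its partial derivative moves \<eta> from the test function to \<open>f\<close>.\<close>

lemma is_weak_gradient_mult_smooth:
  assumes f: "is_weak_gradient f g" and \<eta>: "smooth \<eta>"
  shows "is_weak_gradient (\<lambda>x. \<eta> x * f x) (\<lambda>x. \<eta> x *\<^sub>R g x + f x *\<^sub>R grad \<eta> x)"
  unfolding is_weak_gradient_def
proof (intro conjI ballI allI)
  note L = is_weak_gradient_L1_loc[OF f]
  note M = L1_loc_measurable[OF L(1)] L1_loc_measurable[OF L(2)]
  have c: "continuous_on UNIV \<eta>" "continuous_on UNIV (grad \<eta>)"
    using \<eta> by (auto intro: Ck_continuous_on[OF smooth_Ck[of _ 0]] Ck_continuous_grad[OF smooth_Ck[of _ "Suc 0"]])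
  then have m: "\<eta> \<in> borel_measurable lebesgue" "grad \<eta> \<in> borel_measurable lebesgue"
    by (auto intro!: measurable_completion borel_measurable_continuous_onI)
  show "L1_loc (\<lambda>x. \<eta> x * f x)"
    by (rule L1_loc_continuous_mult[where g="\<lambda>x. \<bar>\<eta> x\<bar>", OF L(1)])
       (use c m M in \<open>auto simp: abs_mult intro!: continuous_intros\<close>)
  have "L1_loc (\<lambda>x. \<eta> x *\<^sub>R g x)"
    by (rule L1_loc_continuous_mult[where g="\<lambda>x. \<bar>\<eta> x\<bar>", OF L(2)])
       (use c m M in \<open>auto intro!: continuous_intros\<close>)
  moreover have "L1_loc (\<lambda>x. f x *\<^sub>R grad \<eta> x)"
    by (rule L1_loc_continuous_mult[where g="\<lambda>x. norm (grad \<eta> x)", OF L(1)])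
       (use c m M in \<open>auto intro!: continuous_intros\<close>)
  ultimately show "L1_loc (\<lambda>x. \<eta> x *\<^sub>R g x + f x *\<^sub>R grad \<eta> x)"
    by (rule L1_loc_add)
  fix \<psi> :: "real^'a \<Rightarrow> real" and i assume \<psi>: "\<psi> \<in> Cc_infinity UNIV"
  have e\<psi>: "(\<lambda>x. \<eta> x * \<psi> x) \<in> Cc_infinity UNIV"
    by (rule Cc_infinity_mult[OF \<eta> \<psi>])
  have de\<psi>: "(\<lambda>x. partial_deriv i \<eta> x * \<psi> x) \<in> Cc_infinity UNIV"
    by (rule Cc_infinity_mult[OF smooth_partial_deriv[OF \<eta>] \<psi>])
  have sm: "smooth \<psi>" using \<psi> by (simp add: Cc_infinity_UNIV_iff)
  have pd: "partial_deriv i (\<lambda>x. \<eta> x * \<psi> x) x = \<eta> x * partial_deriv i \<psi> x + \<psi> x * partial_deriv i \<eta> x" for x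
    using arg_cong[OF grad_mult[OF smooth_differentiable[OF \<eta>] smooth_differentiable[OF sm], of x], of "\<lambda>v. v $ i"]
    by simp
  have "(\<integral>x. \<eta> x * f x * partial_deriv i \<psi> x \<partial>lebesgue)
     = (\<integral>x. f x * partial_deriv i (\<lambda>x. \<eta> x * \<psi> x) x - f x * (partial_deriv i \<eta> x * \<psi> x) \<partial>lebesgue)"
    by (simp add: pd algebra_simps)
  also have "\<dots> = - (\<integral>x. g x $ i * (\<eta> x * \<psi> x) \<partial>lebesgue) - (\<integral>x. f x * (partial_deriv i \<eta> x * \<psi> x) \<partial>lebesgue)"
    using f e\<psi> by (subst Bochner_Integration.integral_diff)
       (auto intro!: Cc_infinity_integrable_mult Cc_infinity_partial_deriv e\<psi> de\<psi> L simp: is_weak_gradient_def)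
  also have "\<dots> = - (\<integral>x. g x $ i * (\<eta> x * \<psi> x) + f x * (partial_deriv i \<eta> x * \<psi> x) \<partial>lebesgue)"
    by (subst Bochner_Integration.integral_add) (auto intro!: Cc_infinity_integrable_mult e\<psi> de\<psi> L L1_loc_nth)
  finally show "(\<integral>x. \<eta> x * f x * partial_deriv i \<psi> x \<partial>lebesgue)
     = - (\<integral>x. (\<eta> x *\<^sub>R g x + f x *\<^sub>R grad \<eta> x) $ i * \<psi> x \<partial>lebesgue)"
    by (simp add: algebra_simps)
qed

lemma L1_loc_compose:
  fixes T :: "real^'n \<Rightarrow> real^'n" and f :: "real ^ 'n \<Rightarrow> 'b::euclidean_space"
  assumes T: "T \<in> lebesgue \<rightarrow>\<^sub>M lebesgue" "distr lebesgue lebesgue T = lebesgue" "continuous_on UNIV T" "inj T"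
    and f: "L1_loc f"
  shows "L1_loc (\<lambda>x. f (T x))"
  unfolding L1_loc_def set_integrable_def
proof (intro allI impI)
  fix K :: "(real^'n) set" assume "compact K"
  then have "compact (T ` K)"
    using T(3) by (intro compact_continuous_image) (auto intro: continuous_on_subset)
  then have "integrable (distr lebesgue lebesgue T) (\<lambda>x. indicator (T ` K) x *\<^sub>R f x)"
    using f by (simp add: T(2) L1_loc_def set_integrable_def)
  then have "integrable lebesgue (\<lambda>x. indicator (T ` K) (T x) *\<^sub>R f (T x))"
    using integrable_distr[OF T(1)] by blast
  moreover have "indicator (T ` K) (T x) = indicat_real K x" for x
    using T(4) by (auto simp: indicator_def inj_def)
  ultimately show "integrable lebesgue (\<lambda>x. indicator K x *\<^sub>R f (T x))" by simp
qed

lemma L1_loc_unimodular: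
  fixes A :: "real^'n^'n" and f :: "real ^ 'n \<Rightarrow> 'b::euclidean_space"
  assumes A: "det A = 1" and f: "L1_loc f"
  shows "L1_loc (\<lambda>x. f (A *v x))"
proof (rule L1_loc_compose[OF lebesgue_measurable_unimodular[OF A] distr_lebesgue_unimodular[OF A] _ _ f])
  show "continuous_on UNIV (\<lambda>x. A *v x)"
    by (intro linear_continuous_on matrix_vector_mul_bounded_linear)
  show "inj (\<lambda>x. A *v x)"
    using A inj_matrix_vector_mult[of A] by (simp add: invertible_det_nz)
qed

lemma integral_unimodular:
  fixes A :: "real^'n^'n" and f :: "real ^ 'n \<Rightarrow> real"
  assumes "det A = 1" "f \<in> borel_measurable lebesgue"
  shows "(\<integral>x. f (A *v x) \<partial>lebesgue) = (\<integral>x. f x \<partial>lebesgue)"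
  using integral_distr[OF lebesgue_measurable_unimodular[OF assms(1)], of f] assms
  by (simp add: distr_lebesgue_unimodular)

text \<open>Each test function has the form \<omega> composed with \<open>A\<close>. Its partial
  derivative is a derivative of \<omega> in the direction \<open>A *v axis i 1\<close>, so the
  change of variables leads to the directional form of the weak gradient of \<open>f\<close>, and
  back again.\<close>

lemma is_weak_gradient_unimodular:
  fixes A :: "real^'n^'n"
  assumes f: "is_weak_gradient f g" and A: "det A = 1"
  shows "is_weak_gradient (\<lambda>x. f (A *v x)) (\<lambda>x. transpose A *v g (A *v x))"
  unfolding is_weak_gradient_def
proof (intro conjI ballI allI)
  note L = is_weak_gradient_L1_loc[OF f]
  show "L1_loc (\<lambda>x. f (A *v x))" by (rule L1_loc_unimodular[OF A L(1)])
  have g: "L1_loc (\<lambda>x. g (A *v x))" by (rule L1_loc_unimodular[OF A L(2)])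
  have lin: "bounded_linear (\<lambda>v. transpose A *v v)"
    by (rule matrix_vector_mul_bounded_linear)
  show "L1_loc (\<lambda>x. transpose A *v g (A *v x))"
  proof (rule L1_loc_bounded_mult[OF g])
    show "norm (transpose A *v g (A *v x)) \<le> onorm (\<lambda>v. transpose A *v v) * norm (g (A *v x))" for x
      by (rule onorm[OF lin])
    show "(\<lambda>x. transpose A *v g (A *v x)) \<in> borel_measurable lebesgue"
      using measurable_compose[OF L1_loc_measurable[OF g] measurable_matrix_vector_mult] .
  qed
  fix \<psi> :: "real^'n \<Rightarrow> real" and i assume \<psi>: "\<psi> \<in> Cc_infinity UNIV"
  obtain A' where A': "A ** A' = mat 1" "A' ** A = mat 1"
    using A invertible_det_nz[of A] unfolding invertible_def by auto
  have "det A' * det A = 1" using A' by (metis det_I det_mul)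
  then have detA': "det A' \<noteq> 0" by auto
  define \<omega> where "\<omega> = (\<lambda>x. \<psi> (A' *v x + 0))"
  have \<omega>: "\<omega> \<in> Cc_infinity UNIV"
    unfolding \<omega>_def by (rule Cc_infinity_affine[OF detA' \<psi>])
  have eq: "\<psi> = (\<lambda>x. \<omega> (A *v x + 0))"
    using A' by (simp add: \<omega>_def matrix_vector_mul_assoc)
  have sm: "smooth \<omega>" using \<omega> by (simp add: Cc_infinity_UNIV_iff)
  let ?v = "A *v axis i 1"
  have pd: "partial_deriv i \<psi> x = ?v \<bullet> grad \<omega> (A *v x)" for x
  proof -
    have "partial_deriv i \<psi> x = axis i 1 \<bullet> grad \<psi> x" by (simp add: inner_axis')
    also have "grad \<psi> x = transpose A *v grad \<omega> (A *v x)"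
      by (subst eq, subst grad_affine) (simp_all add: smooth_differentiable[OF sm])
    finally show ?thesis by (simp only: inner_transpose_matrix_vector)
  qed
  have gi: "(transpose A *v g (A *v x)) $ i = ?v \<bullet> g (A *v x)" for x
    by (metis inner_axis' inner_transpose_matrix_vector inner_real_def mult_1)
  have "(\<integral>x. f (A *v x) * partial_deriv i \<psi> x \<partial>lebesgue) = (\<integral>x. f x * (?v \<bullet> grad \<omega> x) \<partial>lebesgue)"
    unfolding pd using integral_unimodular[OF A, of "\<lambda>x. f x * (?v \<bullet> grad \<omega> x)"]
      borel_measurable_integrable[OF Cc_infinity_integrable_mult[OF L(1) Cc_infinity_grad[OF \<omega>]]] by simp
  also have "\<dots> = - (\<integral>x. (?v \<bullet> g x) * \<omega> x \<partial>lebesgue)"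
    by (rule is_weak_gradient_inner[OF f \<omega>])
  also have "\<dots> = - (\<integral>x. (?v \<bullet> g (A *v x)) * \<omega> (A *v x) \<partial>lebesgue)"
  proof -
    have "(\<lambda>x. (?v \<bullet> g x) * \<omega> x) \<in> borel_measurable lebesgue"
      using L1_loc_measurable[OF L(2)] Cc_infinity_continuous[OF \<omega>]
      by (intro borel_measurable_times borel_measurable_inner) (auto intro!: measurable_completion borel_measurable_continuous_onI)
    then show ?thesis using integral_unimodular[OF A, of "\<lambda>x. (?v \<bullet> g x) * \<omega> x"] by simp
  qed
  finally show "(\<integral>x. f (A *v x) * partial_deriv i \<psi> x \<partial>lebesgue) = - (\<integral>x. (transpose A *v g (A *v x)) $ i * \<psi> x \<partial>lebesgue)"
    unfolding gi by (subst (2) eq) simp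
qed

section \<open>Translations and differentiation under the integral\<close>

lemma bounded_grad:
  assumes "Ck (Suc 0) \<psi>" "bounded {x. \<psi> x \<noteq> 0}"
  obtains K where "0 < K" "\<And>x. norm (grad \<psi> x) \<le> K"
proof -
  let ?S = "closure {x. \<psi> x \<noteq> 0}"
  have "bounded (grad \<psi> ` ?S)"
    using assms Ck_continuous_grad[OF assms(1)]
    by (intro compact_imp_bounded compact_continuous_image) (auto intro: continuous_on_subset simp: compact_closure)
  then obtain K where K: "0 < K" "\<And>x. x \<in> ?S \<Longrightarrow> norm (grad \<psi> x) \<le> K"
    unfolding bounded_pos by auto
  have "grad \<psi> x = 0" if "x \<notin> ?S" for x
    using partial_deriv_eq_0[OF that] by (simp add: vec_eq_iff)
  with K that show ?thesis by (metis less_imp_le norm_zero)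
qed

text \<open>The function \<psi> is Lipschitz, and for a bounded sequence of increments all
  difference quotients vanish outside one ball, on which \<open>f\<close> is integrable; this gives
  a dominating function. The case of constant \<open>f\<close> yields integration by parts, the
  general case handles functions whose derivative vanishes in one direction.\<close>

lemma integral_translation_DERIV:
  fixes f \<psi> :: "real ^ 'n \<Rightarrow> real"
  assumes f: "L1_loc f" and \<psi>: "Ck (Suc 0) \<psi>" "bounded {x. \<psi> x \<noteq> 0}"
  shows "((\<lambda>t. \<integral>y. f y * \<psi> (y + t *\<^sub>R v) \<partial>lebesgue) has_real_derivative (\<integral>y. f y * (v \<bullet> grad \<psi> y) \<partial>lebesgue)) (at 0)"
  unfolding DERIV_def tendsto_at_iff_sequentially o_def
proof (intro allI impI)
  fix X :: "nat \<Rightarrow> real" assume X0: "\<forall>i. X i \<in> UNIV - {0}" and X: "X \<longlonglongrightarrow> 0"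
  have "bounded (range X)" using X convergent_imp_bounded by blast
  then obtain C where C: "0 < C" "\<And>i. \<bar>X i\<bar> \<le> C" unfolding bounded_pos by auto
  obtain K where K: "0 < K" "\<And>x. norm (grad \<psi> x) \<le> K" using bounded_grad[OF \<psi>] by blast
  obtain r where r: "0 < r" "\<And>x. \<psi> x \<noteq> 0 \<Longrightarrow> norm x \<le> r" using \<psi>(2) unfolding bounded_pos by auto
  let ?S = "cball (0::real^'n) (r + C * norm v)"
  have c\<psi>: "continuous_on UNIV \<psi>" by (rule Ck_continuous_on[OF \<psi>(1)])
  have cont: "continuous_on UNIV (\<lambda>y. \<psi> (y + h *\<^sub>R v))" for h
    by (rule continuous_on_compose2[OF c\<psi>, of UNIV "\<lambda>y. y + h *\<^sub>R v"]) (auto intro!: continuous_intros)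
  have bdd: "bounded {y. \<psi> (y + h *\<^sub>R v) \<noteq> 0}" for h
  proof -
    have "{y. \<psi> (y + h *\<^sub>R v) \<noteq> 0} \<subseteq> cball 0 (r + norm (h *\<^sub>R v))"
    proof
      fix y assume "y \<in> {y. \<psi> (y + h *\<^sub>R v) \<noteq> 0}"
      then have "norm (y + h *\<^sub>R v) \<le> r" using r by blast
      then show "y \<in> cball 0 (r + norm (h *\<^sub>R v))" using norm_triangle_ineq4[of "y + h *\<^sub>R v" "h *\<^sub>R v"] by auto
    qed
    then show ?thesis using bounded_subset bounded_cball by blast
  qed
  have int: "integrable lebesgue (\<lambda>y. f y * \<psi> (y + h *\<^sub>R v))" for h
    by (rule L1_loc_integrable_mult[OF f cont bdd])
  have lip: "\<bar>\<psi> (y + h *\<^sub>R v) - \<psi> y\<bar> \<le> K * (\<bar>h\<bar> * norm v)" for y h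
  proof -
    have "norm (\<psi> (y + h *\<^sub>R v) - \<psi> y) \<le> K * norm (y + h *\<^sub>R v - y)"
    proof (rule differentiable_bound[of UNIV])
      show "(\<psi> has_derivative (\<lambda>w. w \<bullet> grad \<psi> x)) (at x within UNIV)" for x
        using Ck_has_derivative[OF \<psi>(1)] by simp
      show "onorm (\<lambda>w. w \<bullet> grad \<psi> x) \<le> K" for x
      proof (rule onorm_bound)
        fix w
        have "\<bar>w \<bullet> grad \<psi> x\<bar> \<le> norm w * norm (grad \<psi> x)" by (rule Cauchy_Schwarz_ineq2)
        also have "\<dots> \<le> norm w * K" using K by (intro mult_left_mono) auto
        finally show "norm (w \<bullet> grad \<psi> x) \<le> K * norm w" by (simp add: mult.commute)
      qed (use K in auto)
    qed auto
    then show ?thesis by simp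
  qed
  have lim: "(\<lambda>i. \<integral>y. f y * ((\<psi> (y + X i *\<^sub>R v) - \<psi> y) / X i) \<partial>lebesgue) \<longlonglongrightarrow> (\<integral>y. f y * (v \<bullet> grad \<psi> y) \<partial>lebesgue)"
  proof (rule integral_dominated_convergence[where w="\<lambda>y. (K * norm v) * norm (indicator ?S y *\<^sub>R f y)"])
    show "AE y in lebesgue. (\<lambda>i. f y * ((\<psi> (y + X i *\<^sub>R v) - \<psi> y) / X i)) \<longlonglongrightarrow> f y * (v \<bullet> grad \<psi> y)"
    proof (rule always_eventually, rule allI, intro tendsto_mult tendsto_const)
      fix y
      have "((\<lambda>t. y + t *\<^sub>R v) has_derivative (\<lambda>t. t *\<^sub>R v)) (at 0)"
        by (auto intro!: derivative_eq_intros)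
      from has_derivative_compose[OF this, of \<psi> "\<lambda>w. w \<bullet> grad \<psi> y"]
      have "((\<lambda>t. \<psi> (y + t *\<^sub>R v)) has_real_derivative (v \<bullet> grad \<psi> y)) (at 0)"
        using Ck_has_derivative[OF \<psi>(1), of y] by (simp add: has_field_derivative_def mult_commute_abs)
      then show "(\<lambda>i. (\<psi> (y + X i *\<^sub>R v) - \<psi> y) / X i) \<longlonglongrightarrow> v \<bullet> grad \<psi> y"
        using X0 X unfolding DERIV_def tendsto_at_iff_sequentially o_def by simp
    qed
    show "integrable lebesgue (\<lambda>y. (K * norm v) * norm (indicator ?S y *\<^sub>R f y))"
      by (intro integrable_mult_right integrable_norm L1_loc_mult_indicator f) auto
    show "AE y in lebesgue. norm (f y * ((\<psi> (y + X i *\<^sub>R v) - \<psi> y) / X i)) \<le> (K * norm v) * norm (indicator ?S y *\<^sub>R f y)" for i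
    proof (rule always_eventually, rule allI)
      fix y
      show "norm (f y * ((\<psi> (y + X i *\<^sub>R v) - \<psi> y) / X i)) \<le> (K * norm v) * norm (indicator ?S y *\<^sub>R f y)"
      proof (cases "y \<in> ?S")
        case True
        have "\<bar>(\<psi> (y + X i *\<^sub>R v) - \<psi> y) / X i\<bar> \<le> K * norm v"
          using lip[of y "X i"] X0 by (simp add: abs_divide pos_divide_le_eq ac_simps)
        from mult_left_mono[OF this, of "\<bar>f y\<bar>"] True show ?thesis by (simp add: abs_mult mult.commute)
      next
        case False
        have "C * norm v \<ge> 0" using C by simp
        then have "\<psi> y = 0" using False r(2)[of y] by force
        moreover have "\<psi> (y + X i *\<^sub>R v) = 0"
        proof (rule ccontr)
          assume "\<psi> (y + X i *\<^sub>R v) \<noteq> 0"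
          then have "norm (y + X i *\<^sub>R v) \<le> r" using r by blast
          then have "norm y \<le> r + \<bar>X i\<bar> * norm v" using norm_triangle_ineq4[of "y + X i *\<^sub>R v" "X i *\<^sub>R v"] by auto
          moreover have "\<bar>X i\<bar> * norm v \<le> C * norm v" using C by (intro mult_right_mono) auto
          ultimately show False using False by auto
        qed
        ultimately show ?thesis using False by simp
      qed
    qed
    show "(\<lambda>y. f y * (v \<bullet> grad \<psi> y)) \<in> borel_measurable lebesgue"
      using L1_loc_measurable[OF f] Ck_continuous_grad[OF \<psi>(1)]
      by (intro borel_measurable_times borel_measurable_inner) (auto intro!: measurable_completion borel_measurable_continuous_onI)
    show "(\<lambda>y. f y * ((\<psi> (y + X i *\<^sub>R v) - \<psi> y) / X i)) \<in> borel_measurable lebesgue" for i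
      using L1_loc_measurable[OF f] cont c\<psi>
      by (intro borel_measurable_times borel_measurable_divide borel_measurable_diff)
         (auto intro!: measurable_completion borel_measurable_continuous_onI)
  qed
  have eq: "(\<integral>y. f y * ((\<psi> (y + X i *\<^sub>R v) - \<psi> y) / X i) \<partial>lebesgue)
     = ((\<integral>y. f y * \<psi> (y + (0 + X i) *\<^sub>R v) \<partial>lebesgue) - (\<integral>y. f y * \<psi> (y + 0 *\<^sub>R v) \<partial>lebesgue)) / X i" for i
  proof -
    show ?thesis using int[of "X i"] int[of 0] by (simp add: right_diff_distrib)
  qed
  show "(\<lambda>i. ((\<integral>y. f y * \<psi> (y + (0 + X i) *\<^sub>R v) \<partial>lebesgue) - (\<integral>y. f y * \<psi> (y + 0 *\<^sub>R v) \<partial>lebesgue)) / X i)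
      \<longlonglongrightarrow> (\<integral>y. f y * (v \<bullet> grad \<psi> y) \<partial>lebesgue)"
    using lim unfolding eq .
qed

lemma integral_translation:
  fixes f :: "'a::euclidean_space \<Rightarrow> real"
  assumes "f \<in> borel_measurable lebesgue"
  shows "(\<integral>x. f (x + t) \<partial>lebesgue) = (\<integral>x. f x \<partial>lebesgue)"
  using integral_distr[OF lebesgue_measurable_translation[of t], of f] assms
  by (simp add: distr_lebesgue_translation)

text \<open>The integral of a translate does not depend on the translation, so its derivative
  vanishes. This replaces integration along coordinate lines.\<close>

lemma integral_grad_eq_0:
  assumes \<psi>: "Ck (Suc 0) \<psi>" "bounded {x. \<psi> x \<noteq> 0}"
  shows "(\<integral>y. v \<bullet> grad \<psi> y \<partial>lebesgue) = 0"
proof -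
  have "\<psi> \<in> borel_measurable lebesgue"
    using Ck_continuous_on[OF \<psi>(1)] by (auto intro!: measurable_completion borel_measurable_continuous_onI)
  then have "(\<lambda>t. \<integral>y. 1 * \<psi> (y + t *\<^sub>R v) \<partial>lebesgue) = (\<lambda>t. \<integral>y. \<psi> y \<partial>lebesgue)"
    by (simp add: integral_translation)
  then show ?thesis
    using integral_translation_DERIV[of "\<lambda>_. 1", OF L1_loc_continuous \<psi>, of v]
    by (simp add: DERIV_unique[OF _ DERIV_const])
qed

text \<open>The product of \<open>f\<close> and a test function has bounded support, so its partial
  derivatives integrate to zero; the product rule splits this into the two integrals of the
  definition.\<close>

lemma is_weak_gradient_grad:
  assumes f: "Ck (Suc 0) f"
  shows "is_weak_gradient f (grad f)"
  unfolding is_weak_gradient_def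
proof (intro conjI ballI allI)
  show L: "L1_loc f" "L1_loc (grad f)"
    by (intro L1_loc_continuous Ck_continuous_on[OF f] Ck_continuous_grad[OF f])+
  fix \<psi> :: "real^'a \<Rightarrow> real" and i assume \<psi>: "\<psi> \<in> Cc_infinity UNIV"
  then have c: "Ck (Suc 0) \<psi>" by (simp add: Cc_infinity_UNIV_iff smooth_Ck del: Ck.simps)
  have "(\<integral>y. axis i 1 \<bullet> grad (\<lambda>x. f x * \<psi> x) y \<partial>lebesgue) = 0"
    using \<psi> by (intro integral_grad_eq_0 Ck_mult f c) (auto simp: Cc_infinity_UNIV_iff elim: bounded_subset)
  moreover have "axis i 1 \<bullet> grad (\<lambda>x. f x * \<psi> x) y = f y * partial_deriv i \<psi> y + grad f y $ i * \<psi> y" for y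
  proof -
    have "f differentiable (at y)" "\<psi> differentiable (at y)"
      using Ck_has_derivative[OF f, of y] Ck_has_derivative[OF c, of y] by (auto simp: differentiable_def)
    then show ?thesis by (simp add: grad_mult inner_add_right inner_axis')
  qed
  ultimately show "(\<integral>x. f x * partial_deriv i \<psi> x \<partial>lebesgue) = - (\<integral>x. grad f x $ i * \<psi> x \<partial>lebesgue)"
    using Cc_infinity_integrable_mult[OF L(1) Cc_infinity_partial_deriv[OF \<psi>, of i]]
      Cc_infinity_integrable_mult[OF L1_loc_nth[OF L(2), of i] \<psi>] by simp
qed

section \<open>Affine energies\<close>

lemma nn_integral_sphere_measure:
  fixes F :: "real^'n \<Rightarrow> ennreal"
  assumes [measurable]: "F \<in> borel_measurable borel"
  shows "(\<integral>\<^sup>+\<xi>. F \<xi> \<partial>sphere_measure) = of_nat CARD('n) * (\<integral>\<^sup>+x. F (x /\<^sub>R norm x) * indicator (ball 0 1 - {0}) x \<partial>lborel)"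
proof -
  let ?R = "restrict_space lborel (ball 0 1 - {0}) :: (real^'n) measure"
  have "(\<lambda>x::real^'n. x /\<^sub>R norm x) \<in> restrict_space borel (ball 0 1 - {0}) \<rightarrow>\<^sub>M restrict_space borel (sphere 0 1)"
    by (rule measurable_restrict_space3) auto
  then have m: "(\<lambda>x::real^'n. x /\<^sub>R norm x) \<in> ?R \<rightarrow>\<^sub>M restrict_space borel (sphere 0 1)"
    by (simp cong: measurable_cong_sets add: sets_restrict_space_cong[OF sets_lborel])
  have F: "F \<in> borel_measurable (restrict_space borel (sphere 0 1))"
    by (rule measurable_restrict_space1) simp
  show ?thesis
    unfolding sphere_measure_def
    by (simp add: nn_integral_scale_measure nn_integral_distr[OF m] F nn_integral_restrict_space)
qed

text \<open>The layer cake formula for a single value. The value infinity is included because a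
  direction of vanishing energy produces an infinite integrand in the affine energy.\<close>

lemma emeasure_Ioo_ennreal: "(\<integral>\<^sup>+s. indicator {0<..} s * indicator {s. ennreal s < a} s \<partial>lborel) = a"
proof (cases a)
  case (real r)
  have "(\<integral>\<^sup>+s. indicator {0<..} s * indicator {s. ennreal s < a} s \<partial>lborel) = (\<integral>\<^sup>+s. indicator {0<..<r} s \<partial>lborel)"
    by (rule nn_integral_cong) (auto simp: indicator_def real ennreal_less_iff)
  then show ?thesis using real by simp
next
  case top
  have "(\<integral>\<^sup>+s. indicator {0<..} s * indicator {s. ennreal s < a} s \<partial>lborel) = (\<integral>\<^sup>+s. indicator {0::real<..} s \<partial>lborel)"
    by (rule nn_integral_cong) (auto simp: indicator_def top)
  also have "\<dots> = emeasure lborel {0::real<..}" by simp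
  also have "\<dots> = top"
  proof (rule ccontr)
    assume "emeasure lborel {0::real<..} \<noteq> top"
    then obtain r where r: "0 \<le> r" "emeasure lborel {0::real<..} = ennreal r" by (cases "emeasure lborel {0::real<..}") auto
    have "emeasure lborel {0<..<r + 1} \<le> emeasure lborel {0::real<..}"
      by (rule emeasure_mono) auto
    then show False using r by simp
  qed
  finally show ?thesis using top by simp
qed

text \<open>Integrating a function of homogeneity degree \<open>-n\<close> over the sphere amounts to integrating a function
  of its values over the whole space; this is what makes the integral invariant under \<open>SL(n)\<close>.
  The layer cake formula and the substitutions \<open>x = s\<^bsup>-1/n\<^esup> y\<close>, \<open>s = |y|\<^sup>n u\<close> lead from one side to the other.\<close>

lemma nn_integral_sphere_homogeneous:
  fixes G :: "real^'n \<Rightarrow> ennreal"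
  assumes [measurable]: "G \<in> borel_measurable borel"
    and hom: "\<And>t x. 0 < t \<Longrightarrow> G (t *\<^sub>R x) = ennreal (t powr - real CARD('n)) * G x"
  shows "(\<integral>\<^sup>+\<xi>. G \<xi> \<partial>sphere_measure) = of_nat CARD('n) *
    (\<integral>\<^sup>+y. (\<integral>\<^sup>+u. ennreal (1 / u) * indicator {1<..} u * indicator {u. ennreal u < G y} u \<partial>lborel) \<partial>lborel)"
proof -
  let ?n = "CARD('n)"
  \<comment> \<open>The extension of \<open>G\<close> from the sphere that is constant along rays.
    Its superlevel sets are invariant under dilations, so the substitution in \<open>x\<close>
    changes only the condition on the norm.\<close>
  define a where "a = (\<lambda>x. G (x /\<^sub>R norm x))"
  have am[measurable]: "a \<in> borel_measurable borel" unfolding a_def by measurable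
  have a_scale: "a (c *\<^sub>R x) = a x" if "0 < c" for c x
  proof -
    have "(c *\<^sub>R x) /\<^sub>R norm (c *\<^sub>R x) = x /\<^sub>R norm x"
      using that by (cases "x = 0") (simp_all add: field_simps)
    then show ?thesis by (simp only: a_def)
  qed
  have a_eq: "a x = ennreal (norm x ^ ?n) * G x" if "x \<noteq> 0" for x
    using that hom[of "inverse (norm x)" x] by (simp add: a_def powr_minus powr_realpow power_inverse)
  have sub: "(\<integral>\<^sup>+x. indicator (ball 0 1 - {0}) x * indicator {x. ennreal s < a x} x \<partial>lborel)
      = ennreal (1 / s) * (\<integral>\<^sup>+y. indicator {y. y \<noteq> 0 \<and> norm y ^ ?n < s} y * indicator {y. ennreal s < a y} y \<partial>lborel)"
    if s: "0 < s" for s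
  proof -
    define c where "c = s powr (- 1 / ?n)"
    have c0: "0 < c" using s by (simp add: c_def)
    have "c ^ ?n = c powr ?n" using c0 by (simp add: powr_realpow)
    also have "\<dots> = s powr ((- 1 / ?n) * ?n)" by (simp only: c_def powr_powr)
    also have "\<dots> = 1 / s" using s by (simp add: powr_neg_one)
    finally have c: "0 < c" "c ^ ?n = 1 / s" using c0 by auto
    have "(\<integral>\<^sup>+x. indicator (ball 0 1 - {0}) x * indicator {x. ennreal s < a x} x \<partial>lborel)
       = (\<integral>\<^sup>+x. indicator (ball 0 1 - {0}) x * indicator {x. ennreal s < a x} x
            \<partial>density (distr lborel borel (\<lambda>x::real^'n. 0 + c *\<^sub>R x)) (\<lambda>_. \<bar>c\<bar>^DIM(real^'n)))"
      using lborel_affine[of c "0::real^'n"] c by simp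
    also have "\<dots> = (\<integral>\<^sup>+x. ennreal (1 / s) * (indicator (ball 0 1 - {0}) (c *\<^sub>R x) * indicator {x. ennreal s < a x} (c *\<^sub>R x)) \<partial>lborel)"
    proof -
      have m[measurable]: "(\<lambda>x. indicator (ball 0 1 - {0}) x * indicator {x. ennreal s < a x} x :: ennreal) \<in> borel_measurable borel"
      proof (intro borel_measurable_times_ennreal borel_measurable_indicator)
        have "Measurable.pred borel (\<lambda>x. ennreal s < a x)" by measurable
        then show "{x. ennreal s < a x} \<in> sets borel" by (simp add: pred_def)
      qed auto
      show ?thesis
        by (subst nn_integral_density, measurable, subst nn_integral_distr, measurable) (use c in simp)
    qed
    also have "\<dots> = (\<integral>\<^sup>+x. ennreal (1 / s) * (indicator {y. y \<noteq> 0 \<and> norm y ^ ?n < s} x * indicator {y. ennreal s < a y} x) \<partial>lborel)"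
    proof (rule nn_integral_cong)
      fix x :: "real^'n"
      have "c * norm x < 1 \<longleftrightarrow> norm x ^ ?n < s"
      proof -
        have "c * norm x < 1 \<longleftrightarrow> (c * norm x) ^ ?n < 1 ^ ?n"
          using c power_mono_iff[of 1 "c * norm x" ?n] by (simp only: not_le[symmetric]) simp
        also have "\<dots> \<longleftrightarrow> (1 / s) * norm x ^ ?n < 1" by (simp only: power_mult_distrib c power_one)
        also have "\<dots> \<longleftrightarrow> norm x ^ ?n < s" using s by (simp add: field_simps)
        finally show ?thesis .
      qed
      then show "ennreal (1 / s) * (indicator (ball 0 1 - {0}) (c *\<^sub>R x) * indicator {x. ennreal s < a x} (c *\<^sub>R x))
         = ennreal (1 / s) * (indicator {y. y \<noteq> 0 \<and> norm y ^ ?n < s} x * indicator {y. ennreal s < a y} x)"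
        using c by (auto simp: indicator_def a_scale)
    qed
    also have "\<dots> = ennreal (1 / s) * (\<integral>\<^sup>+y. indicator {y. y \<noteq> 0 \<and> norm y ^ ?n < s} y * indicator {y. ennreal s < a y} y \<partial>lborel)"
      by (rule nn_integral_cmult)
         (unfold indicator_def of_bool_def mem_Collect_eq Diff_iff mem_ball singleton_iff greaterThan_iff, measurable)
    finally show ?thesis .
  qed
  \<comment> \<open>With \<open>a y = norm y ^ ?n * G y\<close> the scaling of \<open>s\<close>
    turns the condition \<open>norm y ^ ?n < s\<close> into \<open>1 < u\<close> and the condition
    \<open>s < a y\<close> into \<open>u < G y\<close>, while the density \<open>1 / s\<close> is
    scaling invariant. All dependence on \<open>norm y\<close> disappears.\<close>
  have sub2: "(\<integral>\<^sup>+s. indicator {0<..} s * (ennreal (1 / s) * (indicator {y. y \<noteq> 0 \<and> norm y ^ ?n < s} y * indicator {y. ennreal s < a y} y)) \<partial>lborel)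
     = (\<integral>\<^sup>+u. ennreal (1 / u) * indicator {1<..} u * indicator {u. ennreal u < G y} u \<partial>lborel)"
    if y: "y \<noteq> 0" for y :: "real^'n"
  proof -
    let ?c = "norm y ^ ?n"
    have c: "0 < ?c" using y by (intro zero_less_power) simp
    have "(\<integral>\<^sup>+s. indicator {0<..} s * (ennreal (1 / s) * (indicator {y. y \<noteq> 0 \<and> norm y ^ ?n < s} y * indicator {y. ennreal s < a y} y)) \<partial>lborel)
       = ennreal ?c * (\<integral>\<^sup>+u. indicator {0<..} (0 + ?c * u) * (ennreal (1 / (0 + ?c * u)) * (indicator {y. y \<noteq> 0 \<and> norm y ^ ?n < 0 + ?c * u} y * indicator {y. ennreal (0 + ?c * u) < a y} y)) \<partial>lborel)"
      using c y by (subst nn_integral_real_affine[of _ ?c 0]) auto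
    also have "\<dots> = (\<integral>\<^sup>+u. ennreal ?c * (indicator {0<..} (0 + ?c * u) * (ennreal (1 / (0 + ?c * u)) * (indicator {y. y \<noteq> 0 \<and> norm y ^ ?n < 0 + ?c * u} y * indicator {y. ennreal (0 + ?c * u) < a y} y))) \<partial>lborel)"
      by (rule nn_integral_cmult[symmetric]) measurable
    also have "\<dots> = (\<integral>\<^sup>+u. ennreal (1 / u) * indicator {1<..} u * indicator {u. ennreal u < G y} u \<partial>lborel)"
    proof (rule nn_integral_cong)
      fix u :: real
      have 1: "?c < ?c * u \<longleftrightarrow> 1 < u" using c by simp
      show "ennreal ?c * (indicator {0<..} (0 + ?c * u) * (ennreal (1 / (0 + ?c * u)) * (indicator {y. y \<noteq> 0 \<and> norm y ^ ?n < 0 + ?c * u} y * indicator {y. ennreal (0 + ?c * u) < a y} y)))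
        = ennreal (1 / u) * indicator {1<..} u * indicator {u. ennreal u < G y} u"
      proof (cases "1 < u")
        case True
        have "ennreal (?c * u) < a y \<longleftrightarrow> ennreal ?c * ennreal u < ennreal ?c * G y"
          using y True c by (simp add: a_eq ennreal_mult)
        also have "\<dots> \<longleftrightarrow> ennreal u < G y"
          using c y ennreal_mult_strict_left_mono[of "ennreal u" "G y" "ennreal ?c"]
            mult_left_mono[of "G y" "ennreal u" "ennreal ?c"] by (auto simp: not_le[symmetric] top_unique)
        finally have 2: "ennreal (?c * u) < a y \<longleftrightarrow> ennreal u < G y" .
        have 3: "ennreal ?c * ennreal (1 / (?c * u)) = ennreal (1 / u)"
          using c y True by (subst ennreal_mult[symmetric]) auto
        show ?thesis using y True c 2 3 by (auto simp: indicator_def)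
      next
        case False
        then show ?thesis using 1 by (auto simp: indicator_def)
      qed
    qed
    finally show ?thesis .
  qed
  have "(\<integral>\<^sup>+x. a x * indicator (ball 0 1 - {0}) x \<partial>lborel)
     = (\<integral>\<^sup>+x. (\<integral>\<^sup>+s. indicator {0<..} s * (indicator (ball 0 1 - {0}) x * indicator {x. ennreal s < a x} x) \<partial>lborel) \<partial>lborel)"
  proof (rule nn_integral_cong)
    fix x :: "real^'n"
    have "(\<integral>\<^sup>+s. indicator {0<..} s * (indicator (ball 0 1 - {0}) x * indicator {x. ennreal s < a x} x) \<partial>lborel)
      = (\<integral>\<^sup>+s. indicator (ball 0 1 - {0}) x * (indicator {0<..} s * indicator {s. ennreal s < a x} s) \<partial>lborel)"
      by (rule nn_integral_cong) (auto simp: indicator_def)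
    also have "\<dots> = indicator (ball 0 1 - {0}) x * a x"
      by (subst nn_integral_cmult) (auto simp: emeasure_Ioo_ennreal)
    finally show "a x * indicator (ball 0 1 - {0}) x
      = (\<integral>\<^sup>+s. indicator {0<..} s * (indicator (ball 0 1 - {0}) x * indicator {x. ennreal s < a x} x) \<partial>lborel)"
      by (simp add: mult.commute)
  qed
  also have "\<dots> = (\<integral>\<^sup>+s. (\<integral>\<^sup>+x. indicator {0<..} s * (indicator (ball 0 1 - {0}) x * indicator {x. ennreal s < a x} x) \<partial>lborel) \<partial>lborel)"
    by (rule lborel_pair.Fubini'[symmetric])
       (unfold indicator_def of_bool_def mem_Collect_eq Diff_iff mem_ball singleton_iff greaterThan_iff, measurable)
  also have "\<dots> = (\<integral>\<^sup>+s. (\<integral>\<^sup>+y. indicator {0<..} s * (ennreal (1 / s) * (indicator {y. y \<noteq> 0 \<and> norm y ^ ?n < s} y * indicator {y. ennreal s < a y} y)) \<partial>lborel) \<partial>lborel)"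
  proof (rule nn_integral_cong)
    fix s :: real
    have "(\<integral>\<^sup>+x. indicator {0<..} s * (indicator (ball 0 1 - {0}) x * indicator {x. ennreal s < a x} x) \<partial>lborel)
      = indicator {0<..} s * (\<integral>\<^sup>+x. indicator (ball 0 1 - {0}) x * indicator {x. ennreal s < a x} x \<partial>lborel)"
      by (rule nn_integral_cmult)
         (unfold indicator_def of_bool_def mem_Collect_eq Diff_iff mem_ball singleton_iff greaterThan_iff, measurable)
    also have "\<dots> = indicator {0<..} s * (ennreal (1 / s) * (\<integral>\<^sup>+y. indicator {y. y \<noteq> 0 \<and> norm y ^ ?n < s} y * indicator {y. ennreal s < a y} y \<partial>lborel))"
      by (cases "0 < s") (simp_all add: sub)
    also have "\<dots> = (\<integral>\<^sup>+y. indicator {0<..} s * (ennreal (1 / s) * (indicator {y. y \<noteq> 0 \<and> norm y ^ ?n < s} y * indicator {y. ennreal s < a y} y)) \<partial>lborel)"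
      by (simp add: nn_integral_cmult)
    finally show "(\<integral>\<^sup>+x. indicator {0<..} s * (indicator (ball 0 1 - {0}) x * indicator {x. ennreal s < a x} x) \<partial>lborel)
       = (\<integral>\<^sup>+y. indicator {0<..} s * (ennreal (1 / s) * (indicator {y. y \<noteq> 0 \<and> norm y ^ ?n < s} y * indicator {y. ennreal s < a y} y)) \<partial>lborel)" .
  qed
  also have "\<dots> = (\<integral>\<^sup>+y. (\<integral>\<^sup>+s. indicator {0<..} s * (ennreal (1 / s) * (indicator {y. y \<noteq> 0 \<and> norm y ^ ?n < s} y * indicator {y. ennreal s < a y} y)) \<partial>lborel) \<partial>lborel)"
    by (rule lborel_pair.Fubini'[symmetric])
       (unfold indicator_def of_bool_def mem_Collect_eq Diff_iff mem_ball singleton_iff greaterThan_iff, measurable)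
  also have "\<dots> = (\<integral>\<^sup>+y. (\<integral>\<^sup>+u. ennreal (1 / u) * indicator {1<..} u * indicator {u. ennreal u < G y} u \<partial>lborel) \<partial>lborel)"
  proof (rule nn_integral_cong_AE)
    have "AE y in lborel. y \<noteq> (0::real^'n)" by (rule AE_lborel_singleton)
    then show "AE y in lborel. (\<integral>\<^sup>+s. indicator {0<..} s * (ennreal (1 / s) * (indicator {y. y \<noteq> 0 \<and> norm y ^ ?n < s} y * indicator {y. ennreal s < a y} y)) \<partial>lborel)
      = (\<integral>\<^sup>+u. ennreal (1 / u) * indicator {1<..} u * indicator {u. ennreal u < G y} u \<partial>lborel)"
      by eventually_elim (rule sub2)
  qed
  finally show ?thesis by (simp add: nn_integral_sphere_measure a_def)
qed

lemma nn_integral_sphere_unimodular: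
  fixes G :: "real^'n \<Rightarrow> ennreal"
  assumes A: "det A = 1" and [measurable]: "G \<in> borel_measurable borel"
    and hom: "\<And>t x. 0 < t \<Longrightarrow> G (t *\<^sub>R x) = ennreal (t powr - real CARD('n)) * G x"
  shows "(\<integral>\<^sup>+\<xi>. G (A *v \<xi>) \<partial>sphere_measure) = (\<integral>\<^sup>+\<xi>. G \<xi> \<partial>sphere_measure)"
proof -
  let ?L = "\<lambda>y. \<integral>\<^sup>+u. ennreal (1 / u) * indicator {1<..} u * indicator {u. ennreal u < G y} u \<partial>lborel"
  have "(\<integral>\<^sup>+\<xi>. G (A *v \<xi>) \<partial>sphere_measure) = of_nat CARD('n) * (\<integral>\<^sup>+y. ?L (A *v y) \<partial>lborel)"
    by (rule nn_integral_sphere_homogeneous) (auto simp: hom matrix_vector_mult_scaleR)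
  also have "(\<integral>\<^sup>+y. ?L (A *v y) \<partial>lborel) = (\<integral>\<^sup>+y. ?L y \<partial>lborel)"
    using nn_integral_lborel_linear[of A ?L] A by simp
  also have "of_nat CARD('n) * \<dots> = (\<integral>\<^sup>+\<xi>. G \<xi> \<partial>sphere_measure)"
    by (rule nn_integral_sphere_homogeneous[symmetric]) (auto simp: hom)
  finally show ?thesis .
qed

section \<open>Directional energies and their integral over the sphere\<close>

lemma lebesgue_measurable_ex_borel:
  fixes g :: "real ^ 'n \<Rightarrow> real ^ 'n"
  assumes "g \<in> borel_measurable lebesgue"
  obtains g' where "g' \<in> borel_measurable borel" "AE x in lebesgue. g x = g' x"
proof -
  have "\<exists>h. h \<in> borel_measurable lborel \<and> (AE x in lborel. g x $ i = h x)" for i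
    using completion_ex_borel_measurable_real[OF borel_measurable_vec_nth_compose[OF assms, of i]] by auto
  then obtain h where h: "\<And>i. h i \<in> borel_measurable lborel" "\<And>i. AE x in lborel. g x $ i = h i x"
    by metis
  have "(\<lambda>x. \<chi> i. h i x) \<in> borel_measurable borel"
    using h(1) unfolding borel_measurable_euclidean_space[where f="\<lambda>x. \<chi> i. h i x"]
    by (auto simp: Basis_vec_def inner_axis)
  moreover have "AE x in lborel. \<forall>i. g x $ i = h i x"
    using h(2) by (simp add: AE_all_countable)
  then have "AE x in lebesgue. \<forall>i. g x $ i = h i x" by (rule AE_completion)
  then have "AE x in lebesgue. g x = (\<chi> i. h i x)"
    by eventually_elim (simp add: vec_eq_iff)
  ultimately show ?thesis by (rule that)
qed

text \<open>Measurability of a parametrised integral requires an integrand that is jointly Borel in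
  \<xi> and \<open>x\<close>. A Borel representative of \<open>g\<close> provides one, and the
  integral does not see the exceptional null set.\<close>

lemma borel_measurable_Lp_integral_inner [measurable]:
  fixes g :: "real ^ 'n \<Rightarrow> real ^ 'n"
  assumes "g \<in> borel_measurable lebesgue"
  shows "(\<lambda>\<xi>. Lp_integral p (\<lambda>x. \<xi> \<bullet> g x)) \<in> borel_measurable borel"
proof -
  obtain g' where g': "g' \<in> borel_measurable borel" "AE x in lebesgue. g x = g' x"
    using lebesgue_measurable_ex_borel[OF assms] .
  have "Lp_integral p (\<lambda>x. \<xi> \<bullet> g x) = (\<integral>\<^sup>+x. ennreal (\<bar>\<xi> \<bullet> g' x\<bar> powr p) \<partial>lborel)" for \<xi>
  proof -
    have "Lp_integral p (\<lambda>x. \<xi> \<bullet> g x) = Lp_integral p (\<lambda>x. \<xi> \<bullet> g' x)"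
      using g'(2) by (intro Lp_integral_cong_AE) auto
    then show ?thesis by (simp add: Lp_integral_def nn_integral_completion)
  qed
  moreover have "(\<lambda>\<xi>. \<integral>\<^sup>+x. ennreal (\<bar>\<xi> \<bullet> g' x\<bar> powr p) \<partial>lborel) \<in> borel_measurable borel"
    using g'(1) by measurable
  ultimately show ?thesis by simp
qed

lemma Lp_integral_cmult:
  fixes f :: "real ^ 'n \<Rightarrow> real"
  assumes [measurable]: "f \<in> borel_measurable lebesgue" and "0 \<le> t"
  shows "Lp_integral p (\<lambda>x. t * f x) = ennreal (t powr p) * Lp_integral p f"
  unfolding Lp_integral_def using assms(2)
  by (subst nn_integral_cmult[symmetric]) (auto simp: abs_mult powr_mult ennreal_mult)

lemma Lp_integral_inner_scale:
  fixes g :: "real ^ 'n \<Rightarrow> real ^ 'n"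
  assumes [measurable]: "g \<in> borel_measurable lebesgue" and "0 \<le> t"
  shows "Lp_integral p (\<lambda>x. (t *\<^sub>R \<xi>) \<bullet> g x) = ennreal (t powr p) * Lp_integral p (\<lambda>x. \<xi> \<bullet> g x)"
  using Lp_integral_cmult[of "\<lambda>x. \<xi> \<bullet> g x" t p] assms by simp

text \<open>The integral inside the affine energy, for an explicit vector field, so that any weak
  gradient may replace the chosen representative. The exponent is divided by \<open>p\<close>
  because \<open>Lp_integral\<close> takes no root.\<close>

definition sphere_integral :: "real \<Rightarrow> (real ^ 'n \<Rightarrow> real ^ 'n) \<Rightarrow> ennreal" where
  "sphere_integral p g = (\<integral>\<^sup>+\<xi>. Lp_integral p (\<lambda>x. \<xi> \<bullet> g x) epowr (- real CARD('n) / p) \<partial>sphere_measure)"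

lemma affine_energy_eq:
  fixes f :: "real ^ 'n \<Rightarrow> real"
  assumes "0 < p" "is_weak_gradient f g"
  shows "affine_energy p f = sphere_integral p g epowr (- 1 / real CARD('n))"
proof -
  have "Lp_norm p (\<lambda>x. \<xi> \<bullet> weak_gradient f x) = Lp_norm p (\<lambda>x. \<xi> \<bullet> g x)" for \<xi>
    using weak_gradient_AE_eq[OF assms(2)] by (intro Lp_norm_cong_AE) auto
  then show ?thesis
    using assms(1) by (simp add: affine_energy_def sphere_integral_def Lp_norm_epowr)
qed

text \<open>The transpose moves \<open>A\<close> from the gradient to the direction: the energy of
  the transformed field in direction \<xi> is that of \<open>g\<close> at \<open>A *v \<xi>\<close>.
  Raised to the power \<open>- n / p\<close> it is homogeneous of degree \<open>- n\<close>, which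
  is exactly the degree for which integrals over the sphere are invariant.\<close>

lemma sphere_integral_unimodular:
  fixes g :: "real ^ 'n \<Rightarrow> real ^ 'n"
  assumes p: "0 < p" and A: "det A = 1" and [measurable]: "g \<in> borel_measurable lebesgue"
  shows "sphere_integral p (\<lambda>x. transpose A *v g (A *v x)) = sphere_integral p g"
proof -
  let ?G = "\<lambda>\<xi>. Lp_integral p (\<lambda>x. \<xi> \<bullet> g x) epowr (- real CARD('n) / p)"
  have "Lp_integral p (\<lambda>x. \<xi> \<bullet> (transpose A *v g (A *v x))) = Lp_integral p (\<lambda>x. (A *v \<xi>) \<bullet> g x)" for \<xi>
    using Lp_integral_unimodular[OF A, of "\<lambda>x. (A *v \<xi>) \<bullet> g x" p]
    by (simp only: inner_transpose_matrix_vector) simp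
  then have "sphere_integral p (\<lambda>x. transpose A *v g (A *v x)) = (\<integral>\<^sup>+\<xi>. ?G (A *v \<xi>) \<partial>sphere_measure)"
    by (simp add: sphere_integral_def)
  also have "\<dots> = (\<integral>\<^sup>+\<xi>. ?G \<xi> \<partial>sphere_measure)"
  proof (rule nn_integral_sphere_unimodular[OF A])
    show "?G (t *\<^sub>R x) = ennreal (t powr - real CARD('n)) * ?G x" if "0 < t" for t x
    proof -
      have "(t powr p) powr (- real CARD('n) / p) = t powr - real CARD('n)"
        using p by (simp add: powr_powr)
      then show ?thesis
        using that p epowr_cmult[of "t powr p" "Lp_integral p (\<lambda>y. x \<bullet> g y)"]
        by (simp add: Lp_integral_inner_scale del: inner_scaleR_left)
    qed
  qed measurable
  finally show ?thesis by (simp add: sphere_integral_def)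
qed

lemma affine_energy_unimodular:
  assumes "0 < p" "weakly_differentiable f" "det A = 1"
  shows "affine_energy p (\<lambda>x. f (A *v x)) = affine_energy p f"
proof -
  note w = weakly_differentiable_weak_gradient[OF assms(2)]
  show ?thesis
    using affine_energy_eq[OF assms(1) is_weak_gradient_unimodular[OF w assms(3)]]
      affine_energy_eq[OF assms(1) w] sphere_integral_unimodular[OF assms(1,3) L1_loc_measurable[OF is_weak_gradient_L1_loc(2)[OF w]]]
    by simp
qed

section \<open>The affine Sobolev inequality and its invariance\<close>

lemma epowr_less_top: "0 < a \<Longrightarrow> x epowr a < top \<longleftrightarrow> x < top"
  by (cases x rule: ennreal_cases3) (auto simp: epowr_0_left epowr_top epowr_ennreal_pos)

lemma W_homI:
  assumes "0 < p" "is_weak_gradient f g" "Lp_integral p g < \<infinity>"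
    "\<And>t. 0 < t \<Longrightarrow> emeasure lebesgue {x. \<bar>f x\<bar> > t} < \<infinity>"
  shows "f \<in> W_hom p"
proof -
  have "Lp_norm p (weak_gradient f) = Lp_norm p g"
    using weak_gradient_AE_eq[OF assms(2)] by (rule Lp_norm_cong_AE)
  moreover have "Lp_norm p g < \<infinity>"
    using assms by (simp add: Lp_norm_eq epowr_less_top)
  ultimately show ?thesis
    using assms by (auto simp: W_hom_def weakly_differentiable_def)
qed

lemma W_homD:
  assumes "0 < p" "f \<in> W_hom p"
  shows "is_weak_gradient f (weak_gradient f)" "Lp_integral p (weak_gradient f) < \<infinity>"
    "\<And>t. 0 < t \<Longrightarrow> emeasure lebesgue {x. \<bar>f x\<bar> > t} < \<infinity>"
  using assms by (auto simp: W_hom_def weakly_differentiable_weak_gradient Lp_norm_eq epowr_less_top)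

lemma W_hom_unimodular:
  fixes A :: "real ^ 'n ^ 'n"
  assumes p: "0 < p" and f: "f \<in> W_hom p" and A: "det A = 1"
  shows "(\<lambda>x. f (A *v x)) \<in> W_hom p"
proof -
  note w = W_homD[OF p f]
  note m = L1_loc_measurable[OF is_weak_gradient_L1_loc(1)[OF w(1)]]
    L1_loc_measurable[OF is_weak_gradient_L1_loc(2)[OF w(1)]]
  let ?g = "weak_gradient f"
  have lin: "bounded_linear (\<lambda>v. transpose A *v v)" by (rule matrix_vector_mul_bounded_linear)
  let ?K = "onorm (\<lambda>v. transpose A *v v)"
  have K: "0 \<le> ?K" by (rule onorm_pos_le[OF lin])
  show ?thesis
  proof (rule W_homI[OF p is_weak_gradient_unimodular[OF w(1) A]])
    have "Lp_integral p (\<lambda>x. transpose A *v ?g (A *v x)) \<le> Lp_integral p (\<lambda>x. ?K * norm (?g (A *v x)))"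
      unfolding Lp_integral_def
    proof (intro nn_integral_mono ennreal_leI powr_mono2)
      show "norm (transpose A *v ?g (A *v x)) \<le> norm (?K * norm (?g (A *v x)))" for x
        using onorm[OF lin, of "?g (A *v x)"] K by (simp add: abs_mult)
    qed (use p in auto)
    also have "\<dots> = Lp_integral p (\<lambda>x. ?K * norm (?g x))"
      using Lp_integral_unimodular[OF A, of "\<lambda>x. ?K * norm (?g x)" p] m by simp
    also have "\<dots> = ennreal (?K powr p) * Lp_integral p (\<lambda>x. norm (?g x))"
      using m K by (intro Lp_integral_cmult) auto
    also have "\<dots> < \<infinity>"
      using w(2) by (simp add: Lp_integral_def ennreal_mult_less_top)
    finally show "Lp_integral p (\<lambda>x. transpose A *v ?g (A *v x)) < \<infinity>" .
    fix t :: real assume "0 < t"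
    let ?S = "{x. \<bar>f x\<bar> > t}"
    have S: "?S \<in> sets lebesgue"
      using measurable_sets[OF borel_measurable_abs[OF m(1)], of "{t<..}"] by (simp add: vimage_def)
    have "emeasure lebesgue {x. \<bar>f (A *v x)\<bar> > t} = emeasure (distr lebesgue lebesgue (\<lambda>x. A *v x)) ?S"
      using S by (subst emeasure_distr) (auto simp: lebesgue_measurable_unimodular[OF A] vimage_def)
    then show "emeasure lebesgue {x. \<bar>f (A *v x)\<bar> > t} < \<infinity>"
      using w(3)[OF \<open>0 < t\<close>] by (simp add: distr_lebesgue_unimodular[OF A])
  qed
qed

text \<open>The supremum is itself an admissible constant, because multiplication by a fixed
  extended real commutes with suprema.\<close>

lemma S_aff_mult_Lp_norm_le:
  fixes f :: "real ^ 'n \<Rightarrow> real"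
  assumes "f \<in> W_hom p"
  shows "S_aff TYPE('n) p * Lp_norm (sobolev_exp (real CARD('n)) p) f \<le> affine_energy p f"
proof -
  let ?X = "{S. \<forall>f \<in> (W_hom p :: (real ^ 'n \<Rightarrow> real) set). S * Lp_norm (sobolev_exp (real CARD('n)) p) f \<le> affine_energy p f}"
  have "Sup ?X * Lp_norm (sobolev_exp (real CARD('n)) p) f = (SUP S\<in>?X. S * Lp_norm (sobolev_exp (real CARD('n)) p) f)"
    using SUP_mult_right_ennreal[of "\<lambda>x. x" ?X "Lp_norm (sobolev_exp (real CARD('n)) p) f"] by simp
  also have "\<dots> \<le> affine_energy p f"
    using assms by (intro SUP_least) auto
  finally show ?thesis by (simp add: S_aff_def)
qed

lemma M_aff_unimodular:
  fixes A :: "real ^ 'n ^ 'n"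
  assumes p: "0 < p" and f: "f \<in> M_aff p" and A: "det A = 1" and q: "0 < sobolev_exp (real CARD('n)) p"
  shows "(\<lambda>x. f (A *v x)) \<in> M_aff p"
proof -
  let ?q = "sobolev_exp (real CARD('n)) p"
  have W: "f \<in> W_hom p" using f by (simp add: M_aff_def)
  note w = W_homD[OF p W]
  note m = L1_loc_measurable[OF is_weak_gradient_L1_loc(1)[OF w(1)]]
  have "affine_energy p (\<lambda>x. f (A *v x)) = affine_energy p f"
    using w by (intro affine_energy_unimodular p A) (auto simp: weakly_differentiable_def)
  moreover have "Lp_norm ?q (\<lambda>x. f (A *v x)) = Lp_norm ?q f"
    using Lp_integral_unimodular[OF A m] q by (simp add: Lp_norm_eq)
  moreover have "\<not> (AE x in lebesgue. f (A *v x) = 0)"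
  proof
    assume "AE x in lebesgue. f (A *v x) = 0"
    then have "AE x in distr lebesgue lebesgue (\<lambda>x. A *v x). f x = 0"
      using measurable_sets[OF m, of "{0}"]
      by (subst AE_distr_iff) (auto simp: lebesgue_measurable_unimodular[OF A] vimage_def)
    then show False using f unfolding distr_lebesgue_unimodular[OF A] by (simp add: M_aff_def)
  qed
  ultimately show ?thesis
    using f W_hom_unimodular[OF p W A] by (simp add: M_aff_def)
qed

lemma emeasure_sphere_measure_space:
  obtains \<sigma> where "0 < \<sigma>" "\<And>c. (\<integral>\<^sup>+\<xi>. c \<partial>(sphere_measure :: (real^'n) measure)) = c * ennreal \<sigma>"
proof -
  let ?B = "ball 0 1 - {0} :: (real^'n) set"
  have B: "?B \<in> sets borel" by simp
  have "?B \<subseteq> ball 0 1" by auto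
  then have fin: "emeasure lborel ?B < \<infinity>"
    by (intro emeasure_bounded_finite bounded_subset[OF bounded_ball])
  have "emeasure lborel ?B \<noteq> 0"
  proof
    assume 0: "emeasure lborel ?B = 0"
    have "open ?B" by (intro open_Diff) auto
    moreover have "?B \<noteq> {}"
    proof -
      have "(1/2) *\<^sub>R axis undefined 1 \<in> ?B" by (simp add: norm_axis_1 axis_eq_0_iff)
      then show ?thesis by blast
    qed
    ultimately have "\<not> negligible ?B" by (rule open_not_negligible)
    then show False using 0 B negligible_iff_emeasure0[of ?B] by simp
  qed
  then obtain b where b: "0 < b" "emeasure lborel ?B = ennreal b"
    using fin by (cases "emeasure lborel ?B" rule: ennreal_cases3) auto
  show ?thesis
  proof (rule that[of "real CARD('n) * b"])
    show "0 < real CARD('n) * b" using b by simp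
    show "(\<integral>\<^sup>+\<xi>. c \<partial>(sphere_measure :: (real^'n) measure)) = c * ennreal (real CARD('n) * b)" for c
      using nn_integral_sphere_measure[of "\<lambda>_::real^'n. c"] b B
      by (simp add: nn_integral_cmult_indicator ennreal_mult ennreal_of_nat_eq_real_of_nat ac_simps)
  qed
qed

lemma nn_integral_sphere_mono:
  fixes F :: "real^'n \<Rightarrow> ennreal"
  assumes "\<And>\<xi>. norm \<xi> = 1 \<Longrightarrow> F \<xi> \<le> G \<xi>"
  shows "(\<integral>\<^sup>+\<xi>. F \<xi> \<partial>sphere_measure) \<le> (\<integral>\<^sup>+\<xi>. G \<xi> \<partial>sphere_measure)"
  by (rule nn_integral_mono) (use assms in \<open>simp add: sphere_measure_def space_scale_measure space_restrict_space\<close>)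

text \<open>By Cauchy-Schwarz each directional energy is at most the full one. Two negative
  exponents are applied, one inside and one outside the integral over the sphere, so the order is
  reversed twice. The constant comes from the total mass of the sphere.\<close>

lemma affine_energy_le:
  assumes p: "0 < p"
  obtains C where "0 < C"
    "\<And>(f :: real ^ 'n \<Rightarrow> real) g. is_weak_gradient f g \<Longrightarrow> affine_energy p f \<le> ennreal C * Lp_norm p g"
proof -
  obtain \<sigma> where \<sigma>: "0 < \<sigma>" "\<And>c. (\<integral>\<^sup>+\<xi>. c \<partial>(sphere_measure :: (real^'n) measure)) = c * ennreal \<sigma>"
    using emeasure_sphere_measure_space by blast
  let ?n = "real CARD('n)"
  show ?thesis
  proof (rule that[of "\<sigma> powr (- 1 / ?n)"])
    show "0 < \<sigma> powr (- 1 / ?n)" using \<sigma> by simp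
    fix f :: "real ^ 'n \<Rightarrow> real" and g assume fg: "is_weak_gradient f g"
    have le: "Lp_integral p (\<lambda>x. \<xi> \<bullet> g x) \<le> Lp_integral p g" if "norm \<xi> = 1" for \<xi>
      unfolding Lp_integral_def
    proof (intro nn_integral_mono ennreal_leI powr_mono2)
      show "norm (\<xi> \<bullet> g x) \<le> norm (g x)" for x
        using Cauchy_Schwarz_ineq2[of \<xi> "g x"] that by simp
    qed (use p in auto)
    have "ennreal \<sigma> * Lp_integral p g epowr (- ?n / p) \<le> sphere_integral p g"
    proof -
      have "(\<integral>\<^sup>+\<xi>. Lp_integral p g epowr (- ?n / p) \<partial>(sphere_measure :: (real^'n) measure)) \<le> sphere_integral p g"
        unfolding sphere_integral_def
        by (intro nn_integral_sphere_mono epowr_antimono le) (use p in \<open>auto simp: divide_nonpos_pos\<close>)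
      then show ?thesis by (simp only: \<sigma>(2) mult.commute)
    qed
    then have "affine_energy p f \<le> (ennreal \<sigma> * Lp_integral p g epowr (- ?n / p)) epowr (- 1 / ?n)"
      unfolding affine_energy_eq[OF p fg] by (intro epowr_antimono) auto
    also have "\<dots> = ennreal (\<sigma> powr (- 1 / ?n)) * Lp_norm p g"
      using \<sigma>(1) p by (simp only: epowr_cmult epowr_epowr Lp_norm_eq) simp
    finally show "affine_energy p f \<le> ennreal (\<sigma> powr (- 1 / ?n)) * Lp_norm p g" .
  qed
qed

section \<open>Functions without derivative in one direction\<close>

lemma nn_integral_lebesgue_translation:
  fixes t :: "'a::euclidean_space"
  assumes "f \<in> borel_measurable lebesgue"
  shows "(\<integral>\<^sup>+x. f (x + t) \<partial>lebesgue) = (\<integral>\<^sup>+x. f x \<partial>lebesgue)"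
  using nn_integral_distr[OF lebesgue_measurable_translation[of t], of f] assms
  by (simp add: distr_lebesgue_translation)

lemma L1_loc_translation:
  fixes f :: "real ^ 'n \<Rightarrow> 'b::euclidean_space"
  assumes f: "L1_loc f"
  shows "L1_loc (\<lambda>x. f (x + t))"
  by (rule L1_loc_compose[OF lebesgue_measurable_translation distr_lebesgue_translation _ _ f])
     (auto intro!: continuous_intros simp: inj_def)

lemma Cc_infinity_translation:
  "\<psi> \<in> Cc_infinity UNIV \<Longrightarrow> (\<lambda>x. \<psi> (x + t)) \<in> Cc_infinity UNIV"
  using Cc_infinity_affine[of "mat 1" \<psi> t] by simp

text \<open>The pairing of \<open>f\<close> with a translated test function is differentiable in the
  translation parameter, and its derivative is minus the pairing with
  \<open>\<xi> \<bullet> g\<close>, hence zero. So the pairing is constant, and the fundamental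
  lemma converts this into a statement almost everywhere.\<close>

lemma translation_invariant_AE:
  assumes f: "is_weak_gradient f g" and 0: "AE x in lebesgue. \<xi> \<bullet> g x = 0"
  shows "AE x in lebesgue. f (x + t *\<^sub>R \<xi>) = f x"
proof -
  note L = is_weak_gradient_L1_loc[OF f]
  have const: "(\<integral>y. f y * \<psi> (y + s *\<^sub>R \<xi>) \<partial>lebesgue) = (\<integral>y. f y * \<psi> y \<partial>lebesgue)"
    if \<psi>: "\<psi> \<in> Cc_infinity UNIV" for \<psi> s
  proof -
    let ?H = "\<lambda>s. \<integral>y. f y * \<psi> (y + s *\<^sub>R \<xi>) \<partial>lebesgue"
    have "(?H has_real_derivative 0) (at s)" for s
    proof -
      define \<omega> where "\<omega> = (\<lambda>y. \<psi> (y + s *\<^sub>R \<xi>))"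
      have \<omega>: "\<omega> \<in> Cc_infinity UNIV"
        unfolding \<omega>_def by (rule Cc_infinity_translation[OF \<psi>])
      have "((\<lambda>t. \<integral>y. f y * \<omega> (y + t *\<^sub>R \<xi>) \<partial>lebesgue) has_real_derivative (\<integral>y. f y * (\<xi> \<bullet> grad \<omega> y) \<partial>lebesgue)) (at 0)"
        using \<omega> by (intro integral_translation_DERIV L) (auto simp: Cc_infinity_UNIV_iff smooth_Ck simp del: Ck.simps)
      moreover have "(\<integral>y. f y * (\<xi> \<bullet> grad \<omega> y) \<partial>lebesgue) = 0"
      proof -
        have "(\<integral>x. (\<xi> \<bullet> g x) * \<omega> x \<partial>lebesgue) = 0"
          using 0 by (intro integral_eq_zero_AE) auto
        then show ?thesis using is_weak_gradient_inner[OF f \<omega>, of \<xi>] by simp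
      qed
      moreover have "(\<lambda>t. \<integral>y. f y * \<omega> (y + t *\<^sub>R \<xi>) \<partial>lebesgue) = (\<lambda>t. ?H (t + s))"
        by (simp add: \<omega>_def algebra_simps)
      ultimately have "((\<lambda>t. ?H (t + s)) has_real_derivative 0) (at 0)" by simp
      then show ?thesis using DERIV_shift[of ?H 0 0 s] by simp
    qed
    then have "?H s = ?H 0" using DERIV_isconst_all by blast
    then show ?thesis by simp
  qed
  have "AE x in lebesgue. f (x + t *\<^sub>R \<xi>) + (- 1) * f x = 0"
  proof (rule Cc_infinity_null_imp_AE_0)
    have m: "L1_loc (\<lambda>x. (-1) * f x)"
      by (rule L1_loc_bounded_mult[where C=1, OF L(1)]) (use L1_loc_measurable[OF L(1)] in auto)
    then show "L1_loc (\<lambda>x. f (x + t *\<^sub>R \<xi>) + (- 1) * f x)"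
      by (intro L1_loc_add L1_loc_translation L(1))
    fix \<psi> :: "real^'a \<Rightarrow> real" assume \<psi>: "\<psi> \<in> Cc_infinity UNIV"
    let ?\<psi> = "\<lambda>x. \<psi> (x + (- t) *\<^sub>R \<xi>)"
    have "(\<integral>x. f (x + t *\<^sub>R \<xi>) * \<psi> x \<partial>lebesgue) = (\<integral>x. f x * ?\<psi> x \<partial>lebesgue)"
      using integral_translation[of "\<lambda>x. f x * ?\<psi> x" "t *\<^sub>R \<xi>"]
        borel_measurable_integrable[OF Cc_infinity_integrable_mult[OF L(1) Cc_infinity_translation[OF \<psi>, of "(- t) *\<^sub>R \<xi>"]]]
      by simp
    also have "\<dots> = (\<integral>x. f x * \<psi> x \<partial>lebesgue)" by (rule const[OF \<psi>])
    finally have "(\<integral>x. f (x + t *\<^sub>R \<xi>) * \<psi> x \<partial>lebesgue) = (\<integral>x. f x * \<psi> x \<partial>lebesgue)" .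
    moreover have "(f (x + t *\<^sub>R \<xi>) + (- 1) * f x) * \<psi> x = f (x + t *\<^sub>R \<xi>) * \<psi> x - f x * \<psi> x" for x
      by (simp add: algebra_simps)
    ultimately show "(\<integral>x. (f (x + t *\<^sub>R \<xi>) + (- 1) * f x) * \<psi> x \<partial>lebesgue) = 0"
      by (simp add: Cc_infinity_integrable_mult[OF L1_loc_translation[OF L(1)] \<psi>] Cc_infinity_integrable_mult[OF L(1) \<psi>])
  qed
  then show ?thesis by eventually_elim simp
qed

text \<open>If \<open>A\<close> meets a ball in positive measure, it meets each translate of the
  ball along \<xi> in the same measure. Infinitely many of these translates are disjoint, so
  \<open>A\<close> would have infinite measure.\<close>

lemma translation_invariant_finite_imp_null:
  fixes \<xi> :: "real ^ 'n"
  assumes A[measurable]: "A \<in> sets lebesgue" and fin: "emeasure lebesgue A < \<infinity>" and \<xi>: "\<xi> \<noteq> 0"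
    and inv: "\<And>t. AE x in lebesgue. indicator A (x + t *\<^sub>R \<xi>) = (indicator A x :: ennreal)"
  shows "emeasure lebesgue A = 0"
proof -
  have ball0: "emeasure lebesgue (A \<inter> ball 0 r) = 0" if r: "0 < r" for r
  proof -
    let ?B = "ball 0 r :: (real^'n) set"
    \<comment> \<open>Steps of twice the radius in the direction \<xi> make the translated open
      balls pairwise disjoint.\<close>
    define t where "t = 2 * r / norm \<xi>"
    have t: "norm (t *\<^sub>R \<xi>) = 2 * r" using \<xi> r by (simp add: t_def)
    have Bm: "(\<lambda>x. indicator ?B (x - a) :: ennreal) \<in> borel_measurable lebesgue" for a
    proof -
      have "(\<lambda>x. indicator ?B (x - a) :: ennreal) = indicator (ball a r)"
        by (auto simp: fun_eq_iff indicator_def dist_norm norm_minus_commute)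
      then show ?thesis by (simp add: borel_measurable_indicator)
    qed
    let ?m = "emeasure lebesgue (A \<inter> ?B)"
    have m: "(\<integral>\<^sup>+x. indicator A x * indicator ?B (x - (real k * t) *\<^sub>R \<xi>) \<partial>lebesgue) = ?m" for k :: nat
    proof -
      have "(\<integral>\<^sup>+x. indicator A x * indicator ?B (x - (real k * t) *\<^sub>R \<xi>) \<partial>lebesgue)
        = (\<integral>\<^sup>+x. indicator A (x + (real k * t) *\<^sub>R \<xi>) * indicator ?B x \<partial>lebesgue)"
        using nn_integral_lebesgue_translation[of "\<lambda>x. indicator A x * indicator ?B (x - (real k * t) *\<^sub>R \<xi>)" "(real k * t) *\<^sub>R \<xi>"] Bm
        by simp
      also have "\<dots> = (\<integral>\<^sup>+x. indicator A x * indicator ?B x \<partial>lebesgue)"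
        using inv[of "real k * t"] by (intro nn_integral_cong_AE) auto
      also have "\<dots> = (\<integral>\<^sup>+x. indicator (A \<inter> ?B) x \<partial>lebesgue)"
        by (rule nn_integral_cong) (auto simp: indicator_def)
      also have "\<dots> = ?m" by (rule nn_integral_indicator, rule sets.Int[OF A]) simp
      finally show ?thesis .
    qed
    have le: "of_nat K * ?m \<le> emeasure lebesgue A" for K :: nat
    proof -
      have disj: "(\<Sum>k<K. indicator ?B (x - (real k * t) *\<^sub>R \<xi>)) \<le> (1::ennreal)" for x
      proof (cases "\<exists>k<K. x - (real k * t) *\<^sub>R \<xi> \<in> ?B")
        case True
        then obtain k where k: "k < K" "x - (real k * t) *\<^sub>R \<xi> \<in> ?B" by blast
        have "x - (real l * t) *\<^sub>R \<xi> \<notin> ?B" if "l \<noteq> k" for l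
        proof
          assume "x - (real l * t) *\<^sub>R \<xi> \<in> ?B"
          with k have "norm ((x - (real l * t) *\<^sub>R \<xi>) - (x - (real k * t) *\<^sub>R \<xi>)) < 2 * r"
            by (intro order.strict_trans1[OF norm_triangle_ineq4]) simp
          moreover have "(x - (real l * t) *\<^sub>R \<xi>) - (x - (real k * t) *\<^sub>R \<xi>) = (real k - real l) *\<^sub>R (t *\<^sub>R \<xi>)"
            by (simp add: algebra_simps)
          ultimately have "\<bar>real k - real l\<bar> * (2 * r) < 2 * r"
            using t by (simp only: norm_scaleR real_norm_def)
          then have "\<bar>real k - real l\<bar> < 1" using r by simp
          then show False using that by linarith
        qed
        then have "(\<Sum>k<K. indicator ?B (x - (real k * t) *\<^sub>R \<xi>)) = (\<Sum>l<K. if l = k then 1 else (0::ennreal))"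
          using k by (intro sum.cong) (auto simp: indicator_def)
        then show ?thesis by simp
      next
        case False
        then have "(\<Sum>k<K. indicator ?B (x - (real k * t) *\<^sub>R \<xi>)) = (0::ennreal)"
          by (intro sum.neutral) (auto simp: indicator_def)
        then show ?thesis by simp
      qed
      have "of_nat K * ?m = (\<Sum>k<K. \<integral>\<^sup>+x. indicator A x * indicator ?B (x - (real k * t) *\<^sub>R \<xi>) \<partial>lebesgue)"
        by (simp add: m)
      also have "\<dots> = (\<integral>\<^sup>+x. (\<Sum>k<K. indicator A x * indicator ?B (x - (real k * t) *\<^sub>R \<xi>)) \<partial>lebesgue)"
        using Bm by (intro nn_integral_sum[symmetric] borel_measurable_times_ennreal) auto
      also have "\<dots> \<le> (\<integral>\<^sup>+x. indicator A x * 1 \<partial>lebesgue)"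
        by (intro nn_integral_mono) (simp only: sum_distrib_left[symmetric] mult_left_mono[OF disj zero_le])
      also have "\<dots> = emeasure lebesgue A" by simp
      finally show ?thesis .
    qed
    show "?m = 0"
    proof (rule ccontr)
      assume "?m \<noteq> 0"
      moreover have "?m \<le> emeasure lebesgue A" by (rule emeasure_mono[OF _ A]) auto
      ultimately obtain b where b: "?m = ennreal b" "0 < b"
        using fin by (cases ?m rule: ennreal_cases3) (auto simp: top_unique)
      obtain a where a: "emeasure lebesgue A = ennreal a" "0 \<le> a" using fin by (cases "emeasure lebesgue A") auto
      obtain K :: nat where "a / b < K" using reals_Archimedean2 by blast
      then have "a < real K * b" using b by (simp add: pos_divide_less_eq)
      moreover have "ennreal (real K * b) \<le> ennreal a"
        using le[of K] a b by (simp add: ennreal_mult ennreal_of_nat_eq_real_of_nat)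
      ultimately show False using a by simp
    qed
  qed
  have "A \<inter> ball 0 (real (Suc k)) \<in> null_sets lebesgue" for k
    using ball0[of "real (Suc k)"] by (intro null_setsI sets.Int[OF A]) auto
  then have "(\<Union>k. A \<inter> ball 0 (real (Suc k))) \<in> null_sets lebesgue" by (rule null_sets_UN)
  moreover have "(\<Union>k. A \<inter> ball 0 (real (Suc k))) = A"
  proof -
    have "\<exists>k. norm x < 1 + real k" for x :: "real^'n"
      using reals_Archimedean2[of "norm x"] by (metis add.commute less_add_one order_less_trans)
    then show ?thesis by auto
  qed
  ultimately show ?thesis by auto
qed

text \<open>Here the finiteness of the superlevel sets is decisive: nonzero constants have zero
  gradient as well. The superlevel sets at levels \<open>1 / (k + 1)\<close> are invariant along
  \<xi> up to null sets, hence null.\<close>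

lemma W_hom_directional_derivative_0:
  assumes p: "0 < p" and f: "f \<in> W_hom p" and \<xi>: "\<xi> \<noteq> 0"
    and 0: "AE x in lebesgue. \<xi> \<bullet> weak_gradient f x = 0"
  shows "AE x in lebesgue. f x = 0"
proof -
  note w = W_homD[OF p f]
  note m = L1_loc_measurable[OF is_weak_gradient_L1_loc(1)[OF w(1)]]
  have "{x. \<bar>f x\<bar> > inverse (real (Suc k))} \<in> null_sets lebesgue" for k
  proof (rule null_setsI)
    let ?A = "{x. \<bar>f x\<bar> > inverse (real (Suc k))}"
    show A: "?A \<in> sets lebesgue"
      using measurable_sets[OF borel_measurable_abs[OF m], of "{inverse (real (Suc k))<..}"] by (simp add: vimage_def)
    show "emeasure lebesgue ?A = 0"
    proof (rule translation_invariant_finite_imp_null[OF A _ \<xi>])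
      show "emeasure lebesgue ?A < \<infinity>" by (rule w(3)) simp
      show "AE x in lebesgue. indicator ?A (x + t *\<^sub>R \<xi>) = (indicator ?A x :: ennreal)" for t
        using translation_invariant_AE[OF w(1) 0, of t] by eventually_elim (simp add: indicator_def)
    qed
  qed
  then have "(\<Union>k. {x. \<bar>f x\<bar> > inverse (real (Suc k))}) \<in> null_sets lebesgue" by (rule null_sets_UN)
  then have "AE x in lebesgue. x \<notin> (\<Union>k. {x. \<bar>f x\<bar> > inverse (real (Suc k))})" by (rule AE_not_in)
  then show ?thesis
  proof eventually_elim
    case (elim x)
    then show ?case using reals_Archimedean[of "\<bar>f x\<bar>"] by fastforce
  qed
qed

text \<open>Directional energy is lower semicontinuous in the direction by Fatou, and the sphere is
  compact. A sequence of directions with energies tending to zero would accumulate at a direction of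
  energy zero.\<close>

lemma Lp_integral_inner_inf_pos:
  fixes g :: "real ^ 'n \<Rightarrow> real ^ 'n"
  assumes p: "0 < p" and g[measurable]: "g \<in> borel_measurable lebesgue"
    and pos: "\<And>\<xi>. norm \<xi> = 1 \<Longrightarrow> Lp_integral p (\<lambda>x. \<xi> \<bullet> g x) \<noteq> 0"
  obtains c where "0 < c" "\<And>\<xi>. norm \<xi> = 1 \<Longrightarrow> ennreal c \<le> Lp_integral p (\<lambda>x. \<xi> \<bullet> g x)"
proof (rule ccontr)
  assume "\<not> thesis"
  have "\<exists>\<xi>. norm \<xi> = 1 \<and> Lp_integral p (\<lambda>x. \<xi> \<bullet> g x) < ennreal (inverse (real (Suc k)))" for k
    using that[of "inverse (real (Suc k))"] \<open>\<not> thesis\<close> by (force simp: not_le)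
  then obtain X where X: "\<And>k. norm (X k) = 1" "\<And>k. Lp_integral p (\<lambda>x. X k \<bullet> g x) < ennreal (inverse (real (Suc k)))"
    by metis
  have "seq_compact (sphere (0::real^'n) 1)" using compact_sphere compact_eq_seq_compact_metric by blast
  then obtain \<xi> r where \<xi>: "\<xi> \<in> sphere 0 1" "strict_mono r" "(X \<circ> r) \<longlonglongrightarrow> \<xi>"
    using X(1) by (metis seq_compactE mem_sphere_0)
  have lim: "(\<lambda>k. ennreal (norm (X (r k) \<bullet> g x) powr p)) \<longlonglongrightarrow> ennreal (norm (\<xi> \<bullet> g x) powr p)" for x
    using \<xi>(3) p unfolding o_def
    by (intro tendsto_ennrealI tendsto_powr2 tendsto_norm tendsto_inner tendsto_const) auto
  have "Lp_integral p (\<lambda>x. \<xi> \<bullet> g x) = (\<integral>\<^sup>+x. liminf (\<lambda>k. ennreal (norm (X (r k) \<bullet> g x) powr p)) \<partial>lebesgue)"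
    unfolding Lp_integral_def using lim by (intro nn_integral_cong) (rule lim_imp_Liminf[OF _ lim, symmetric], simp)
  also have "\<dots> \<le> liminf (\<lambda>k. Lp_integral p (\<lambda>x. X (r k) \<bullet> g x))"
    unfolding Lp_integral_def by (rule nn_integral_liminf) measurable
  also have "\<dots> = 0"
  proof (rule lim_imp_Liminf)
    show "(\<lambda>k. Lp_integral p (\<lambda>x. X (r k) \<bullet> g x)) \<longlonglongrightarrow> 0"
    proof (rule tendsto_sandwich[OF _ _ tendsto_const])
      show "(\<lambda>k. ennreal (inverse (real (Suc (r k))))) \<longlonglongrightarrow> 0"
        using LIMSEQ_subseq_LIMSEQ[OF LIMSEQ_inverse_real_of_nat \<xi>(2)] tendsto_ennrealI by (fastforce simp: o_def)
      show "\<forall>\<^sub>F k in sequentially. Lp_integral p (\<lambda>x. X (r k) \<bullet> g x) \<le> ennreal (inverse (real (Suc (r k))))"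
        using X(2) by (intro always_eventually allI less_imp_le)
    qed simp
  qed simp
  finally show False using pos \<xi>(1) by simp
qed

text \<open>Energy zero would require an infinite integral over the sphere. The directional energies
  have a positive lower bound on the sphere, which bounds the integrand.\<close>

lemma affine_energy_pos:
  fixes f :: "real ^ 'n \<Rightarrow> real"
  assumes p: "0 < p" and f: "f \<in> W_hom p" and nz: "\<not> (AE x in lebesgue. f x = 0)"
  shows "affine_energy p f \<noteq> 0"
proof -
  note w = W_homD[OF p f]
  note m = L1_loc_measurable[OF is_weak_gradient_L1_loc(2)[OF w(1)]]
  let ?g = "weak_gradient f" and ?n = "real CARD('n)"
  have "Lp_integral p (\<lambda>x. \<xi> \<bullet> ?g x) \<noteq> 0" if "norm \<xi> = 1" for \<xi>
  proof
    assume 0: "Lp_integral p (\<lambda>x. \<xi> \<bullet> ?g x) = 0"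
    have mm: "(\<lambda>x. \<xi> \<bullet> ?g x) \<in> borel_measurable lebesgue" using m by simp
    have "AE x in lebesgue. ennreal (norm (\<xi> \<bullet> ?g x) powr p) = 0"
      using 0 mm unfolding Lp_integral_def by (subst (asm) nn_integral_0_iff_AE) auto
    then have "AE x in lebesgue. \<xi> \<bullet> ?g x = 0" by eventually_elim (simp add: ennreal_eq_0_iff)
    moreover have "\<xi> \<noteq> 0" using that by auto
    ultimately show False using W_hom_directional_derivative_0[OF p f] nz by blast
  qed
  then obtain c where c: "0 < c" "\<And>\<xi>. norm \<xi> = 1 \<Longrightarrow> ennreal c \<le> Lp_integral p (\<lambda>x. \<xi> \<bullet> ?g x)"
    using Lp_integral_inner_inf_pos[OF p m] by blast
  obtain \<sigma> where \<sigma>: "0 < \<sigma>" "\<And>c. (\<integral>\<^sup>+\<xi>. c \<partial>(sphere_measure :: (real^'n) measure)) = c * ennreal \<sigma>"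
    using emeasure_sphere_measure_space by blast
  have "sphere_integral p ?g \<le> (\<integral>\<^sup>+\<xi>. ennreal c epowr (- ?n / p) \<partial>(sphere_measure :: (real^'n) measure))"
    unfolding sphere_integral_def
    by (intro nn_integral_sphere_mono epowr_antimono c) (use p in \<open>auto simp: divide_nonpos_pos\<close>)
  also have "\<dots> < top" unfolding \<sigma>(2) using c(1) by (simp add: epowr_ennreal_pos ennreal_mult_less_top)
  finally have "sphere_integral p ?g \<noteq> top" by simp
  then show ?thesis
    unfolding affine_energy_eq[OF p w(1)]
    by (cases "sphere_integral p ?g" rule: ennreal_cases3) (auto simp: epowr_0_left epowr_ennreal_pos)
qed

section \<open>Cutting off a bump\<close>

text \<open>The additive saving \<open>a\<close> is worth a fixed factor only where \<open>j\<close>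
  is not too large, and \<open>s\<close> is the threshold. If \<open>j epowr (- r)\<close> is at
  most \<open>s\<close>, the last summand pays for the extra factor. Otherwise \<open>j\<close> lies
  below \<open>s powr (- 1 / r)\<close>, so \<open>a\<close> is at least the fraction
  \<open>a * s powr (1 / r)\<close> of \<open>j\<close>, and the negative power of \<open>j1\<close>
  is larger by the corresponding factor.\<close>

lemma powr_neg_gain:
  fixes j j1 :: ennreal
  assumes r: "1 \<le> r" and a: "0 < a" and s: "0 < s" and le: "j1 + ennreal a \<le> j"
  shows "ennreal (1 + a * s powr (1 / r)) * j epowr (- r) \<le> j1 epowr (- r) + ennreal (a * s powr (1 / r) * s)"
proof (cases "j = \<infinity>")
  case True
  then show ?thesis using r by (simp add: epowr_top)
next
  case False
  let ?b = "a * s powr (1 / r)"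
  have b: "0 < ?b" using a s by simp
  obtain x where x: "j = ennreal x" "0 \<le> x" using False by (cases j) auto
  have "j1 \<noteq> \<infinity>" using le False by (auto simp: top_unique)
  then obtain y where y: "j1 = ennreal y" "0 \<le> y" by (cases j1) auto
  have yx: "y + a \<le> x"
    using le x y a by (simp flip: ennreal_plus)
  then have x0: "0 < x" using y a by simp
  show ?thesis
  proof (cases "y = 0")
    case True
    then show ?thesis using y r by (simp add: epowr_0_left)
  next
    case False
    then have y0: "0 < y" using y by simp
    have yt: "x powr (- r) \<le> y powr (- r)"
      using yx y0 a r by (intro powr_mono2') auto
    have "(1 + ?b) * x powr (- r) \<le> y powr (- r) + ?b * s"
    proof (cases "x powr (- r) \<le> s")
      case True
      then have "?b * x powr (- r) \<le> ?b * s" using b by (intro mult_left_mono) auto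
      then show ?thesis using yt by (simp add: algebra_simps)
    next
      case False
      then have "s powr (1 / r) \<le> (x powr (- r)) powr (1 / r)"
        using s r by (intro powr_mono2) auto
      also have "\<dots> = x powr ((- r) * (1 / r))" by (simp only: powr_powr)
      also have "\<dots> = 1 / x" using r x0 by (simp add: powr_neg_one)
      finally have "?b \<le> a / x" using a mult_left_mono[of "s powr (1 / r)" "1 / x" a] by simp
      then have "?b * x \<le> a" using x0 by (simp add: field_simps)
      then have yb: "y \<le> x * (1 - ?b)" using yx by (simp add: algebra_simps)
      then have b1: "?b < 1" using y0 x0 by (smt (verit) mult_nonneg_nonpos)
      \<comment> \<open>The exponent is first weakened to \<open>- 1\<close>, where the bound is
        \<open>(1 + b) * (1 - b) \<le> 1\<close>, and then strengthened to \<open>- r\<close>, which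
        is allowed because \<open>1 - b\<close> lies between 0 and 1 and \<open>r\<close> is at
        least 1.\<close>
      have "1 + ?b \<le> (1 - ?b) powr (- 1)"
      proof -
        have "(1 + ?b) * (1 - ?b) = 1 - ?b\<^sup>2" by (simp add: algebra_simps power2_eq_square)
        then have "(1 + ?b) * (1 - ?b) \<le> 1" by simp
        then show ?thesis using b1 by (simp add: powr_neg_one pos_le_divide_eq)
      qed
      also have "\<dots> \<le> (1 - ?b) powr (- r)"
        using b b1 r by (intro powr_mono') auto
      finally have "(1 + ?b) * x powr (- r) \<le> (1 - ?b) powr (- r) * x powr (- r)"
        by (rule mult_right_mono) simp
      also have "\<dots> = (x * (1 - ?b)) powr (- r)"
        using x0 b1 by (simp add: powr_mult mult.commute)
      also have "\<dots> \<le> y powr (- r)"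
        using yb y0 r by (intro powr_mono2') auto
      finally show ?thesis using b s by (smt (verit) mult_nonneg_nonneg)
    qed
    then show ?thesis
      using x x0 y y0 b s by (simp add: epowr_ennreal_pos ennreal_mult[symmetric] ennreal_plus[symmetric] del: ennreal_plus)
  qed
qed

text \<open>For an extremal the integral over the sphere is known exactly, for the competitor
  \<open>f1\<close> the Sobolev inequality bounds it from above. Integrating the gain over all
  directions forces the competitor to lose a definite share of the norm, and \<kappa> depends on
  neither function.\<close>

lemma M_aff_gain:
  fixes S p :: real
  assumes p: "0 < p" "p < real CARD('n)" and S: "S_aff TYPE('n) p = ennreal S" "0 < S"
  obtains \<kappa> where "0 < \<kappa>"
    "\<And>(f :: real^'n \<Rightarrow> real) g f1 g1 a F F1.
      f \<in> M_aff p \<Longrightarrow> is_weak_gradient f g \<Longrightarrow> f1 \<in> W_hom p \<Longrightarrow> is_weak_gradient f1 g1 \<Longrightarrow> 0 < a \<Longrightarrow>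
      (\<And>\<xi>. norm \<xi> = 1 \<Longrightarrow> Lp_integral p (\<lambda>x. \<xi> \<bullet> g1 x) + ennreal a \<le> Lp_integral p (\<lambda>x. \<xi> \<bullet> g x)) \<Longrightarrow>
      Lp_norm (sobolev_exp (real CARD('n)) p) f = ennreal F \<Longrightarrow> 0 < F \<Longrightarrow>
      Lp_norm (sobolev_exp (real CARD('n)) p) f1 = ennreal F1 \<Longrightarrow> 0 < F1 \<Longrightarrow>
      (1 + \<kappa> * a * F powr (- p)) * F1 powr real CARD('n) \<le> F powr real CARD('n)"
proof -
  let ?n = "real CARD('n)"
  obtain \<sigma> where \<sigma>: "0 < \<sigma>" "\<And>c. (\<integral>\<^sup>+\<xi>. c \<partial>(sphere_measure :: (real^'n) measure)) = c * ennreal \<sigma>"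
    using emeasure_sphere_measure_space by blast
  define \<kappa> where "\<kappa> = (2 * \<sigma>) powr (- p / ?n) * S powr (- p) / 2"
  show ?thesis
  proof (rule that[of \<kappa>])
    show "0 < \<kappa>" using \<sigma> S by (simp add: \<kappa>_def)
    fix f f1 :: "real^'n \<Rightarrow> real" and g g1 and a F F1 :: real
    assume f: "f \<in> M_aff p" "is_weak_gradient f g" and f1: "f1 \<in> W_hom p" "is_weak_gradient f1 g1"
      and a: "0 < a"
      and le: "\<And>\<xi>. norm \<xi> = 1 \<Longrightarrow> Lp_integral p (\<lambda>x. \<xi> \<bullet> g1 x) + ennreal a \<le> Lp_integral p (\<lambda>x. \<xi> \<bullet> g x)"
      and F: "Lp_norm (sobolev_exp ?n p) f = ennreal F" "0 < F"
      and F1: "Lp_norm (sobolev_exp ?n p) f1 = ennreal F1" "0 < F1"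
    let ?I = "sphere_integral p g" and ?I1 = "sphere_integral p g1"
    define i where "i = (S * F) powr (- ?n)"
    define i1 where "i1 = (S * F1) powr (- ?n)"
    have i: "0 < i" using S F by (simp add: i_def)
    have "affine_energy p f = ennreal (S * F)"
      using f(1) S F by (simp add: M_aff_def ennreal_mult)
    then have "?I epowr (- 1 / ?n) = ennreal (S * F)" by (simp add: affine_energy_eq[OF p(1) f(2)])
    then have "(?I epowr (- 1 / ?n)) epowr (- ?n) = ennreal (S * F) epowr (- ?n)" by simp
    then have I: "?I = ennreal i"
      using S F by (simp add: epowr_epowr epowr_ennreal_pos i_def)
    have "ennreal (S * F1) \<le> affine_energy p f1"
      using S_aff_mult_Lp_norm_le[OF f1(1)] S F1 by (simp add: ennreal_mult)
    then have "(?I1 epowr (- 1 / ?n)) epowr (- ?n) \<le> ennreal (S * F1) epowr (- ?n)"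
      by (intro epowr_antimono) (simp_all add: affine_energy_eq[OF p(1) f1(2)])
    then have I1: "?I1 \<le> ennreal i1"
      using S F1 by (simp add: epowr_epowr epowr_ennreal_pos i1_def)
    \<comment> \<open>Half of the mean of the integrand over the sphere: the error term
      \<open>b * s * \<sigma>\<close> is then exactly half of the gain \<open>b * i\<close>, and a
      net gain of \<open>b / 2 * i\<close> remains. The definition of \<kappa> rewrites
      \<open>b / 2\<close> through the norm of the extremal.\<close>
    define s where "s = i / (2 * \<sigma>)"
    have s: "0 < s" using i \<sigma> by (simp add: s_def)
    define b where "b = a * s powr (p / ?n)"
    have b: "0 < b" using a s by (simp add: b_def)
    have meas: "(\<lambda>\<xi>. Lp_integral p (\<lambda>x. \<xi> \<bullet> g x) epowr (- ?n / p)) \<in> borel_measurable sphere_measure"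
      "(\<lambda>\<xi>. Lp_integral p (\<lambda>x. \<xi> \<bullet> g1 x) epowr (- ?n / p)) \<in> borel_measurable sphere_measure"
      using L1_loc_measurable[OF is_weak_gradient_L1_loc(2)[OF f(2)]] L1_loc_measurable[OF is_weak_gradient_L1_loc(2)[OF f1(2)]]
      unfolding sphere_measure_def
      by (auto intro!: measurable_epowr measurable_restrict_space1 borel_measurable_Lp_integral_inner
          simp: measurable_cong_sets[OF sets_scale_measure refl])
    have "ennreal ((1 + b) * i) = (\<integral>\<^sup>+\<xi>. ennreal (1 + b) * Lp_integral p (\<lambda>x. \<xi> \<bullet> g x) epowr (- ?n / p) \<partial>sphere_measure)"
      using b i I by (subst nn_integral_cmult[OF meas(1)], fold sphere_integral_def) (simp add: ennreal_mult)
    also have "\<dots> \<le> (\<integral>\<^sup>+\<xi>. Lp_integral p (\<lambda>x. \<xi> \<bullet> g1 x) epowr (- ?n / p) + ennreal (b * s) \<partial>sphere_measure)"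
    proof (rule nn_integral_sphere_mono)
      fix \<xi> :: "real^'n" assume "norm \<xi> = 1"
      from powr_neg_gain[OF _ a s le[OF this], of "?n / p"] p
      show "ennreal (1 + b) * Lp_integral p (\<lambda>x. \<xi> \<bullet> g x) epowr (- ?n / p)
        \<le> Lp_integral p (\<lambda>x. \<xi> \<bullet> g1 x) epowr (- ?n / p) + ennreal (b * s)"
        by (simp add: b_def)
    qed
    also have "\<dots> = ?I1 + ennreal (b * s) * ennreal \<sigma>"
      unfolding sphere_integral_def \<sigma>(2)[symmetric] by (rule nn_integral_add[OF meas(2)]) simp
    also have "\<dots> \<le> ennreal i1 + ennreal (b * s * \<sigma>)"
      using I1 b s \<sigma> by (intro add_mono) (simp_all add: ennreal_mult)
    finally have "ennreal ((1 + b) * i) \<le> ennreal i1 + ennreal (b * s * \<sigma>)" .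
    then have "(1 + b) * i \<le> i1 + b * s * \<sigma>"
    proof -
      have "0 \<le> i1" "0 \<le> b * s * \<sigma>" using b s \<sigma>(1) by (auto simp: i1_def)
      then show ?thesis
        using \<open>ennreal ((1 + b) * i) \<le> ennreal i1 + ennreal (b * s * \<sigma>)\<close>
        by (metis add_nonneg_nonneg ennreal_le_iff ennreal_plus)
    qed
    moreover have "b * s * \<sigma> = b / 2 * i" using \<sigma> by (simp add: s_def)
    ultimately have "(1 + b) * i \<le> i1 + b / 2 * i" by linarith
    then have main: "(1 + b / 2) * i \<le> i1" by (simp add: algebra_simps)
    have "b / 2 = \<kappa> * a * F powr (- p)"
    proof -
      have "s powr (p / ?n) = i powr (p / ?n) * (2 * \<sigma>) powr (- p / ?n)"
      proof -
        have "(2 * \<sigma>) powr (- p / ?n) = inverse ((2 * \<sigma>) powr (p / ?n))"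
          using powr_minus[of "2 * \<sigma>" "p / ?n"] by simp
        moreover have "s powr (p / ?n) = i powr (p / ?n) / (2 * \<sigma>) powr (p / ?n)"
          unfolding s_def by (rule powr_divide)
        ultimately show ?thesis by (simp only: divide_inverse)
      qed
      also have "i powr (p / ?n) = S powr (- p) * F powr (- p)"
        using S F by (simp add: i_def powr_powr powr_mult)
      finally show ?thesis by (simp add: b_def \<kappa>_def)
    qed
    moreover have "(1 + b / 2) * F1 powr ?n \<le> F powr ?n"
    proof -
      have e: "i = 1 / (S powr ?n * F powr ?n)" "i1 = 1 / (S powr ?n * F1 powr ?n)"
        by (simp_all add: i_def i1_def powr_minus_divide powr_mult)
      have P: "0 < S powr ?n" "0 < F powr ?n" "0 < F1 powr ?n" using S F F1 by auto
      show ?thesis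
      proof -
        obtain X Y A where XYA: "F powr ?n = X" "F1 powr ?n = Y" "S powr ?n = A" by blast
        then have "0 < X" "0 < Y" "0 < A" using P by auto
        moreover have "(1 + b / 2) * (1 / (A * X)) * (A * X * Y) \<le> 1 / (A * Y) * (A * X * Y)"
          using main P unfolding e XYA by (intro mult_right_mono) auto
        ultimately show ?thesis unfolding XYA by simp
      qed
    qed
    ultimately show "(1 + \<kappa> * a * F powr (- p)) * F1 powr ?n \<le> F powr ?n" by simp
  qed
qed

section \<open>Convexity and the energy of a truncation\<close>

lemma powr_convex_nonneg:
  fixes x y t p :: real
  assumes p: "1 \<le> p" and t: "0 \<le> t" "t \<le> 1" and xy: "0 \<le> x" "0 \<le> y"
  shows "((1 - t) * x + t * y) powr p \<le> (1 - t) * x powr p + t * y powr p"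
proof (cases "x = 0 \<or> y = 0")
  case True
  have le: "s powr p \<le> s" if "0 \<le> s" "s \<le> 1" for s
    using powr_mono'[of 1 p s] that p by (cases "s = 0") auto
  show ?thesis
  proof (cases "x = 0")
    case True
    then show ?thesis using p t xy le[of t] by (simp add: powr_mult mult_right_mono)
  next
    case False
    then have "y = 0" using \<open>x = 0 \<or> y = 0\<close> by simp
    then show ?thesis using p t xy le[of "1 - t"] by (simp add: powr_mult mult_right_mono)
  qed
next
  case False
  then show ?thesis
    using convex_onD[OF powr_convex[OF p] t, of x y] xy by simp
qed

lemma powr_convex_abs:
  fixes a c t p :: real
  assumes p: "1 \<le> p" and t: "0 \<le> t" "t \<le> 1"
  shows "\<bar>(1 - t) * a + t * c\<bar> powr p \<le> (1 - t) * \<bar>a\<bar> powr p + t * \<bar>c\<bar> powr p"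
proof -
  have "\<bar>(1 - t) * a + t * c\<bar> \<le> (1 - t) * \<bar>a\<bar> + t * \<bar>c\<bar>"
    using t abs_triangle_ineq[of "(1 - t) * a" "t * c"] by (simp add: abs_mult)
  then have "\<bar>(1 - t) * a + t * c\<bar> powr p \<le> ((1 - t) * \<bar>a\<bar> + t * \<bar>c\<bar>) powr p"
    using p by (intro powr_mono2) auto
  also have "\<dots> \<le> (1 - t) * \<bar>a\<bar> powr p + t * \<bar>c\<bar> powr p"
    by (rule powr_convex_nonneg) (use p t in auto)
  finally show ?thesis .
qed

text \<open>A Caccioppoli inequality that does not involve the Euler-Lagrange equation: with \<open>\<eta> = Z\<^sup>k\<close>,
  the vector \<open>(1 - \<eta>) a - u \<nabla>\<eta>\<close> is a convex combination of \<open>a\<close> and \<open>- k u \<nabla>Z / Z\<close>.\<close>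

lemma cutoff_pointwise:
  fixes a u z z' l p :: real
  assumes p: "2 \<le> p" and k: "p \<le> real k" and z: "0 \<le> z" "z \<le> 1" and z': "\<bar>z'\<bar> \<le> l"
  shows "\<bar>(1 - z ^ k) * a - u * (real k * z ^ (k - 1) * z')\<bar> powr p + z ^ k * \<bar>a\<bar> powr p
    \<le> \<bar>a\<bar> powr p + (real k * l) powr p * \<bar>u\<bar> powr p * of_bool (z \<noteq> 0)"
proof (cases "z = 0")
  case True
  have "2 \<le> k" using p k by linarith
  then show ?thesis using True by (simp add: power_0_left)
next
  case False
  then have z0: "0 < z" using z by simp
  have k0: "0 < k" using p k by simp
  define c where "c = - (real k * u * z' / z)"
  have "z ^ k = z ^ (k - 1) * z" using power_minus_mult[OF k0, of z] by simp
  then have "(1 - z ^ k) * a - u * (real k * z ^ (k - 1) * z') = (1 - z ^ k) * a + z ^ k * c"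
    using z0 by (simp add: c_def)
  also have "\<bar>\<dots>\<bar> powr p \<le> (1 - z ^ k) * \<bar>a\<bar> powr p + z ^ k * \<bar>c\<bar> powr p"
    using p z by (intro powr_convex_abs) (auto simp: power_le_one)
  \<comment> \<open>The factor \<open>z ^ k\<close> against the power \<open>z powr p\<close> in the
    denominator leaves \<open>z powr (k - p)\<close>, which is at most 1. This is the reason for
    cutting off with a power of \<open>Z\<close> that is at least \<open>p\<close>.\<close>
  also have "z ^ k * \<bar>c\<bar> powr p \<le> (real k * l) powr p * \<bar>u\<bar> powr p"
  proof -
    have "z ^ k * \<bar>c\<bar> powr p = z powr (real k - p) * (real k * \<bar>z'\<bar> * \<bar>u\<bar>) powr p"
      using z0 by (simp add: c_def abs_mult powr_diff powr_realpow powr_divide ac_simps)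
    also have "\<dots> \<le> 1 * (real k * l * \<bar>u\<bar>) powr p"
      using z z' p k by (intro mult_mono powr_mono2 powr_le1) (auto intro: mult_right_mono mult_left_mono)
    also have "\<dots> = (real k * l) powr p * \<bar>u\<bar> powr p"
      using z' by (simp add: powr_mult)
    finally show ?thesis .
  qed
  finally show ?thesis using False by (simp add: algebra_simps)
qed

lemma grad_power:
  assumes "f differentiable (at x)"
  shows "grad (\<lambda>x. 1 - f x ^ k) x = - ((real k * f x ^ (k - 1)) *\<^sub>R grad f x)"
proof (rule grad_eqI)
  show "((\<lambda>x. 1 - f x ^ k) has_derivative (\<lambda>v. v \<bullet> - ((real k * f x ^ (k - 1)) *\<^sub>R grad f x))) (at x)"
    using has_derivative_diff[OF has_derivative_const has_derivative_power[OF differentiable_has_derivative_grad[OF assms], of k]]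
    by (simp add: ac_simps)
qed

lemma ennreal_add_le_add_mult_indicator:
  fixes a b c d e :: real
  assumes "a + b \<le> c + d * (e * indicator D x)" "0 \<le> a" "0 \<le> b" "0 \<le> c" "0 \<le> d" "0 \<le> e"
  shows "ennreal a + ennreal b \<le> ennreal c + ennreal d * (ennreal e * indicator D x)"
proof -
  have "ennreal a + ennreal b = ennreal (a + b)" using assms by simp
  also have "\<dots> \<le> ennreal (c + d * (e * indicator D x))" using assms(1) by (rule ennreal_leI)
  also have "\<dots> = ennreal c + ennreal (d * (e * indicator D x))" using assms by simp
  also have "ennreal (d * (e * indicator D x)) = ennreal d * (ennreal e * indicator D x)"
    using assms by (cases "x \<in> D") (simp_all add: ennreal_mult)
  finally show ?thesis .
qed

text \<open>The pointwise inequality with \<open>a = \<xi> \<bullet> g x\<close> and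
  \<open>u = f x\<close>, integrated for one fixed direction. The energy weighted by
  \<open>Z x ^ k\<close> is saved; the price is the mass of \<open>f\<close> on \<open>D\<close>
  times a power of the slope \<open>l\<close>, so slowly varying cutoffs are cheap.\<close>

lemma cutoff_energy:
  fixes f Z :: "real^'n \<Rightarrow> real"
  assumes p: "2 \<le> p" and k: "p \<le> real k" and f: "is_weak_gradient f g"
    and Z: "smooth Z" "\<And>x. 0 \<le> Z x" "\<And>x. Z x \<le> 1" "\<And>x. norm (grad Z x) \<le> l" "\<And>x. Z x \<noteq> 0 \<Longrightarrow> x \<in> D"
    and D: "D \<in> sets lebesgue"
  defines "f1 \<equiv> \<lambda>x. (1 - Z x ^ k) * f x"
    and "g1 \<equiv> \<lambda>x. (1 - Z x ^ k) *\<^sub>R g x + f x *\<^sub>R grad (\<lambda>x. 1 - Z x ^ k) x"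
  shows "is_weak_gradient f1 g1"
    and "norm \<xi> = 1 \<Longrightarrow> Lp_integral p (\<lambda>x. \<xi> \<bullet> g1 x) + (\<integral>\<^sup>+x. ennreal (Z x ^ k * \<bar>\<xi> \<bullet> g x\<bar> powr p) \<partial>lebesgue)
      \<le> Lp_integral p (\<lambda>x. \<xi> \<bullet> g x) + ennreal ((real k * l) powr p) * (\<integral>\<^sup>+x. ennreal (\<bar>f x\<bar> powr p) * indicator D x \<partial>lebesgue)"
proof -
  have sm: "smooth (\<lambda>x. 1 - Z x ^ k)"
    unfolding smooth_def
  proof
    fix l
    have "Ck l (\<lambda>x. 1 + (- 1) * Z x ^ k)"
      using Z(1) by (intro Ck_add Ck_cmult Ck_const Ck_power) (simp add: smooth_def)
    then show "Ck l (\<lambda>x. 1 - Z x ^ k)" by simp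
  qed
  show w: "is_weak_gradient f1 g1"
    unfolding f1_def g1_def by (rule is_weak_gradient_mult_smooth[OF f sm])
  note L = is_weak_gradient_L1_loc[OF f]
  have fm: "f \<in> borel_measurable lebesgue" and gm: "(\<lambda>x. \<xi> \<bullet> g x) \<in> borel_measurable lebesgue"
    and g1m: "(\<lambda>x. \<xi> \<bullet> g1 x) \<in> borel_measurable lebesgue"
    using L1_loc_measurable[OF L(1)] L1_loc_measurable[OF L(2)] L1_loc_measurable[OF is_weak_gradient_L1_loc(2)[OF w]] by simp_all
  have Zm: "Z \<in> borel_measurable lebesgue"
    using Ck_continuous_on[OF smooth_Ck[OF Z(1), of 0]] by (auto intro!: measurable_completion borel_measurable_continuous_onI)
  have mD: "(\<lambda>x. ennreal (\<bar>f x\<bar> powr p) * indicator D x) \<in> borel_measurable lebesgue"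
    by (intro borel_measurable_times_ennreal borel_measurable_indicator D) (use fm in measurable)
  assume \<xi>: "norm \<xi> = 1"
  have "Lp_integral p (\<lambda>x. \<xi> \<bullet> g1 x) + (\<integral>\<^sup>+x. ennreal (Z x ^ k * \<bar>\<xi> \<bullet> g x\<bar> powr p) \<partial>lebesgue)
    = (\<integral>\<^sup>+x. ennreal (\<bar>\<xi> \<bullet> g1 x\<bar> powr p) + ennreal (Z x ^ k * \<bar>\<xi> \<bullet> g x\<bar> powr p) \<partial>lebesgue)"
    unfolding Lp_integral_def using g1m gm Zm by (subst nn_integral_add) auto
  also have "\<dots> \<le> (\<integral>\<^sup>+x. ennreal (\<bar>\<xi> \<bullet> g x\<bar> powr p) + ennreal ((real k * l) powr p) * (ennreal (\<bar>f x\<bar> powr p) * indicator D x) \<partial>lebesgue)"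
  proof (rule nn_integral_mono)
    fix x
    let ?a = "\<xi> \<bullet> g x" and ?z' = "\<xi> \<bullet> grad Z x"
    have g1: "\<xi> \<bullet> g1 x = (1 - Z x ^ k) * ?a - f x * (real k * Z x ^ (k - 1) * ?z')"
      by (simp add: g1_def grad_power[OF smooth_differentiable[OF Z(1)]] inner_add_right algebra_simps)
    have "\<bar>?z'\<bar> \<le> l"
      using Cauchy_Schwarz_ineq2[of \<xi> "grad Z x"] Z(4)[of x] \<xi> by simp
    from cutoff_pointwise[OF p k Z(2,3) this, where a="?a" and u="f x"]
    have "\<bar>\<xi> \<bullet> g1 x\<bar> powr p + Z x ^ k * \<bar>?a\<bar> powr p
        \<le> \<bar>?a\<bar> powr p + (real k * l) powr p * \<bar>f x\<bar> powr p * of_bool (Z x \<noteq> 0)"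
      unfolding g1 .
    also have "\<dots> \<le> \<bar>?a\<bar> powr p + (real k * l) powr p * (\<bar>f x\<bar> powr p * indicator D x)"
      using Z(5)[of x] by (auto simp: indicator_def)
    finally show "ennreal (\<bar>\<xi> \<bullet> g1 x\<bar> powr p) + ennreal (Z x ^ k * \<bar>\<xi> \<bullet> g x\<bar> powr p)
       \<le> ennreal (\<bar>\<xi> \<bullet> g x\<bar> powr p) + ennreal ((real k * l) powr p) * (ennreal (\<bar>f x\<bar> powr p) * indicator D x)"
      using Z(2)[of x] by (intro ennreal_add_le_add_mult_indicator) auto
  qed
  also have "\<dots> = Lp_integral p (\<lambda>x. \<xi> \<bullet> g x) + (\<integral>\<^sup>+x. ennreal ((real k * l) powr p) * (ennreal (\<bar>f x\<bar> powr p) * indicator D x) \<partial>lebesgue)"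
  proof -
    have "(\<lambda>x. ennreal (norm (\<xi> \<bullet> g x) powr p)) \<in> borel_measurable lebesgue" using gm by measurable
    from nn_integral_add[OF this borel_measurable_times_ennreal[OF borel_measurable_const mD]] show ?thesis
      by (simp add: Lp_integral_def)
  qed
  also have "(\<integral>\<^sup>+x. ennreal ((real k * l) powr p) * (ennreal (\<bar>f x\<bar> powr p) * indicator D x) \<partial>lebesgue)
     = ennreal ((real k * l) powr p) * (\<integral>\<^sup>+x. ennreal (\<bar>f x\<bar> powr p) * indicator D x \<partial>lebesgue)"
    by (rule nn_integral_cmult[OF mD])
  finally show "Lp_integral p (\<lambda>x. \<xi> \<bullet> g1 x) + (\<integral>\<^sup>+x. ennreal (Z x ^ k * \<bar>\<xi> \<bullet> g x\<bar> powr p) \<partial>lebesgue)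
      \<le> Lp_integral p (\<lambda>x. \<xi> \<bullet> g x) + ennreal ((real k * l) powr p) * (\<integral>\<^sup>+x. ennreal (\<bar>f x\<bar> powr p) * indicator D x \<partial>lebesgue)" .
qed

section \<open>The energy forced by the bump in every direction\<close>

lemma grad_translation:
  assumes "smooth f"
  shows "grad (\<lambda>x. f (x - e)) x = grad f (x - e)"
  using grad_affine[of f "mat 1" x "- e", OF smooth_differentiable[OF assms]]
  by (simp add: transpose_mat)

lemma Cc_infinity_translation_minus:
  "\<psi> \<in> Cc_infinity UNIV \<Longrightarrow> (\<lambda>x. \<psi> (x - t)) \<in> Cc_infinity UNIV"
  using Cc_infinity_translation[of \<psi> "- t"] by simp

lemma Cc_infinity_bounded:
  assumes "\<psi> \<in> Cc_infinity UNIV"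
  obtains K where "0 < K" "\<And>x. \<bar>\<psi> x\<bar> \<le> K"
proof -
  let ?S = "closure {x. \<psi> x \<noteq> 0}"
  have "compact ?S" using assms by (simp add: Cc_infinity_UNIV_iff compact_closure)
  then have "bounded (\<psi> ` ?S)"
    using Cc_infinity_continuous[OF assms]
    by (intro compact_imp_bounded compact_continuous_image) (auto intro: continuous_on_subset)
  then obtain K where K: "0 < K" "\<And>x. x \<in> ?S \<Longrightarrow> \<bar>\<psi> x\<bar> \<le> K"
    unfolding bounded_pos by auto
  have "\<bar>\<psi> x\<bar> \<le> K" for x
  proof (cases "x \<in> ?S")
    case False
    then have "\<psi> x = 0" using subsetD[OF closure_subset[of "{x. \<psi> x \<noteq> 0}"], of x] by auto
    then show ?thesis using K by simp
  qed (rule K)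
  with K(1) that show ?thesis by blast
qed

lemma Cc_infinity_Lp_integral_finite:
  assumes p: "0 < p" and \<psi>: "\<psi> \<in> Cc_infinity UNIV"
  shows "Lp_integral p \<psi> < \<infinity>"
proof -
  obtain K where K: "0 < K" "\<And>x. \<bar>\<psi> x\<bar> \<le> K" using Cc_infinity_bounded[OF \<psi>] by blast
  obtain r where r: "\<And>x. \<psi> x \<noteq> 0 \<Longrightarrow> norm x \<le> r" using \<psi> unfolding Cc_infinity_UNIV_iff bounded_iff by auto
  have "Lp_integral p \<psi> \<le> (\<integral>\<^sup>+x. ennreal (K powr p) * indicator (cball (0::real^'a) r) x \<partial>lebesgue)"
    unfolding Lp_integral_def
  proof (rule nn_integral_mono)
    fix x :: "real^'a"
    show "ennreal (norm (\<psi> x) powr p) \<le> ennreal (K powr p) * indicator (cball 0 r) x"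
      using K(2)[of x] r[of x] p by (cases "\<psi> x = 0") (auto intro!: ennreal_leI powr_mono2)
  qed
  also have "\<dots> = ennreal (K powr p) * emeasure lebesgue (cball (0::real^'a) r)"
    by (rule nn_integral_cmult_indicator) simp
  also have "\<dots> < \<infinity>"
    using emeasure_lborel_cball_finite[of "0::real^'a" r] by (simp add: ennreal_mult_less_top)
  finally show ?thesis .
qed

text \<open>If \<phi> did not vary along \<xi>, its open set of nonzeros would be invariant along
  \<xi> and of finite measure, hence null and therefore empty. Compactness of the sphere makes the
  bound uniform. The exponent is 2, because the duality argument below pairs a directional
  derivative with itself.\<close>

lemma Cc_infinity_directional_energy_pos:
  fixes \<phi> :: "real^'n \<Rightarrow> real"
  assumes \<phi>: "\<phi> \<in> Cc_infinity UNIV" "\<phi> \<noteq> (\<lambda>_. 0)"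
  obtains Q where "0 < Q" "\<And>\<xi>. norm \<xi> = 1 \<Longrightarrow> Q \<le> (\<integral>x. (\<xi> \<bullet> grad \<phi> x) * (\<xi> \<bullet> grad \<phi> x) \<partial>lebesgue)"
proof -
  have sm: "smooth \<phi>" using \<phi> by (simp add: Cc_infinity_UNIV_iff)
  have w: "is_weak_gradient \<phi> (grad \<phi>)" by (rule is_weak_gradient_grad[OF smooth_Ck[OF sm]])
  have m: "grad \<phi> \<in> borel_measurable lebesgue" by (rule L1_loc_measurable[OF is_weak_gradient_L1_loc(2)[OF w]])
  have m\<phi>: "\<phi> \<in> borel_measurable lebesgue" by (rule L1_loc_measurable[OF is_weak_gradient_L1_loc(1)[OF w]])
  obtain r where r: "\<And>x. \<phi> x \<noteq> 0 \<Longrightarrow> norm x \<le> r" using \<phi> unfolding Cc_infinity_UNIV_iff bounded_iff by auto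
  have "Lp_integral 2 (\<lambda>x. \<xi> \<bullet> grad \<phi> x) \<noteq> 0" if \<xi>: "norm \<xi> = 1" for \<xi>
  proof
    assume 0: "Lp_integral 2 (\<lambda>x. \<xi> \<bullet> grad \<phi> x) = 0"
    have mm: "(\<lambda>x. \<xi> \<bullet> grad \<phi> x) \<in> borel_measurable lebesgue" using m by simp
    have "AE x in lebesgue. ennreal (norm (\<xi> \<bullet> grad \<phi> x) powr 2) = 0"
      using 0 mm unfolding Lp_integral_def by (subst (asm) nn_integral_0_iff_AE) auto
    then have AE0: "AE x in lebesgue. \<xi> \<bullet> grad \<phi> x = 0" by eventually_elim (simp add: ennreal_eq_0_iff)
    let ?A = "{x. \<phi> x \<noteq> 0}"
    have A: "?A \<in> sets lebesgue"
      using measurable_sets[OF m\<phi>, of "- {0}"] by (simp add: vimage_def Compl_eq)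
    have "emeasure lebesgue ?A = 0"
    proof (rule translation_invariant_finite_imp_null[OF A])
      have "emeasure lebesgue ?A \<le> emeasure lebesgue (cball 0 r :: (real^'n) set)"
        by (rule emeasure_mono) (use r in auto)
      then show "emeasure lebesgue ?A < \<infinity>"
        using emeasure_lborel_cball_finite[of "0::real^'n" r] by (auto simp: le_less_trans)
      show "\<xi> \<noteq> 0" using \<xi> by auto
      show "AE x in lebesgue. indicator ?A (x + t *\<^sub>R \<xi>) = (indicator ?A x :: ennreal)" for t
        using translation_invariant_AE[OF w AE0, of t] by eventually_elim (simp add: indicator_def)
    qed
    moreover have "open ?A"
      by (intro open_Collect_neq Cc_infinity_continuous[OF \<phi>(1)] continuous_on_const)
    ultimately have "?A = {}"
      using open_not_negligible A negligible_iff_emeasure0 by blast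
    then show False using \<phi>(2) by auto
  qed
  then obtain Q where Q: "0 < Q" "\<And>\<xi>. norm \<xi> = 1 \<Longrightarrow> ennreal Q \<le> Lp_integral 2 (\<lambda>x. \<xi> \<bullet> grad \<phi> x)"
    using Lp_integral_inner_inf_pos[of 2 "grad \<phi>"] m by (metis zero_less_numeral)
  show ?thesis
  proof (rule that[OF Q(1)])
    fix \<xi> :: "real^'n" assume \<xi>: "norm \<xi> = 1"
    have \<psi>: "(\<lambda>x. \<xi> \<bullet> grad \<phi> x) \<in> Cc_infinity UNIV" by (rule Cc_infinity_grad[OF \<phi>(1)])
    have "integrable lebesgue (\<lambda>x. (\<xi> \<bullet> grad \<phi> x) * (\<xi> \<bullet> grad \<phi> x))"
      by (rule Cc_infinity_integrable_mult[OF L1_loc_continuous[OF Cc_infinity_continuous[OF \<psi>]] \<psi>])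
    then have "ennreal (\<integral>x. (\<xi> \<bullet> grad \<phi> x) * (\<xi> \<bullet> grad \<phi> x) \<partial>lebesgue) = (\<integral>\<^sup>+x. ennreal ((\<xi> \<bullet> grad \<phi> x) * (\<xi> \<bullet> grad \<phi> x)) \<partial>lebesgue)"
      by (intro nn_integral_eq_integral[symmetric]) auto
    also have "\<dots> = Lp_integral 2 (\<lambda>x. \<xi> \<bullet> grad \<phi> x)"
      unfolding Lp_integral_def by (intro nn_integral_cong) (simp add: powr_numeral power2_eq_square)
    finally have "ennreal Q \<le> ennreal (\<integral>x. (\<xi> \<bullet> grad \<phi> x) * (\<xi> \<bullet> grad \<phi> x) \<partial>lebesgue)"
      using Q(2)[OF \<xi>] by simp
    then show "Q \<le> (\<integral>x. (\<xi> \<bullet> grad \<phi> x) * (\<xi> \<bullet> grad \<phi> x) \<partial>lebesgue)"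
      by (subst (asm) ennreal_le_iff) auto
  qed
qed

lemma grad_grad_bounded:
  fixes \<phi> :: "real^'n \<Rightarrow> real"
  assumes \<phi>: "\<phi> \<in> Cc_infinity UNIV"
  obtains K where "0 < K" "\<And>\<xi> x. norm \<xi> = 1 \<Longrightarrow> \<bar>\<xi> \<bullet> grad (\<lambda>x. \<xi> \<bullet> grad \<phi> x) x\<bar> \<le> K"
proof -
  have "\<exists>K>0. \<forall>x. norm (grad (partial_deriv i \<phi>) x) \<le> K" for i
    using Cc_infinity_partial_deriv[OF \<phi>, of i] bounded_grad[of "partial_deriv i \<phi>"]
    unfolding Cc_infinity_UNIV_iff using smooth_Ck by metis
  then obtain K where K: "\<And>i. 0 < K i" "\<And>i x. norm (grad (partial_deriv i \<phi>) x) \<le> K i" by metis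
  show ?thesis
  proof (rule that[of "\<Sum>i\<in>UNIV. K i"])
    show "0 < (\<Sum>i\<in>UNIV. K i)" using K(1) by (intro sum_pos) auto
    fix \<xi> x :: "real^'n" assume \<xi>: "norm \<xi> = 1"
    have sm: "smooth (partial_deriv i \<phi>)" for i
      using \<phi> smooth_partial_deriv by (auto simp: Cc_infinity_UNIV_iff)
    have "grad (\<lambda>x. \<xi> \<bullet> grad \<phi> x) x = (\<Sum>i\<in>UNIV. \<xi> $ i *\<^sub>R grad (partial_deriv i \<phi>) x)"
    proof (rule grad_eqI)
      have "((\<lambda>x. \<Sum>i\<in>UNIV. \<xi> $ i * partial_deriv i \<phi> x) has_derivative
          (\<lambda>v. \<Sum>i\<in>UNIV. \<xi> $ i * (v \<bullet> grad (partial_deriv i \<phi>) x))) (at x)"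
        by (intro has_derivative_sum has_derivative_mult_right differentiable_has_derivative_grad smooth_differentiable sm)
      then show "((\<lambda>x. \<xi> \<bullet> grad \<phi> x) has_derivative (\<lambda>v. v \<bullet> (\<Sum>i\<in>UNIV. \<xi> $ i *\<^sub>R grad (partial_deriv i \<phi>) x))) (at x)"
        by (simp add: inner_vec_def[of \<xi>] inner_sum_right)
    qed
    also have "norm (\<Sum>i\<in>UNIV. \<xi> $ i *\<^sub>R grad (partial_deriv i \<phi>) x) \<le> (\<Sum>i\<in>UNIV. K i)"
    proof (rule sum_norm_le)
      fix i
      have "\<bar>\<xi> $ i\<bar> \<le> 1" using component_le_norm_cart[of \<xi> i] \<xi> by simp
      then have "\<bar>\<xi> $ i\<bar> * norm (grad (partial_deriv i \<phi>) x) \<le> 1 * K i"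
        using K by (intro mult_mono) auto
      then show "norm (\<xi> $ i *\<^sub>R grad (partial_deriv i \<phi>) x) \<le> K i" by simp
    qed
    finally show "\<bar>\<xi> \<bullet> grad (\<lambda>x. \<xi> \<bullet> grad \<phi> x) x\<bar> \<le> (\<Sum>i\<in>UNIV. K i)"
      using Cauchy_Schwarz_ineq2[of \<xi> "grad (\<lambda>x. \<xi> \<bullet> grad \<phi> x) x"] \<xi> by simp
  qed
qed

text \<open>Below the threshold \<tau> the first term suffices, above it the second. With a free
  threshold this plays the part of Hoelder's inequality.\<close>

lemma le_add_powr_mult:
  fixes a \<tau> p :: real
  assumes "0 \<le> a" "0 < \<tau>" "1 \<le> p"
  shows "a \<le> \<tau> + \<tau> powr (1 - p) * a powr p"
proof (cases "a \<le> \<tau>")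
  case True
  then show ?thesis by (simp add: add_increasing2)
next
  case False
  then have "\<tau> powr (1 - p) * \<tau> powr (p - 1) \<le> \<tau> powr (1 - p) * a powr (p - 1)"
    using assms by (intro mult_left_mono powr_mono2) auto
  moreover have "\<tau> powr (1 - p) * \<tau> powr (p - 1) = 1" using assms by (simp add: powr_add[symmetric])
  ultimately have "1 * a \<le> \<tau> powr (1 - p) * a powr (p - 1) * a"
    using assms by (intro mult_right_mono) auto
  moreover have "a powr (p - 1) * a = a powr p"
    using False assms powr_add[of a "p - 1" 1] by simp
  ultimately show ?thesis using assms by (simp add: mult.assoc)
qed

lemma Cc_infinity_mono: "\<phi> \<in> Cc_infinity \<Omega> \<Longrightarrow> \<phi> \<in> Cc_infinity UNIV"
  by (auto simp: Cc_infinity_def)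

lemma Cc_infinity_outside:
  assumes "\<phi> \<in> Cc_infinity \<Omega>" "x \<notin> \<Omega>"
  shows "\<phi> x = 0" "grad \<phi> x = 0"
proof -
  have x: "x \<notin> closure {x. \<phi> x \<noteq> 0}" using assms by (auto simp: Cc_infinity_def)
  then show "\<phi> x = 0" using subsetD[OF closure_subset[of "{x. \<phi> x \<noteq> 0}"], of x] by auto
  show "grad \<phi> x = 0" using partial_deriv_eq_0[OF x] by (simp add: vec_eq_iff)
qed

lemma Cc_infinity_grad_in:
  assumes "\<phi> \<in> Cc_infinity \<Omega>"
  shows "(\<lambda>x. v \<bullet> grad \<phi> x) \<in> Cc_infinity \<Omega>"
proof -
  have "{x. v \<bullet> grad \<phi> x \<noteq> 0} \<subseteq> closure {x. \<phi> x \<noteq> 0}"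
  proof
    fix x assume "x \<in> {x. v \<bullet> grad \<phi> x \<noteq> 0}"
    then have "grad \<phi> x \<noteq> 0" by auto
    then show "x \<in> closure {x. \<phi> x \<noteq> 0}"
      using partial_deriv_eq_0[of x \<phi>] by (auto simp: vec_eq_iff)
  qed
  then have "closure {x. v \<bullet> grad \<phi> x \<noteq> 0} \<subseteq> closure {x. \<phi> x \<noteq> 0}"
    by (simp add: closure_minimal)
  then show ?thesis
    using assms Cc_infinity_grad[OF Cc_infinity_mono[OF assms], of v]
    by (auto simp: Cc_infinity_def)
qed

text \<open>Let \<psi> and \<omega> be the first and second derivatives of the shifted bump in
  direction \<xi>. The pairing of \<open>\<xi> \<bullet> g\<close> with \<psi> is minus that of
  \<open>w\<close> with \<omega>, and closeness of \<open>w\<close> to the scaled bump makes the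
  latter nearly \<open>- \<epsilon>\<close> times the integral of the square of \<psi>. Since \<psi>
  is bounded and lives in the unit ball, the energy of \<open>w\<close> there cannot be
  small.\<close>

lemma bump_energy_lower_bound:
  fixes \<phi> :: "real^'n \<Rightarrow> real"
  assumes \<phi>: "\<phi> \<in> Cc_infinity (ball 0 1)" "\<phi> \<noteq> (\<lambda>_. 0)" and p: "1 \<le> p"
  obtains d \<theta> where "0 < d" "0 < \<theta>"
    "\<And>w g (e::real^'n) \<epsilon> (\<xi>::real^'n). is_weak_gradient w g \<Longrightarrow> 0 < \<epsilon> \<Longrightarrow> norm \<xi> = 1 \<Longrightarrow>
      (\<integral>\<^sup>+x. ennreal \<bar>w x - \<epsilon> * \<phi> (x - e)\<bar> * indicator (ball e 1) x \<partial>lebesgue) \<le> ennreal (\<theta> * \<epsilon>) \<Longrightarrow>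
      ennreal (d * \<epsilon> powr p) \<le> (\<integral>\<^sup>+x. ennreal (\<bar>\<xi> \<bullet> g x\<bar> powr p) * indicator (ball e 1) x \<partial>lebesgue)"
proof -
  note \<phi>U = Cc_infinity_mono[OF \<phi>(1)]
  have sm: "smooth \<phi>" using \<phi>U by (simp add: Cc_infinity_UNIV_iff)
  obtain Q where Q: "0 < Q" "\<And>\<xi>. norm \<xi> = 1 \<Longrightarrow> Q \<le> (\<integral>x. (\<xi> \<bullet> grad \<phi> x) * (\<xi> \<bullet> grad \<phi> x) \<partial>lebesgue)"
    using Cc_infinity_directional_energy_pos[OF \<phi>U \<phi>(2)] by blast
  obtain K1 where K1: "0 < K1" "\<And>x. norm (grad \<phi> x) \<le> K1"
    using bounded_grad[OF smooth_Ck[OF sm]] \<phi>U unfolding Cc_infinity_UNIV_iff by blast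
  obtain K2 where K2: "0 < K2" "\<And>\<xi> x. norm \<xi> = 1 \<Longrightarrow> \<bar>\<xi> \<bullet> grad (\<lambda>x. \<xi> \<bullet> grad \<phi> x) x\<bar> \<le> K2"
    using grad_grad_bounded[OF \<phi>U] by blast
  define \<beta> where "\<beta> = unit_ball_vol (real DIM(real^'n)) * 1 ^ DIM(real^'n)"
  have \<beta>: "0 < \<beta>" "emeasure lebesgue (ball e 1) = ennreal \<beta>" for e :: "real^'n"
    by (simp_all add: \<beta>_def emeasure_ball del: One_nat_def)
  \<comment> \<open>The error in the pairing is at most
    \<open>K2 * (\<theta> * \<epsilon>) = \<epsilon> * Q / 2\<close>, half of the main term
    \<open>\<epsilon> * Q\<close>.\<close>
  define \<theta> where "\<theta> = Q / (2 * K2)"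
  \<comment> \<open>With the threshold \<open>\<tau> = \<epsilon> * t\<close> the part of the
    pairing where the derivative is below \<tau> contributes at most
    \<open>K1 * \<tau> * \<beta> = \<epsilon> * Q / 4\<close>. The remaining quarter must come from
    the energy, and solving for it gives \<open>d\<close>.\<close>
  define t where "t = Q / (4 * K1 * \<beta>)"
  have t: "0 < t" using Q K1 \<beta> by (simp add: t_def)
  define d where "d = Q / (4 * K1) * t powr (p - 1)"
  show ?thesis
  proof (rule that[of d \<theta>])
    show "0 < d" "0 < \<theta>" using Q K1 K2 t by (simp_all add: d_def \<theta>_def)
    fix w :: "real^'n \<Rightarrow> real" and g and e \<xi> :: "real^'n" and \<epsilon> :: real
    assume w: "is_weak_gradient w g" and \<epsilon>: "0 < \<epsilon>" and \<xi>: "norm \<xi> = 1"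
      and small: "(\<integral>\<^sup>+x. ennreal \<bar>w x - \<epsilon> * \<phi> (x - e)\<bar> * indicator (ball e 1) x \<partial>lebesgue) \<le> ennreal (\<theta> * \<epsilon>)"
    define \<psi>0 where "\<psi>0 = (\<lambda>x. \<xi> \<bullet> grad \<phi> x)"
    define \<omega>0 where "\<omega>0 = (\<lambda>x. \<xi> \<bullet> grad \<psi>0 x)"
    have \<psi>0: "\<psi>0 \<in> Cc_infinity (ball 0 1)" unfolding \<psi>0_def by (rule Cc_infinity_grad_in[OF \<phi>(1)])
    have \<omega>0: "\<omega>0 \<in> Cc_infinity (ball 0 1)" unfolding \<omega>0_def by (rule Cc_infinity_grad_in[OF \<psi>0])
    have sm\<psi>0: "smooth \<psi>0" using Cc_infinity_mono[OF \<psi>0] by (simp add: Cc_infinity_UNIV_iff)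
    define \<phi>e where "\<phi>e = (\<lambda>x. \<phi> (x - e))"
    define \<psi> where "\<psi> = (\<lambda>x. \<psi>0 (x - e))"
    define \<omega> where "\<omega> = (\<lambda>x. \<omega>0 (x - e))"
    have C: "\<phi>e \<in> Cc_infinity UNIV" "\<psi> \<in> Cc_infinity UNIV" "\<omega> \<in> Cc_infinity UNIV"
      unfolding \<phi>e_def \<psi>_def \<omega>_def
      by (intro Cc_infinity_translation_minus Cc_infinity_mono[OF \<phi>(1)] Cc_infinity_mono[OF \<psi>0] Cc_infinity_mono[OF \<omega>0])+
    have g\<phi>: "\<xi> \<bullet> grad \<phi>e x = \<psi> x" for x
      by (simp add: \<phi>e_def \<psi>_def \<psi>0_def grad_translation[OF sm])
    have g\<psi>: "\<xi> \<bullet> grad \<psi> x = \<omega> x" for x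
      by (simp add: \<psi>_def \<omega>_def \<omega>0_def grad_translation[OF sm\<psi>0])
    have out: "\<psi> x = 0" "\<omega> x = 0" if "x \<notin> ball e 1" for x
      using that Cc_infinity_outside(1)[OF \<psi>0, of "x - e"] Cc_infinity_outside(1)[OF \<omega>0, of "x - e"]
      by (simp_all add: \<psi>_def \<omega>_def dist_norm norm_minus_commute)
    have b\<psi>: "\<bar>\<psi> x\<bar> \<le> K1" for x
      using Cauchy_Schwarz_ineq2[of \<xi> "grad \<phi> (x - e)"] K1(2)[of "x - e"] \<xi> by (simp add: \<psi>_def \<psi>0_def)
    have b\<omega>: "\<bar>\<omega> x\<bar> \<le> K2" for x
      using K2(2)[OF \<xi>] by (simp add: \<omega>_def \<omega>0_def \<psi>0_def)
    note L = is_weak_gradient_L1_loc[OF w]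
    note mw = L1_loc_measurable[OF L(1)]
    have mg: "(\<lambda>x. \<xi> \<bullet> g x) \<in> borel_measurable lebesgue" using L1_loc_measurable[OF L(2)] by simp
    have Lg: "L1_loc (\<lambda>x. \<xi> \<bullet> g x)"
      by (rule L1_loc_bounded_mult[OF L(2) mg, of 1]) (use Cauchy_Schwarz_ineq2[of \<xi>] \<xi> in auto)
    have L\<phi>: "L1_loc \<phi>e" by (rule L1_loc_continuous[OF Cc_infinity_continuous[OF C(1)]])
    have I1: "(\<integral>x. w x * \<omega> x \<partial>lebesgue) = - (\<integral>x. (\<xi> \<bullet> g x) * \<psi> x \<partial>lebesgue)"
      using is_weak_gradient_inner[OF w C(2), of \<xi>] by (simp add: g\<psi>)
    have I2: "(\<integral>x. \<phi>e x * \<omega> x \<partial>lebesgue) \<le> - Q"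
    proof -
      have "is_weak_gradient \<phi>e (grad \<phi>e)"
        using C(1) by (intro is_weak_gradient_grad) (simp add: Cc_infinity_UNIV_iff smooth_Ck del: Ck.simps)
      from is_weak_gradient_inner[OF this C(2), of \<xi>]
      have "(\<integral>x. \<phi>e x * \<omega> x \<partial>lebesgue) = - (\<integral>x. \<psi> x * \<psi> x \<partial>lebesgue)"
        by (simp add: g\<psi> g\<phi>)
      also have "(\<integral>x. \<psi> x * \<psi> x \<partial>lebesgue) = (\<integral>x. \<psi>0 x * \<psi>0 x \<partial>lebesgue)"
      proof -
        have "\<psi>0 \<in> borel_measurable lebesgue"
          by (rule L1_loc_measurable[OF L1_loc_continuous[OF Cc_infinity_continuous[OF Cc_infinity_mono[OF \<psi>0]]]])
        then show ?thesis using integral_translation[of "\<lambda>x. \<psi>0 x * \<psi>0 x" "- e"] by (simp add: \<psi>_def)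
      qed
      finally show ?thesis using Q(2)[OF \<xi>] by (simp add: \<psi>0_def)
    qed
    have i1: "integrable lebesgue (\<lambda>x. w x * \<omega> x)" by (rule Cc_infinity_integrable_mult[OF L(1) C(3)])
    have i2: "integrable lebesgue (\<lambda>x. \<phi>e x * \<omega> x)" by (rule Cc_infinity_integrable_mult[OF L\<phi> C(3)])
    have i3: "integrable lebesgue (\<lambda>x. (\<xi> \<bullet> g x) * \<psi> x)" by (rule Cc_infinity_integrable_mult[OF Lg C(2)])
    have m\<phi>: "\<phi>e \<in> borel_measurable lebesgue" by (rule L1_loc_measurable[OF L\<phi>])
    have bm: "ball e 1 \<in> sets lebesgue" by simp
    have "ennreal \<bar>\<integral>x. w x * \<omega> x - \<epsilon> * (\<phi>e x * \<omega> x) \<partial>lebesgue\<bar>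
        \<le> (\<integral>\<^sup>+x. ennreal \<bar>w x * \<omega> x - \<epsilon> * (\<phi>e x * \<omega> x)\<bar> \<partial>lebesgue)"
      using integral_norm_bound_ennreal[OF Bochner_Integration.integrable_diff[OF i1 integrable_mult_right[OF i2, of \<epsilon>]]]
      by simp
    also have "\<dots> \<le> (\<integral>\<^sup>+x. ennreal K2 * (ennreal \<bar>w x - \<epsilon> * \<phi> (x - e)\<bar> * indicator (ball e 1) x) \<partial>lebesgue)"
    proof (rule nn_integral_mono)
      fix x
      have "w x * \<omega> x - \<epsilon> * (\<phi>e x * \<omega> x) = \<omega> x * (w x - \<epsilon> * \<phi> (x - e))"
        by (simp add: \<phi>e_def algebra_simps)
      then have "\<bar>w x * \<omega> x - \<epsilon> * (\<phi>e x * \<omega> x)\<bar> \<le> K2 * \<bar>w x - \<epsilon> * \<phi> (x - e)\<bar>"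
        using b\<omega>[of x] by (simp add: abs_mult mult_right_mono)
      then show "ennreal \<bar>w x * \<omega> x - \<epsilon> * (\<phi>e x * \<omega> x)\<bar> \<le> ennreal K2 * (ennreal \<bar>w x - \<epsilon> * \<phi> (x - e)\<bar> * indicator (ball e 1) x)"
        using out(2)[of x] K2(1) by (cases "x \<in> ball e 1") (simp_all add: ennreal_mult[symmetric] ennreal_leI)
    qed
    also have "\<dots> = ennreal K2 * (\<integral>\<^sup>+x. ennreal \<bar>w x - \<epsilon> * \<phi> (x - e)\<bar> * indicator (ball e 1) x \<partial>lebesgue)"
    proof (intro nn_integral_cmult borel_measurable_times_ennreal borel_measurable_indicator bm)
      show "(\<lambda>x. ennreal \<bar>w x - \<epsilon> * \<phi> (x - e)\<bar>) \<in> borel_measurable lebesgue"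
        using mw m\<phi> unfolding \<phi>e_def by measurable
    qed
    also have "\<dots> \<le> ennreal K2 * ennreal (\<theta> * \<epsilon>)" by (intro mult_left_mono small) simp
    also have "\<dots> = ennreal (\<epsilon> * Q / 2)"
      using K2(1) Q(1) \<epsilon> by (subst ennreal_mult[symmetric]) (simp_all add: \<theta>_def)
    finally have "\<bar>(\<integral>x. w x * \<omega> x \<partial>lebesgue) - \<epsilon> * (\<integral>x. \<phi>e x * \<omega> x \<partial>lebesgue)\<bar> \<le> \<epsilon> * Q / 2"
      using Q \<epsilon> i1 i2 by (simp add: ennreal_le_iff)
    moreover have "\<epsilon> * (\<integral>x. \<phi>e x * \<omega> x \<partial>lebesgue) \<le> \<epsilon> * (- Q)"
      using I2 \<epsilon> by (intro mult_left_mono) auto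
    ultimately have "\<epsilon> * Q / 2 \<le> (\<integral>x. (\<xi> \<bullet> g x) * \<psi> x \<partial>lebesgue)"
      unfolding I1 by linarith
    also have "\<dots> \<le> \<bar>\<integral>x. (\<xi> \<bullet> g x) * \<psi> x \<partial>lebesgue\<bar>" by simp
    finally have "ennreal (\<epsilon> * Q / 2) \<le> ennreal \<bar>\<integral>x. (\<xi> \<bullet> g x) * \<psi> x \<partial>lebesgue\<bar>" by (rule ennreal_leI)
    also have "ennreal \<bar>\<integral>x. (\<xi> \<bullet> g x) * \<psi> x \<partial>lebesgue\<bar> \<le> (\<integral>\<^sup>+x. ennreal \<bar>(\<xi> \<bullet> g x) * \<psi> x\<bar> \<partial>lebesgue)"
      using integral_norm_bound_ennreal[OF i3] by simp
    finally have lower: "ennreal (\<epsilon> * Q / 2) \<le> (\<integral>\<^sup>+x. ennreal \<bar>(\<xi> \<bullet> g x) * \<psi> x\<bar> \<partial>lebesgue)" .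
    define \<tau> where "\<tau> = \<epsilon> * t"
    have \<tau>: "0 < \<tau>" using \<epsilon> t by (simp add: \<tau>_def)
    let ?X = "\<integral>\<^sup>+x. ennreal (\<bar>\<xi> \<bullet> g x\<bar> powr p) * indicator (ball e 1) x \<partial>lebesgue"
    note lower
    also have "(\<integral>\<^sup>+x. ennreal \<bar>(\<xi> \<bullet> g x) * \<psi> x\<bar> \<partial>lebesgue)
      \<le> (\<integral>\<^sup>+x. ennreal (K1 * \<tau>) * indicator (ball e 1) x + ennreal (K1 * \<tau> powr (1 - p)) * (ennreal (\<bar>\<xi> \<bullet> g x\<bar> powr p) * indicator (ball e 1) x) \<partial>lebesgue)"
    proof (rule nn_integral_mono)
      fix x
      let ?a = "\<bar>\<xi> \<bullet> g x\<bar>"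
      have "\<bar>(\<xi> \<bullet> g x) * \<psi> x\<bar> \<le> ?a * K1"
        using b\<psi>[of x] by (simp add: abs_mult mult_left_mono)
      also have "\<dots> \<le> (\<tau> + \<tau> powr (1 - p) * ?a powr p) * K1"
        using le_add_powr_mult[OF _ \<tau> p, of ?a] K1 by (intro mult_right_mono) auto
      finally have "\<bar>(\<xi> \<bullet> g x) * \<psi> x\<bar> \<le> K1 * \<tau> + K1 * \<tau> powr (1 - p) * ?a powr p"
        by (simp add: algebra_simps)
      from ennreal_leI[OF this]
      show "ennreal \<bar>(\<xi> \<bullet> g x) * \<psi> x\<bar> \<le> ennreal (K1 * \<tau>) * indicator (ball e 1) x + ennreal (K1 * \<tau> powr (1 - p)) * (ennreal (\<bar>\<xi> \<bullet> g x\<bar> powr p) * indicator (ball e 1) x)"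
        using out(1)[of x] K1(1) \<tau> by (cases "x \<in> ball e 1") (simp_all add: ennreal_mult)
    qed
    also have "\<dots> = ennreal (K1 * \<tau>) * ennreal \<beta> + ennreal (K1 * \<tau> powr (1 - p)) * ?X"
    proof -
      have m1: "(\<lambda>x. ennreal (\<bar>\<xi> \<bullet> g x\<bar> powr p) * indicator (ball e 1) x) \<in> borel_measurable lebesgue"
        by (intro borel_measurable_times_ennreal borel_measurable_indicator bm) (use mg in measurable)
      have m2: "(\<lambda>x. ennreal (K1 * \<tau>) * indicator (ball e 1) x) \<in> borel_measurable lebesgue"
        by (intro borel_measurable_times_ennreal borel_measurable_indicator bm) simp
      show ?thesis
        unfolding nn_integral_add[OF m2 borel_measurable_times_ennreal[OF borel_measurable_const m1]]
          nn_integral_cmult[OF m1] nn_integral_cmult_indicator[OF bm] \<beta>(2) ..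
    qed
    finally have X: "ennreal (\<epsilon> * Q / 2) \<le> ennreal (K1 * \<tau>) * ennreal \<beta> + ennreal (K1 * \<tau> powr (1 - p)) * ?X" .
    show "ennreal (d * \<epsilon> powr p) \<le> ?X"
    proof (cases ?X)
      case (real X)
      have "ennreal (\<epsilon> * Q / 2) \<le> ennreal (K1 * \<tau> * \<beta> + K1 * \<tau> powr (1 - p) * X)"
        using X unfolding real(2) using K1 \<tau> \<beta>(1) real(1) by (simp add: ennreal_mult)
      then have "\<epsilon> * Q / 2 \<le> K1 * \<tau> * \<beta> + K1 * \<tau> powr (1 - p) * X"
        by (subst (asm) ennreal_le_iff) (use K1 \<tau> \<beta>(1) real(1) in \<open>auto intro!: add_nonneg_nonneg\<close>)
      moreover have "K1 * \<tau> * \<beta> = \<epsilon> * Q / 4"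
        using K1(1) \<beta>(1) by (simp add: \<tau>_def t_def field_simps)
      ultimately have le: "\<epsilon> * Q / 4 \<le> K1 * (\<tau> powr (1 - p) * X)" by (simp add: mult.assoc)
      have "\<epsilon> * Q / (4 * K1) * \<tau> powr (p - 1) \<le> (\<tau> powr (1 - p) * X) * \<tau> powr (p - 1)"
        using le K1 by (intro mult_right_mono) (auto simp: field_simps)
      also have "\<dots> = X * (\<tau> powr (1 - p) * \<tau> powr (p - 1))" by (simp add: ac_simps)
      also have "\<tau> powr (1 - p) * \<tau> powr (p - 1) = 1" using \<tau> by (simp add: powr_add[symmetric])
      finally have "\<epsilon> * Q / (4 * K1) * \<tau> powr (p - 1) \<le> X" by simp
      moreover have "\<tau> powr (p - 1) * \<epsilon> = \<epsilon> powr p * t powr (p - 1)"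
      proof -
        have "\<epsilon> powr (p - 1) * \<epsilon> = \<epsilon> powr p" using \<epsilon> powr_add[of \<epsilon> "p - 1" 1] by simp
        then show ?thesis by (simp add: \<tau>_def powr_mult ac_simps)
      qed
      then have "\<epsilon> * Q / (4 * K1) * \<tau> powr (p - 1) = d * \<epsilon> powr p"
        by (simp add: d_def ac_simps)
      ultimately show ?thesis unfolding real(2) by (simp add: ennreal_leI)
    qed simp
  qed
qed

section \<open>Elementary estimates for powers and their integrals\<close>

lemma powr_add3_le:
  fixes x y z r :: real
  assumes "0 \<le> r"
  shows "\<bar>x + y + z\<bar> powr r \<le> 3 powr r * (\<bar>x\<bar> powr r + \<bar>y\<bar> powr r + \<bar>z\<bar> powr r)"
proof -
  define m where "m = max \<bar>x\<bar> (max \<bar>y\<bar> \<bar>z\<bar>)"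
  have "\<bar>x + y + z\<bar> powr r \<le> (3 * m) powr r"
    using assms by (intro powr_mono2) (auto simp: m_def)
  also have "\<dots> = 3 powr r * m powr r" by (simp add: powr_mult m_def)
  also have "m powr r \<le> \<bar>x\<bar> powr r + \<bar>y\<bar> powr r + \<bar>z\<bar> powr r"
    unfolding m_def max_def by (auto intro: add_increasing add_increasing2)
  finally show ?thesis by simp
qed

lemma powr_le_add_powr_mult:
  fixes a \<tau> r q :: real
  assumes "0 \<le> a" "0 < \<tau>" "0 \<le> r" "r \<le> q"
  shows "a powr r \<le> \<tau> powr r + \<tau> powr (r - q) * a powr q"
proof (cases "a \<le> \<tau>")
  case True
  then have "a powr r \<le> \<tau> powr r" using assms by (intro powr_mono2) auto
  then show ?thesis by (simp add: add_increasing2)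
next
  case False
  then have "a powr (r - q) \<le> \<tau> powr (r - q)" using assms by (intro powr_mono2') auto
  then have "a powr (r - q) * a powr q \<le> \<tau> powr (r - q) * a powr q" by (intro mult_right_mono) auto
  then show ?thesis by (simp add: powr_add[symmetric] add_increasing)
qed

text \<open>On a set of finite measure a small integral of the power \<open>q\<close> controls lower
  powers. Splitting at the level \<tau> yields \<beta> from the set where \<open>h\<close> is small
  and 1 from the rest.\<close>

lemma nn_integral_powr_le_of_Lp_integral:
  fixes h :: "real^'n \<Rightarrow> real"
  assumes h: "h \<in> borel_measurable lebesgue" and \<tau>: "0 < \<tau>" and r: "0 \<le> r" "r \<le> q"
    and le: "Lp_integral q h \<le> ennreal (\<tau> powr q)"
    and D: "D \<in> sets lebesgue" "emeasure lebesgue D = ennreal \<beta>" "0 \<le> \<beta>"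
  shows "(\<integral>\<^sup>+x. ennreal (\<bar>h x\<bar> powr r) * indicator D x \<partial>lebesgue) \<le> ennreal (\<tau> powr r * (\<beta> + 1))"
proof -
  have "(\<integral>\<^sup>+x. ennreal (\<bar>h x\<bar> powr r) * indicator D x \<partial>lebesgue)
    \<le> (\<integral>\<^sup>+x. ennreal (\<tau> powr r) * indicator D x + ennreal (\<tau> powr (r - q)) * ennreal (norm (h x) powr q) \<partial>lebesgue)"
  proof (rule nn_integral_mono)
    fix x
    have "ennreal (\<bar>h x\<bar> powr r) \<le> ennreal (\<tau> powr r + \<tau> powr (r - q) * \<bar>h x\<bar> powr q)"
      using \<tau> r by (intro ennreal_leI powr_le_add_powr_mult) auto
    then show "ennreal (\<bar>h x\<bar> powr r) * indicator D x \<le> ennreal (\<tau> powr r) * indicator D x + ennreal (\<tau> powr (r - q)) * ennreal (norm (h x) powr q)"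
      by (cases "x \<in> D") (simp_all add: ennreal_mult)
  qed
  also have "\<dots> = ennreal (\<tau> powr r) * ennreal \<beta> + ennreal (\<tau> powr (r - q)) * Lp_integral q h"
  proof -
    have m1: "(\<lambda>x. ennreal (\<tau> powr r) * indicator D x) \<in> borel_measurable lebesgue"
      by (intro borel_measurable_times_ennreal borel_measurable_indicator D) simp
    have m2: "(\<lambda>x. ennreal (norm (h x) powr q)) \<in> borel_measurable lebesgue" using h by measurable
    show ?thesis
      unfolding nn_integral_add[OF m1 borel_measurable_times_ennreal[OF borel_measurable_const m2]]
        nn_integral_cmult[OF m2] nn_integral_cmult_indicator[OF D(1)] D(2) Lp_integral_def ..
  qed
  also have "\<dots> \<le> ennreal (\<tau> powr r) * ennreal \<beta> + ennreal (\<tau> powr (r - q)) * ennreal (\<tau> powr q)"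
    by (intro add_left_mono mult_left_mono le) simp
  also have "\<dots> = ennreal (\<tau> powr r * (\<beta> + 1))"
    using D(3) by (simp add: ennreal_mult[symmetric] powr_add[symmetric] ennreal_plus[symmetric] algebra_simps del: ennreal_plus)
  finally show ?thesis .
qed

lemma nn_integral_powr_add3_le:
  fixes x y z :: "'a \<Rightarrow> real"
  assumes m: "x \<in> borel_measurable M" "y \<in> borel_measurable M" "z \<in> borel_measurable M"
    and D: "D \<in> sets M" and r: "0 \<le> r" and u: "\<And>t. t \<in> D \<Longrightarrow> u t = x t + y t + z t"
    and X: "(\<integral>\<^sup>+t. ennreal (\<bar>x t\<bar> powr r) * indicator D t \<partial>M) \<le> ennreal X" "0 \<le> X"
    and Y: "(\<integral>\<^sup>+t. ennreal (\<bar>y t\<bar> powr r) * indicator D t \<partial>M) \<le> ennreal Y" "0 \<le> Y"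
    and Z: "(\<integral>\<^sup>+t. ennreal (\<bar>z t\<bar> powr r) * indicator D t \<partial>M) \<le> ennreal Z" "0 \<le> Z"
  shows "(\<integral>\<^sup>+t. ennreal (\<bar>u t\<bar> powr r) * indicator D t \<partial>M) \<le> ennreal (3 powr r * (X + Y + Z))"
proof -
  let ?i = "\<lambda>f t. ennreal (\<bar>f t :: real\<bar> powr r) * indicator D t"
  have mm: "?i f \<in> borel_measurable M" if "f \<in> borel_measurable M" for f
    by (intro borel_measurable_times_ennreal borel_measurable_indicator D) (use that in measurable)
  have "(\<integral>\<^sup>+t. ?i u t \<partial>M) \<le> (\<integral>\<^sup>+t. ennreal (3 powr r) * (?i x t + ?i y t + ?i z t) \<partial>M)"
  proof (rule nn_integral_mono)
    fix t
    show "?i u t \<le> ennreal (3 powr r) * (?i x t + ?i y t + ?i z t)"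
    proof (cases "t \<in> D")
      case True
      have "ennreal (\<bar>u t\<bar> powr r) \<le> ennreal (3 powr r * (\<bar>x t\<bar> powr r + \<bar>y t\<bar> powr r + \<bar>z t\<bar> powr r))"
        unfolding u[OF True] using r by (intro ennreal_leI powr_add3_le)
      then show ?thesis using True by (simp add: ennreal_mult)
    qed simp
  qed
  also have "\<dots> = ennreal (3 powr r) * ((\<integral>\<^sup>+t. ?i x t \<partial>M) + (\<integral>\<^sup>+t. ?i y t \<partial>M) + (\<integral>\<^sup>+t. ?i z t \<partial>M))"
    using mm[OF m(1)] mm[OF m(2)] mm[OF m(3)]
    by (simp add: nn_integral_cmult nn_integral_add borel_measurable_add)
  also have "\<dots> \<le> ennreal (3 powr r) * (ennreal X + ennreal Y + ennreal Z)"
    by (intro mult_left_mono add_mono X Y Z) simp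
  also have "\<dots> = ennreal (3 powr r * (X + Y + Z))"
    using X(2) Y(2) Z(2) by (simp add: ennreal_mult)
  finally show ?thesis .
qed

lemma Lp_integral_translation:
  fixes f :: "real ^ 'n \<Rightarrow> real"
  assumes "f \<in> borel_measurable lebesgue"
  shows "Lp_integral r (\<lambda>x. f (x - e)) = Lp_integral r f"
proof -
  have m: "(\<lambda>x. ennreal (norm (f x) powr r)) \<in> borel_measurable lebesgue" using assms by measurable
  show ?thesis
    unfolding Lp_integral_def using nn_integral_lebesgue_translation[OF m, of "- e"] by simp
qed

text \<open>Chebyshev's inequality at level \<open>t\<close>.\<close>

lemma emeasure_superlevel_finite:
  fixes f :: "real ^ 'n \<Rightarrow> real"
  assumes f: "f \<in> borel_measurable lebesgue" and q: "0 < q" "Lp_integral q f < \<infinity>" and t: "0 < t"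
  shows "emeasure lebesgue {x. \<bar>f x\<bar> > t} < \<infinity>"
proof -
  let ?A = "{x. \<bar>f x\<bar> > t}"
  have A: "?A \<in> sets lebesgue"
    using measurable_sets[OF borel_measurable_abs[OF f], of "{t<..}"] by (simp add: vimage_def)
  have "ennreal (t powr q) * emeasure lebesgue ?A = (\<integral>\<^sup>+x. ennreal (t powr q) * indicator ?A x \<partial>lebesgue)"
    by (rule nn_integral_cmult_indicator[OF A, symmetric])
  also have "\<dots> \<le> Lp_integral q f"
    unfolding Lp_integral_def
  proof (rule nn_integral_mono)
    fix x
    show "ennreal (t powr q) * indicator ?A x \<le> ennreal (norm (f x) powr q)"
      using t q by (cases "x \<in> ?A") (auto intro!: ennreal_leI powr_mono2)
  qed
  also have "\<dots> < top" using q by simp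
  finally show ?thesis using t by (auto simp: ennreal_mult_less_top)
qed

section \<open>Cutoff functions and the final comparison\<close>

lemma cutoff_exists:
  obtains \<zeta> :: "real^'n \<Rightarrow> real" where "\<zeta> \<in> Cc_infinity UNIV" "\<And>x. 0 \<le> \<zeta> x" "\<And>x. \<zeta> x \<le> 1" "\<zeta> 0 = 1"
    "\<And>x. \<zeta> x \<noteq> 0 \<Longrightarrow> norm x \<le> real CARD('n)"
proof -
  \<comment> \<open>Each coordinate contributes the factor
    \<open>flat 0 (1 + t) * flat 0 (1 - t)\<close>, whose value at 0 is \<open>exp (- 2)\<close>;
    the prefactor normalises the value at the origin to 1.\<close>
  define \<zeta> :: "real^'n \<Rightarrow> real" where "\<zeta> = (\<lambda>x. exp 2 ^ CARD('n) * box_bump 0 (-1) 1 x)"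
  have out: "box_bump 0 (-1) 1 x = 0" if "\<not> norm x \<le> real CARD('n)" for x :: "real^'n"
  proof (rule box_bump_outside)
    show "x \<notin> box (-1) 1"
    proof
      assume "x \<in> box (-1) 1"
      then have "\<bar>x $ i\<bar> \<le> 1" for i by (auto simp: mem_box_cart abs_le_iff less_imp_le)
      then have "(\<Sum>i\<in>UNIV. \<bar>x $ i\<bar>) \<le> (\<Sum>i\<in>(UNIV::'n set). 1)" by (intro sum_mono)
      then have "norm x \<le> real CARD('n)" using norm_le_l1_cart[of x] by simp
      then show False using that by simp
    qed
  qed
  \<comment> \<open>The two exponents add up to \<open>- 2 / (1 - t^2)\<close>, so the maximum is
    attained at 0.\<close>
  have fac: "flat 0 (1 + t) * flat 0 (1 - t) \<le> exp (- 2)" for t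
  proof (cases "\<bar>t\<bar> < 1")
    case True
    then have t2: "0 < 1 - t\<^sup>2" "1 - t\<^sup>2 \<le> 1" by (auto simp: abs_square_less_1)
    have "inverse (1 + t) + inverse (1 - t) = 2 / (1 - t\<^sup>2)"
      using True by (simp add: field_simps power2_eq_square)
    also have "\<dots> \<ge> 2" using t2 by (simp add: field_simps)
    finally have "- inverse (1 + t) + - inverse (1 - t) \<le> -2" by simp
    then show ?thesis using True by (simp add: flat_def exp_add[symmetric])
  next
    case False
    then have "flat 0 (1 + t) * flat 0 (1 - t) = 0" by (auto simp: flat_def)
    then show ?thesis by (simp only: exp_ge_zero)
  qed
  have bump: "box_bump 0 (-1) 1 x = (\<Prod>i\<in>UNIV. flat 0 (1 + x $ i) * flat 0 (1 - x $ i))" for x :: "real^'n"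
    by (simp add: box_bump_def add.commute)
  show ?thesis
  proof (rule that[of \<zeta>])
    show "\<zeta> \<in> Cc_infinity UNIV"
      unfolding \<zeta>_def by (rule Cc_infinity_mult[OF _ box_bump_Cc_infinity]) (simp add: smooth_def Ck_const)
    show "0 \<le> \<zeta> x" for x by (simp add: \<zeta>_def box_bump_bounds)
    show "\<zeta> x \<noteq> 0 \<Longrightarrow> norm x \<le> real CARD('n)" for x using out[of x] by (auto simp: \<zeta>_def)
    show "\<zeta> x \<le> 1" for x
    proof -
      have "box_bump 0 (-1) 1 x \<le> (\<Prod>i\<in>(UNIV::'n set). exp (- 2))"
        unfolding bump by (intro prod_mono) (auto simp: fac flat_0_bounds)
      then have "\<zeta> x \<le> exp 2 ^ CARD('n) * exp (- 2) ^ CARD('n)"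
        unfolding \<zeta>_def by (intro mult_left_mono) auto
      also have "\<dots> = 1" by (simp add: power_mult_distrib[symmetric] exp_add[symmetric])
      finally show ?thesis .
    qed
    show "\<zeta> 0 = 1"
      by (simp add: \<zeta>_def bump flat_def exp_add[symmetric] power_mult_distrib[symmetric])
  qed
qed

text \<open>The contradiction at the end of the argument: \<open>\<epsilon>\<^sup>p\<close> cannot be absorbed by \<open>\<epsilon>\<^sup>q\<close>.\<close>

lemma gain_beats_loss:
  fixes A A1 :: real
  assumes pq: "0 < p" "p < q" and r: "0 < r" "r \<le> real N" and \<epsilon>: "0 < \<epsilon>" "\<epsilon> \<le> 1"
    and A: "0 < m0" "m0 \<le> A" "A \<le> m1" and A1: "0 < A1" "A \<le> A1 + C1 * \<epsilon> powr q" and C1: "0 \<le> C1"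
    and \<kappa>: "0 < \<kappa>"
    and gain: "(1 + \<kappa> * \<epsilon> powr p * A powr (- p / q)) * A1 powr r \<le> A powr r"
    and small: "real N * (C1 / m0) * (1 + \<kappa> * m1 powr (- p / q)) * \<epsilon> powr (q - p) < \<kappa> * m1 powr (- p / q)"
  shows False
proof -
  \<comment> \<open>Here \<open>k * \<epsilon> powr p\<close> bounds the relative gain from below,
    and \<open>y\<close> bounds the relative loss of mass from above. The smallness condition says
    that the gain exceeds \<open>N * y * (1 + k)\<close>.\<close>
  define k where "k = \<kappa> * m1 powr (- p / q)"
  define y where "y = C1 / m0 * \<epsilon> powr q"
  have A0: "0 < A" and m1: "0 < m1" using A by auto
  have k: "0 < k" using \<kappa> m1 by (simp add: k_def)
  have y0: "0 \<le> y" using C1 A by (simp add: y_def)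
  have \<epsilon>q: "\<epsilon> powr q = \<epsilon> powr (q - p) * \<epsilon> powr p" by (simp add: powr_add[symmetric])
  have \<epsilon>p: "0 < \<epsilon> powr p" "\<epsilon> powr p \<le> 1" using \<epsilon> pq by (auto intro: powr_le1)
  have N: "1 \<le> N" using r by (cases N) auto
  have Ny: "real N * y * (1 + k) < k * \<epsilon> powr p"
  proof -
    have "real N * y * (1 + k) = (real N * (C1 / m0) * (1 + k) * \<epsilon> powr (q - p)) * \<epsilon> powr p"
      by (simp add: y_def \<epsilon>q)
    also have "\<dots> < k * \<epsilon> powr p"
      using small \<epsilon>p(1) unfolding k_def by (rule mult_strict_right_mono)
    finally show ?thesis .
  qed
  also have "k * \<epsilon> powr p \<le> k * 1" using k \<epsilon>p by (intro mult_left_mono) auto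
  finally have "real N * y * (1 + k) < 1 + k" by simp
  then have Ny1: "real N * y < 1" using k by (simp add: mult_less_cancel_right2)
  have "1 * y \<le> real N * y" using N y0 by (intro mult_right_mono) auto
  then have y1: "y < 1" using Ny1 by simp
  have "A * (1 - y) \<le> A1"
  proof -
    have "C1 * \<epsilon> powr q = m0 * y" using A by (simp add: y_def)
    also have "\<dots> \<le> A * y" using A y0 by (intro mult_right_mono) auto
    finally show ?thesis using A1 by (simp add: algebra_simps)
  qed
  then have "(A * (1 - y)) powr r \<le> A1 powr r"
    using A0 y1 r by (intro powr_mono2) auto
  moreover have "(A * (1 - y)) powr r = A powr r * (1 - y) powr r"
    using A0 y1 by (simp add: powr_mult)
  \<comment> \<open>Bernoulli's inequality is used with the natural exponent \<open>N\<close>,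
    obtained by rounding \<open>r\<close> up; as \<open>1 - y\<close> lies between 0 and 1, this
    only lowers the power.\<close>
  moreover have "1 - real N * y \<le> (1 - y) powr r"
  proof -
    have "1 - real N * y \<le> (1 - y) ^ N"
      using Bernoulli_inequality[of "- y" N] y1 by simp
    also have "\<dots> = (1 - y) powr (real N)" using y1 by (simp add: powr_realpow)
    also have "\<dots> \<le> (1 - y) powr r" using r y0 y1 by (intro powr_mono') auto
    finally show ?thesis .
  qed
  then have "A powr r * (1 - real N * y) \<le> A powr r * (1 - y) powr r"
    by (rule mult_left_mono) simp
  ultimately have low: "A powr r * (1 - real N * y) \<le> A1 powr r" by simp
  have "m1 powr (- p / q) \<le> A powr (- p / q)"
    using A A0 pq by (intro powr_mono2') (auto simp: divide_nonpos_pos)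
  then have "k * \<epsilon> powr p \<le> \<kappa> * \<epsilon> powr p * A powr (- p / q)"
    using \<kappa> \<epsilon>p by (simp add: k_def mult_left_mono mult_right_mono ac_simps)
  then have "(1 + k * \<epsilon> powr p) * (A powr r * (1 - real N * y)) \<le> (1 + \<kappa> * \<epsilon> powr p * A powr (- p / q)) * A1 powr r"
    using low k \<epsilon>p Ny1 by (intro mult_mono) (auto intro!: add_nonneg_nonneg mult_nonneg_nonneg less_imp_le[OF \<kappa>])
  also note gain
  finally have "A powr r * ((1 + k * \<epsilon> powr p) * (1 - real N * y)) \<le> A powr r * 1"
    by (simp add: ac_simps)
  then have "(1 + k * \<epsilon> powr p) * (1 - real N * y) \<le> 1"
    using A0 by (subst (asm) mult_le_cancel_left_pos) auto
  then have "k * \<epsilon> powr p \<le> real N * y * (1 + k * \<epsilon> powr p)" by (simp add: algebra_simps)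
  also have "\<dots> \<le> real N * y * (1 + k)"
    using y0 k \<epsilon>p by (intro mult_left_mono) (auto simp: mult_left_le)
  finally show False using Ny by simp
qed

text \<open>A single profile is dilated by \<open>M\<close> and moved to \<open>e\<close>. The slope
  decays like \<open>1 / M\<close>, and the region where the power \<open>k\<close> stays above one
  half grows until it covers the unit ball. The constants do not depend on \<open>M\<close> or
  \<open>e\<close>, so \<open>M\<close> can later be chosen in terms of the energy to be
  saved.\<close>

lemma cutoff_family_exists:
  obtains L M0 where "0 < L" "1 \<le> M0"
    "\<And>M (e::real^'n). M0 \<le> M \<Longrightarrow> \<exists>Z. smooth Z \<and> (\<forall>x. 0 \<le> Z x) \<and> (\<forall>x. Z x \<le> 1) \<and> (\<forall>x. norm (grad Z x) \<le> L / M) \<and>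
       (\<forall>x. Z x \<noteq> 0 \<longrightarrow> x \<in> cball e (real CARD('n) * M)) \<and> (\<forall>x\<in>ball e 1. 1 / 2 \<le> Z x ^ k)"
proof -
  obtain \<zeta> :: "real^'n \<Rightarrow> real" where \<zeta>: "\<zeta> \<in> Cc_infinity UNIV" "\<And>x. 0 \<le> \<zeta> x" "\<And>x. \<zeta> x \<le> 1" "\<zeta> 0 = 1"
    "\<And>x. \<zeta> x \<noteq> 0 \<Longrightarrow> norm x \<le> real CARD('n)"
    using cutoff_exists by blast
  have sm: "smooth \<zeta>" using \<zeta>(1) by (simp add: Cc_infinity_UNIV_iff)
  obtain L where L: "0 < L" "\<And>x. norm (grad \<zeta> x) \<le> L"
    using bounded_grad[OF smooth_Ck[OF sm]] \<zeta>(1) unfolding Cc_infinity_UNIV_iff by blast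
  have "isCont (\<lambda>x. \<zeta> x ^ k) 0"
    using Cc_infinity_continuous[OF \<zeta>(1)] by (intro continuous_intros) (simp add: continuous_on_eq_continuous_at)
  then have "((\<lambda>x. \<zeta> x ^ k) \<longlongrightarrow> 1) (at 0)" using \<zeta>(4) by (simp add: isCont_def)
  then have "\<forall>\<^sub>F x in at 0. 1 / 2 < \<zeta> x ^ k" by (rule order_tendstoD) simp
  then obtain s where s: "0 < s" "\<And>x. x \<noteq> 0 \<Longrightarrow> norm x < s \<Longrightarrow> 1 / 2 < \<zeta> x ^ k"
    unfolding eventually_at by (auto simp: dist_norm)
  \<comment> \<open>For \<open>M\<close> at least \<open>1 / s\<close> the rescaled unit ball lies
    in the ball of radius \<open>s\<close> on which the profile is large.\<close>
  define M0 where "M0 = max 1 (1 / s)"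
  show ?thesis
  proof (rule that[of L M0])
    show "0 < L" "1 \<le> M0" using L by (auto simp: M0_def)
    fix M :: real and e :: "real^'n" assume M: "M0 \<le> M"
    then have M1: "1 \<le> M" "1 / s \<le> M" by (auto simp: M0_def)
    then have M0: "0 < M" by simp
    let ?A = "(1 / M) *\<^sub>R (mat 1 :: real^'n^'n)" and ?b = "- ((1 / M) *\<^sub>R e)"
    define Z where "Z = (\<lambda>x. \<zeta> (?A *v x + ?b))"
    have A: "?A *v x = (1 / M) *\<^sub>R x" for x by (simp add: scaleR_matrix_vector_assoc[symmetric])
    have tA: "transpose ?A *v x = (1 / M) *\<^sub>R x" for x
      by (simp only: transpose_scalar transpose_mat A)
    have arg: "?A *v x + ?b = (1 / M) *\<^sub>R (x - e)" for x
      unfolding A by (simp add: scaleR_diff_right)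
    have Z: "Z x = \<zeta> ((1 / M) *\<^sub>R (x - e))" for x unfolding Z_def arg ..
    show "\<exists>Z. smooth Z \<and> (\<forall>x. 0 \<le> Z x) \<and> (\<forall>x. Z x \<le> 1) \<and> (\<forall>x. norm (grad Z x) \<le> L / M) \<and>
       (\<forall>x. Z x \<noteq> 0 \<longrightarrow> x \<in> cball e (real CARD('n) * M)) \<and> (\<forall>x\<in>ball e 1. 1 / 2 \<le> Z x ^ k)"
    proof (intro exI[of _ Z] conjI allI impI ballI)
      show "smooth Z" unfolding Z_def smooth_def using sm by (intro allI Ck_affine) (rule smooth_Ck)
      show "0 \<le> Z x" "Z x \<le> 1" for x unfolding Z by (rule \<zeta>)+
      show "norm (grad Z x) \<le> L / M" for x
      proof -
        have "grad Z x = (1 / M) *\<^sub>R grad \<zeta> (?A *v x + ?b)"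
          unfolding Z_def by (subst grad_affine[OF smooth_differentiable[OF sm]]) (rule tA)
        then show ?thesis using L(2)[of "?A *v x + ?b"] M0 by (simp add: divide_right_mono)
      qed
      show "x \<in> cball e (real CARD('n) * M)" if "Z x \<noteq> 0" for x
        using \<zeta>(5)[of "(1 / M) *\<^sub>R (x - e)"] that M0
        by (simp add: Z dist_norm norm_minus_commute pos_divide_le_eq)
      show "1 / 2 \<le> Z x ^ k" if "x \<in> ball e 1" for x
      proof (cases "x = e")
        case True
        then show ?thesis using \<zeta>(4) by (simp add: Z)
      next
        case False
        have "norm ((1 / M) *\<^sub>R (x - e)) < 1 / M"
          using that M0 by (simp add: dist_norm norm_minus_commute divide_strict_right_mono)
        also have "1 / M \<le> s" using M1 M0 s(1) by (simp add: field_simps)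
        finally show ?thesis using s(2)[of "(1 / M) *\<^sub>R (x - e)"] False M0 by (simp add: Z less_imp_le)
      qed
    qed
  qed
qed

text \<open>This admits the truncated function as a competitor in the Sobolev inequality. The
  product rule adds a term containing \<open>f\<close> itself, which need not be globally integrable
  to the power \<open>p\<close>; that term is confined to \<open>D\<close>, where \<open>fin\<close>
  applies.\<close>

lemma cutoff_W_hom:
  fixes f Z :: "real^'n \<Rightarrow> real"
  assumes p: "2 \<le> p" and f: "f \<in> W_hom p"
    and Z: "smooth Z" "\<And>x. 0 \<le> Z x" "\<And>x. Z x \<le> 1" "\<And>x. norm (grad Z x) \<le> l" "\<And>x. Z x \<noteq> 0 \<Longrightarrow> x \<in> D"
    and D: "D \<in> sets lebesgue" and k: "2 \<le> k"
    and fin: "(\<integral>\<^sup>+x. ennreal (\<bar>f x\<bar> powr p) * indicator D x \<partial>lebesgue) < \<infinity>"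
  defines "g1 \<equiv> \<lambda>x. (1 - Z x ^ k) *\<^sub>R weak_gradient f x + f x *\<^sub>R grad (\<lambda>x. 1 - Z x ^ k) x"
  assumes w: "is_weak_gradient (\<lambda>x. (1 - Z x ^ k) * f x) g1"
  shows "(\<lambda>x. (1 - Z x ^ k) * f x) \<in> W_hom p"
proof (rule W_homI[OF _ w])
  have p0: "0 < p" using p by simp
  then show "0 < p" .
  note wf = W_homD[OF p0 f]
  note fm = L1_loc_measurable[OF is_weak_gradient_L1_loc(1)[OF wf(1)]]
  note gm = L1_loc_measurable[OF is_weak_gradient_L1_loc(2)[OF wf(1)]]
  have Zk: "0 \<le> 1 - Z x ^ k" "1 - Z x ^ k \<le> 1" for x
    using Z(2,3)[of x] by (auto simp: power_le_one)
  have l: "0 \<le> l" using Z(4)[of undefined] norm_ge_zero order_trans by blast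
  define c where "c = real k * l"
  have c: "0 \<le> c" using l by (simp add: c_def)
  let ?g = "weak_gradient f"
  have pw: "norm (g1 x) powr p \<le> 3 powr p * (norm (?g x) powr p + c powr p * (\<bar>f x\<bar> powr p * indicator D x))" for x
  proof -
    have gr: "grad (\<lambda>x. 1 - Z x ^ k) x = - ((real k * Z x ^ (k - 1)) *\<^sub>R grad Z x)"
      by (rule grad_power[OF smooth_differentiable[OF Z(1)]])
    have "norm (grad (\<lambda>x. 1 - Z x ^ k) x) \<le> c * indicator D x"
    proof (cases "Z x = 0")
      case True
      then show ?thesis using k c by (simp add: gr power_0_left)
    next
      case False
      have "real k * Z x ^ (k - 1) * norm (grad Z x) \<le> real k * 1 * l"
        using Z(2,3,4)[of x] by (intro mult_mono) (auto simp: power_le_one)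
      then show ?thesis using Z(5)[OF False] Z(2)[of x] by (simp add: gr c_def)
    qed
    then have "\<bar>f x\<bar> * norm (grad (\<lambda>x. 1 - Z x ^ k) x) \<le> \<bar>f x\<bar> * (c * indicator D x)"
      by (rule mult_left_mono) simp
    moreover have "\<bar>1 - Z x ^ k\<bar> * norm (?g x) \<le> norm (?g x)"
      using Zk[of x] by (simp add: mult_left_le_one_le)
    ultimately have "norm (g1 x) \<le> \<bar>norm (?g x) + \<bar>f x\<bar> * (c * indicator D x) + 0\<bar>"
      using norm_triangle_ineq[of "(1 - Z x ^ k) *\<^sub>R ?g x" "f x *\<^sub>R grad (\<lambda>x. 1 - Z x ^ k) x"]
      by (simp add: g1_def)
    then have "norm (g1 x) powr p \<le> \<bar>norm (?g x) + \<bar>f x\<bar> * (c * indicator D x) + 0\<bar> powr p"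
      using p by (intro powr_mono2) auto
    also have "\<dots> \<le> 3 powr p * (\<bar>norm (?g x)\<bar> powr p + \<bar>\<bar>f x\<bar> * (c * indicator D x)\<bar> powr p + \<bar>0\<bar> powr p)"
      using p by (intro powr_add3_le) auto
    also have "\<bar>\<bar>f x\<bar> * (c * indicator D x)\<bar> powr p = c powr p * (\<bar>f x\<bar> powr p * indicator D x)"
      using c by (simp add: indicator_def powr_mult)
    finally show ?thesis using p by simp
  qed
  have mD: "(\<lambda>x. ennreal (\<bar>f x\<bar> powr p) * indicator D x) \<in> borel_measurable lebesgue"
    by (intro borel_measurable_times_ennreal borel_measurable_indicator D) (use fm in measurable)
  have mg: "(\<lambda>x. ennreal (norm (?g x) powr p)) \<in> borel_measurable lebesgue" using gm by measurable
  have "Lp_integral p g1 \<le> (\<integral>\<^sup>+x. ennreal (3 powr p) * (ennreal (norm (?g x) powr p) + ennreal (c powr p) * (ennreal (\<bar>f x\<bar> powr p) * indicator D x)) \<partial>lebesgue)"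
    unfolding Lp_integral_def
  proof (rule nn_integral_mono)
    fix x
    have "ennreal (norm (g1 x) powr p) \<le> ennreal (3 powr p * (norm (?g x) powr p + c powr p * (\<bar>f x\<bar> powr p * indicator D x)))"
      by (rule ennreal_leI[OF pw])
    also have "\<dots> = ennreal (3 powr p) * (ennreal (norm (?g x) powr p) + ennreal (c powr p) * (ennreal (\<bar>f x\<bar> powr p) * indicator D x))"
      by (cases "x \<in> D") (simp_all add: ennreal_mult)
    finally show "ennreal (norm (g1 x) powr p) \<le> ennreal (3 powr p) * (ennreal (norm (?g x) powr p) + ennreal (c powr p) * (ennreal (\<bar>f x\<bar> powr p) * indicator D x))" .
  qed
  also have "\<dots> = ennreal (3 powr p) * (Lp_integral p ?g + ennreal (c powr p) * (\<integral>\<^sup>+x. ennreal (\<bar>f x\<bar> powr p) * indicator D x \<partial>lebesgue))"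
    using mg mD by (simp add: nn_integral_cmult nn_integral_add Lp_integral_def)
  also have "\<dots> < \<infinity>"
    using wf(2) fin by (simp add: ennreal_mult_less_top)
  finally show "Lp_integral p g1 < \<infinity>" .
  fix t :: real assume t: "0 < t"
  have "emeasure lebesgue {x. t < \<bar>(1 - Z x ^ k) * f x\<bar>} \<le> emeasure lebesgue {x. t < \<bar>f x\<bar>}"
  proof (rule emeasure_mono)
    show "{x. t < \<bar>(1 - Z x ^ k) * f x\<bar>} \<subseteq> {x. t < \<bar>f x\<bar>}"
    proof
      fix x assume "x \<in> {x. t < \<bar>(1 - Z x ^ k) * f x\<bar>}"
      then have "t < \<bar>1 - Z x ^ k\<bar> * \<bar>f x\<bar>" by (simp add: abs_mult)
      also have "\<dots> \<le> 1 * \<bar>f x\<bar>" using Zk[of x] by (intro mult_right_mono) auto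
      finally show "x \<in> {x. t < \<bar>f x\<bar>}" by simp
    qed
    show "{x. t < \<bar>f x\<bar>} \<in> sets lebesgue"
      using measurable_sets[OF borel_measurable_abs[OF fm], of "{t<..}"] by (simp add: vimage_def)
  qed
  also have "\<dots> < \<infinity>" by (rule wf(3)[OF t])
  finally show "emeasure lebesgue {x. t < \<bar>(1 - Z x ^ k) * f x\<bar>} < \<infinity>" .
qed

section \<open>The profile\<close>

text \<open>At the origin the difference quotient has size \<open>norm h powr (q - 1)\<close>, which
  tends to 0 because \<open>q\<close> exceeds 1. Elsewhere this is the chain rule.\<close>

lemma norm_powr_has_derivative:
  fixes x :: "'a::real_inner"
  assumes "1 < q"
  shows "((\<lambda>x. norm x powr q) has_derivative (\<lambda>v. v \<bullet> ((q * norm x powr (q - 2)) *\<^sub>R x))) (at x)"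
proof (cases "x = 0")
  case False
  have "((\<lambda>x. norm x powr q) has_derivative (\<lambda>v. (q * norm x powr (q - 1)) * (sgn x \<bullet> v))) (at x)"
  proof -
    have n: "(norm has_derivative (\<lambda>v. sgn x \<bullet> v)) (at x)"
      using has_derivative_norm[OF False] by (simp add: inner_commute)
    have "((\<lambda>r. r powr q) has_derivative (\<lambda>h. (q * norm x powr (q - 1)) * h)) (at (norm x))"
      using has_real_derivative_powr[of "norm x" q] False by (simp add: has_field_derivative_def)
    from has_derivative_compose[OF n this] show ?thesis .
  qed
  moreover have "(q * norm x powr (q - 1)) * (sgn x \<bullet> v) = v \<bullet> ((q * norm x powr (q - 2)) *\<^sub>R x)" for v
  proof -
    have "norm x powr (q - 1) = norm x powr (q - 2) * norm x"
      using False powr_add[of "norm x" "q - 2" 1] by (simp add: algebra_simps)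
    then show ?thesis using False by (simp add: sgn_div_norm inner_commute)
  qed
  ultimately show ?thesis by simp
next
  case True
  have "((\<lambda>h::'a. norm h powr (q - 1)) \<longlongrightarrow> 0) (at 0)"
  proof -
    have "((\<lambda>h::'a. norm h) \<longlongrightarrow> 0) (at 0)" by (rule tendsto_norm_zero) (rule tendsto_ident_at)
    from tendsto_zero_powrI[OF this tendsto_const[of "q - 1"]] show ?thesis using assms by auto
  qed
  moreover have "norm h powr (q - 1) = \<bar>norm h powr q\<bar> / norm h" for h :: 'a
    using powr_diff[of "norm h" q 1] by (cases "h = 0") auto
  ultimately have "((\<lambda>h::'a. \<bar>norm h powr q\<bar> / norm h) \<longlongrightarrow> 0) (at 0)" by simp
  then show ?thesis using True assms by (simp add: has_derivative_at)
qed

text \<open>The conjugate exponent \<open>q\<close> can be smaller than 2, and the profile then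
  fails to be smooth at the origin, so one continuous derivative is what can be claimed. The
  critical factor \<open>norm x powr (q - 2) *\<^sub>R x\<close> has norm
  \<open>norm x powr (q - 1)\<close> and is continuous at 0.\<close>

lemma U_profile_Ck:
  fixes p :: real
  assumes "1 < p"
  shows "Ck (Suc 0) (U_profile c p :: real ^ 'n \<Rightarrow> real)"
proof -
  define q where "q = p / (p - 1)"
  have q: "1 < q" using assms by (simp add: q_def field_simps)
  define s where "s = (p - real CARD('n)) / p"
  let ?w = "\<lambda>x::real^'n. 1 + norm x powr q"
  have w: "0 < ?w x" for x by (simp add: add_pos_nonneg)
  let ?g = "\<lambda>x::real^'n. (c * s * ?w x powr (s - 1)) *\<^sub>R ((q * norm x powr (q - 2)) *\<^sub>R x)"
  show ?thesis
  proof (rule Ck_SucI)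
    fix x :: "real^'n"
    have d1: "(?w has_derivative (\<lambda>v. v \<bullet> ((q * norm x powr (q - 2)) *\<^sub>R x))) (at x)"
      using has_derivative_add[OF has_derivative_const norm_powr_has_derivative[OF q]] by simp
    have d2: "((\<lambda>r. c * r powr s) has_derivative (\<lambda>h. (c * s * ?w x powr (s - 1)) * h)) (at (?w x))"
      using DERIV_cmult[OF has_real_derivative_powr[OF w], of c s x] by (simp add: has_field_derivative_def mult.assoc[symmetric])
    show "(U_profile c p has_derivative (\<lambda>v. v \<bullet> ?g x)) (at x)"
      using has_derivative_compose[OF d1 d2]
      by (simp add: U_profile_def[abs_def] q_def[symmetric] s_def[symmetric] ac_simps)
  next
    fix i
    have c0: "continuous_on UNIV (\<lambda>x::real^'n. norm x powr q)"
      by (rule has_derivative_continuous_on[OF has_derivative_at_withinI[OF norm_powr_has_derivative[OF q]]])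
    have "isCont (\<lambda>x::real^'n. norm x powr (q - 2) *\<^sub>R x) x" for x
    proof (cases "x = 0")
      case False
      then show ?thesis by (intro continuous_intros) auto
    next
      case True
      have "((\<lambda>h::real^'n. norm h powr (q - 1)) \<longlongrightarrow> 0) (at 0)"
      proof -
        have "((\<lambda>h::real^'n. norm h) \<longlongrightarrow> 0) (at 0)" by (rule tendsto_norm_zero) (rule tendsto_ident_at)
        from tendsto_zero_powrI[OF this tendsto_const[of "q - 1"]] show ?thesis using q by auto
      qed
      moreover have "norm h powr (q - 1) = norm (norm h powr (q - 2) *\<^sub>R h)" for h :: "real^'n"
        using powr_add[of "norm h" "q - 2" 1] by (cases "h = 0") (auto simp: algebra_simps)
      ultimately have "((\<lambda>h::real^'n. norm h powr (q - 2) *\<^sub>R h) \<longlongrightarrow> 0) (at 0)"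
        by (simp only: tendsto_norm_zero_iff)
      then show ?thesis using True by (simp add: isCont_def)
    qed
    then have c1: "continuous_on UNIV (\<lambda>x::real^'n. norm x powr (q - 2) *\<^sub>R x)"
      by (simp add: continuous_on_eq_continuous_at)
    have c2: "continuous_on UNIV (\<lambda>x::real^'n. ?w x powr (s - 1))"
      using w by (intro continuous_intros c0) (metis less_irrefl)
    have "continuous_on UNIV (\<lambda>x. ((c * s * q * ?w x powr (s - 1)) *\<^sub>R (norm x powr (q - 2) *\<^sub>R x)) $ i)"
      by (intro continuous_intros c2 c1)
    then show "Ck 0 (\<lambda>x. ?g x $ i)" by (simp add: ac_simps)
  qed
qed

lemma U_profile_pos:
  assumes "0 < c"
  shows "0 < U_profile c p x"
proof -
  have "0 < 1 + norm x powr (p / (p - 1))" by (simp add: add_pos_nonneg)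
  then show ?thesis using assms by (simp add: U_profile_def)
qed

lemma U_profile_antimono:
  fixes x y :: "real ^ 'n"
  assumes "1 < p" "p < real CARD('n)" "0 < c" "norm x \<le> norm y"
  shows "U_profile c p y \<le> U_profile c p x"
proof -
  have "norm x powr (p / (p - 1)) \<le> norm y powr (p / (p - 1))"
    using assms by (intro powr_mono2) auto
  then show ?thesis
    unfolding U_profile_def using assms
    by (intro mult_left_mono powr_mono2') (auto simp: add_pos_nonneg divide_nonpos_pos)
qed

section \<open>Extremals stay away from the bump\<close>

lemma sobolev_exp_gt:
  assumes "0 < p" "p < n"
  shows "p < sobolev_exp n p"
proof -
  have "p * (n - p) < n * p" using assms by (simp add: algebra_simps)
  then show ?thesis using assms by (simp add: sobolev_exp_def pos_less_divide_eq)
qed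

text \<open>The gain from \<open>M_aff_gain\<close> has order \<open>\<epsilon> powr p\<close>, the
  loss of mass order \<open>\<epsilon> powr q\<close>, and \<open>gain_beats_loss\<close> excludes
  this. The point \<open>e\<close> is arbitrary subject to the decay of \<open>U\<close>, so
  \<delta> and the bound for \<epsilon> must not depend on it.\<close>

lemma no_extremal_near_bump:
  fixes \<phi> U :: "real ^ 'n \<Rightarrow> real" and p c\<^sub>0 S :: real
  assumes p2: "2 \<le> p" and pn: "p < real CARD('n)"
    and \<phi>: "\<phi> \<in> Cc_infinity (ball 0 1)" "\<phi> \<noteq> (\<lambda>_. 0)"
    and c0: "0 < c\<^sub>0" and U: "U = U_profile c\<^sub>0 p"
    and U1: "Lp_norm (sobolev_exp (real CARD('n)) p) U = 1"
    and S: "S_aff TYPE('n) p = ennreal S" "0 < S"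
  obtains \<delta> \<epsilon>0 where "0 < \<delta>" "0 < \<epsilon>0" "\<epsilon>0 \<le> 1"
    "\<And>\<epsilon> e w. 0 < \<epsilon> \<Longrightarrow> \<epsilon> < \<epsilon>0 \<Longrightarrow> (\<And>y. norm e / 4 \<le> norm y \<Longrightarrow> U y \<le> \<epsilon>\<^sup>2) \<Longrightarrow> w \<in> M_aff p \<Longrightarrow>
      Lp_integral (sobolev_exp (real CARD('n)) p) (\<lambda>x. U x + \<epsilon> * \<phi> (x - e) - w x)
        \<le> ennreal ((\<delta> * \<epsilon>) powr sobolev_exp (real CARD('n)) p) \<Longrightarrow> False"
proof -
  let ?n = "real CARD('n)"
  define q where "q = sobolev_exp ?n p"
  have p0: "0 < p" and p1: "1 \<le> p" using p2 by auto
  have pq: "p < q" unfolding q_def by (rule sobolev_exp_gt[OF p0 pn])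
  have q0: "0 < q" and q1: "1 \<le> q" using pq p2 by auto
  note \<phi>U = Cc_infinity_mono[OF \<phi>(1)]
  have \<phi>m: "\<phi> \<in> borel_measurable lebesgue"
    by (rule L1_loc_measurable[OF L1_loc_continuous[OF Cc_infinity_continuous[OF \<phi>U]]])
  have Um: "U \<in> borel_measurable lebesgue"
    unfolding U using p2 by (intro L1_loc_measurable L1_loc_continuous Ck_continuous_on[OF U_profile_Ck]) simp
  have Upos: "0 < U x" for x unfolding U by (rule U_profile_pos[OF c0])
  have UI: "Lp_integral q U = 1"
  proof -
    have "(Lp_integral q U epowr (1 / q)) epowr q = 1 epowr q"
      using U1 q0 by (simp add: Lp_norm_eq q_def)
    then show ?thesis using q0 epowr_ennreal_pos[of 1 q] by (simp add: epowr_epowr)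
  qed
  obtain \<kappa> where \<kappa>: "0 < \<kappa>"
    "\<And>(f :: real^'n \<Rightarrow> real) g f1 g1 a F F1.
      f \<in> M_aff p \<Longrightarrow> is_weak_gradient f g \<Longrightarrow> f1 \<in> W_hom p \<Longrightarrow> is_weak_gradient f1 g1 \<Longrightarrow> 0 < a \<Longrightarrow>
      (\<And>\<xi>. norm \<xi> = 1 \<Longrightarrow> Lp_integral p (\<lambda>x. \<xi> \<bullet> g1 x) + ennreal a \<le> Lp_integral p (\<lambda>x. \<xi> \<bullet> g x)) \<Longrightarrow>
      Lp_norm q f = ennreal F \<Longrightarrow> 0 < F \<Longrightarrow> Lp_norm q f1 = ennreal F1 \<Longrightarrow> 0 < F1 \<Longrightarrow>
      (1 + \<kappa> * a * F powr (- p)) * F1 powr ?n \<le> F powr ?n"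
    unfolding q_def using M_aff_gain[OF p0 pn S] by blast
  obtain d \<theta> where d: "0 < d" and \<theta>: "0 < \<theta>" and bump:
    "\<And>w g (e::real^'n) \<epsilon> (\<xi>::real^'n). is_weak_gradient w g \<Longrightarrow> 0 < \<epsilon> \<Longrightarrow> norm \<xi> = 1 \<Longrightarrow>
      (\<integral>\<^sup>+x. ennreal \<bar>w x - \<epsilon> * \<phi> (x - e)\<bar> * indicator (ball e 1) x \<partial>lebesgue) \<le> ennreal (\<theta> * \<epsilon>) \<Longrightarrow>
      ennreal (d * \<epsilon> powr p) \<le> (\<integral>\<^sup>+x. ennreal (\<bar>\<xi> \<bullet> g x\<bar> powr p) * indicator (ball e 1) x \<partial>lebesgue)"
    using bump_energy_lower_bound[OF \<phi> p1] by blast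
  \<comment> \<open>A natural exponent above \<open>n / q\<close>, for Bernoulli's inequality at the
    end.\<close>
  obtain N :: nat where N: "?n / q \<le> real N" using real_arch_simple by blast
  obtain k :: nat where k: "p \<le> real k" using real_arch_simple by blast
  then have k2: "2 \<le> k" using p2 by linarith
  obtain L M0 where L: "0 < L" "1 \<le> M0" and cut:
    "\<And>M (e::real^'n). M0 \<le> M \<Longrightarrow> \<exists>Z. smooth Z \<and> (\<forall>x. 0 \<le> Z x) \<and> (\<forall>x. Z x \<le> 1) \<and> (\<forall>x. norm (grad Z x) \<le> L / M) \<and>
       (\<forall>x. Z x \<noteq> 0 \<longrightarrow> x \<in> cball e (?n * M)) \<and> (\<forall>x\<in>ball e 1. 1 / 2 \<le> Z x ^ k)"
    using cutoff_family_exists[of k] by blast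
  obtain \<Phi>p where \<Phi>p: "Lp_integral p \<phi> = ennreal \<Phi>p" "0 \<le> \<Phi>p"
    using Cc_infinity_Lp_integral_finite[OF p0 \<phi>U] by (cases "Lp_integral p \<phi>") auto
  obtain \<Phi>q where \<Phi>q: "Lp_integral q \<phi> = ennreal \<Phi>q" "0 \<le> \<Phi>q"
    using Cc_infinity_Lp_integral_finite[OF q0 \<phi>U] by (cases "Lp_integral q \<phi>") auto
  \<comment> \<open>The mass of \<open>w\<close> on the cutoff ball will be at most
    \<open>3 powr p * (\<Phi>p + 2) * \<epsilon> powr p\<close>. If the slope factor
    \<open>k * L / M\<close> is at most \<open>1 / X\<close>, the truncation costs at most
    \<open>d / 4 * \<epsilon> powr p\<close>, half of what it saves.\<close>
  define X where "X = (4 * (3 powr p * (\<Phi>p + 2)) / d) powr (1 / p)"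
  have X: "0 < X" using \<Phi>p(2) d by (simp add: X_def)
  have Xp: "X powr p = 4 * (3 powr p * (\<Phi>p + 2)) / d"
    using \<Phi>p(2) d p0 by (simp add: X_def powr_powr)
  define M where "M = max M0 (real k * L * X)"
  have M: "M0 \<le> M" "1 \<le> M" "real k * L * X \<le> M" using L by (auto simp: M_def)
  have loss: "(real k * (L / M)) powr p * (3 powr p * (\<Phi>p + 2)) \<le> d / 4"
  proof -
    have "real k * (L / M) \<le> 1 / X" using M X by (simp add: field_simps)
    then have "(real k * (L / M)) powr p \<le> (1 / X) powr p"
      using L M p0 by (intro powr_mono2) auto
    also have "\<dots> = d / (4 * (3 powr p * (\<Phi>p + 2)))" by (simp add: powr_divide Xp)
    finally have "(real k * (L / M)) powr p * (3 powr p * (\<Phi>p + 2)) \<le> d / (4 * (3 powr p * (\<Phi>p + 2))) * (3 powr p * (\<Phi>p + 2))"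
      using \<Phi>p(2) by (intro mult_right_mono) auto
    also have "\<dots> = d / 4" using \<Phi>p(2) by simp
    finally show ?thesis .
  qed
  define \<rho> where "\<rho> = ?n * M"
  have n1: "1 \<le> ?n" by (simp add: Suc_leI)
  have \<rho>: "1 \<le> \<rho>" unfolding \<rho>_def using mult_mono[OF n1 M(2)] by simp
  define \<beta> where "\<beta> = unit_ball_vol (real DIM(real^'n)) * \<rho> ^ DIM(real^'n)"
  have \<beta>: "0 \<le> \<beta>" "emeasure lebesgue (cball e \<rho>) = ennreal \<beta>" for e :: "real^'n"
    using \<rho> by (simp_all add: \<beta>_def emeasure_cball)
  define \<beta>1 where "\<beta>1 = unit_ball_vol (real DIM(real^'n)) * 1 ^ DIM(real^'n)"
  have \<beta>1: "0 \<le> \<beta>1" "emeasure lebesgue (ball e 1) = ennreal \<beta>1" for e :: "real^'n"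
    by (simp_all add: \<beta>1_def emeasure_ball del: One_nat_def)
  \<comment> \<open>The first two entries make the error \<open>h\<close> contribute at most
    \<open>\<epsilon> powr r\<close> on the cutoff ball for each \<open>r\<close> from 1 to
    \<open>q\<close>; the third keeps its integral over the unit ball below half of
    \<open>\<theta> * \<epsilon>\<close>.\<close>
  define \<delta> where "\<delta> = min 1 (min (1 / (\<beta> + 1)) (\<theta> / (2 * (\<beta>1 + 1))))"
  have \<delta>: "0 < \<delta>" "\<delta> \<le> 1" "\<delta> * (\<beta> + 1) \<le> 1" "\<delta> * (\<beta>1 + 1) \<le> \<theta> / 2"
  proof -
    show "0 < \<delta>" "\<delta> \<le> 1" using \<beta>(1) \<beta>1(1) \<theta> by (auto simp: \<delta>_def)
    have "\<delta> \<le> 1 / (\<beta> + 1)" "\<delta> \<le> \<theta> / (2 * (\<beta>1 + 1))" by (auto simp: \<delta>_def)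
    then show "\<delta> * (\<beta> + 1) \<le> 1" "\<delta> * (\<beta>1 + 1) \<le> \<theta> / 2"
      using \<beta>(1) \<beta>1(1) by (simp_all add: field_simps)
  qed
  obtain i0 :: 'n where True by simp
  \<comment> \<open>The value of the profile at the radius of the cutoff ball. It will force
    \<open>e\<close> to be far away: were \<open>norm e / 4\<close> at most \<rho>, the decay
    hypothesis would give \<open>u0 \<le> \<epsilon>^2\<close>.\<close>
  define u0 where "u0 = U (\<rho> *\<^sub>R axis i0 1)"
  have u0: "0 < u0" by (simp add: u0_def Upos)
  \<comment> \<open>The numbers \<open>m0\<close> and \<open>m1\<close> will enclose the integral
    \<open>A\<close> of the power \<open>q\<close> of \<open>w\<close>, and \<open>C1\<close> will
    bound its part on the cutoff ball. Since \<open>U\<close> has norm 1, the three-term inequality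
    leaves \<open>3 powr (- q)\<close> for \<open>w\<close> and the error terms; half of it is
    reserved for the errors.\<close>
  define m0 where "m0 = 3 powr (- q) / 2"
  define m1 where "m1 = 3 powr q * (1 + \<Phi>q + 1)"
  define C1 where "C1 = 3 powr q * (\<beta> + \<Phi>q + 1)"
  have m0: "0 < m0" by (simp add: m0_def)
  have m1: "0 < m1" using \<Phi>q(2) by (simp add: m1_def add_nonneg_pos)
  have C1: "0 \<le> C1" using \<Phi>q(2) \<beta>(1) by (simp add: C1_def)
  define \<kappa>' where "\<kappa>' = \<kappa> * (d / 4)"
  have \<kappa>': "0 < \<kappa>'" using \<kappa>(1) d by (simp add: \<kappa>'_def)
  define T where "T = \<kappa>' * m1 powr (- p / q)"
  have T: "0 < T" using \<kappa>' m1 by (simp add: T_def)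
  define B where "B = real N * (C1 / m0) * (1 + T)"
  have B: "0 \<le> B" using C1 m0 T by (simp add: B_def)
  \<comment> \<open>In the order of the list: the bound by 1; the mass of \<open>U\<close> on the
    cutoff ball; the integral of \<open>U\<close> on the unit ball in the duality estimate; the
    distance of \<open>e\<close>; the lower bound \<open>m0\<close> for \<open>A\<close>; and the
    final comparison of the powers \<open>p\<close> and \<open>q\<close>.\<close>
  define \<epsilon>0 where "\<epsilon>0 = Min {1, 1 / (\<beta> + 1), \<theta> / (2 * (\<beta>1 + 1)), u0, m0 / (\<Phi>q + 1), (T / (B + 1)) powr (1 / (q - p))}"
  have \<epsilon>0: "0 < \<epsilon>0" "\<epsilon>0 \<le> 1" "\<epsilon>0 \<le> 1 / (\<beta> + 1)" "\<epsilon>0 \<le> \<theta> / (2 * (\<beta>1 + 1))" "\<epsilon>0 \<le> u0"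
      "\<epsilon>0 \<le> m0 / (\<Phi>q + 1)" "\<epsilon>0 \<le> (T / (B + 1)) powr (1 / (q - p))"
    using \<beta>(1) \<beta>1(1) \<theta> u0 m0 \<Phi>q(2) T B by (auto simp: \<epsilon>0_def)
  show ?thesis
  proof (rule that[OF \<delta>(1) \<epsilon>0(1,2)], fold q_def)
    fix \<epsilon> :: real and e :: "real^'n" and w :: "real^'n \<Rightarrow> real"
    assume \<epsilon>: "0 < \<epsilon>" "\<epsilon> < \<epsilon>0" and Usmall: "\<And>y. norm e / 4 \<le> norm y \<Longrightarrow> U y \<le> \<epsilon>\<^sup>2"
      and w: "w \<in> M_aff p" and close: "Lp_integral q (\<lambda>x. U x + \<epsilon> * \<phi> (x - e) - w x) \<le> ennreal ((\<delta> * \<epsilon>) powr q)"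
    have \<epsilon>1: "\<epsilon> < 1" using \<epsilon> \<epsilon>0 by simp
    have \<epsilon>\<epsilon>: "\<epsilon>\<^sup>2 \<le> \<epsilon>" using \<epsilon> \<epsilon>1 by (simp add: power2_eq_square mult_left_le)
    have \<epsilon>\<beta>: "\<epsilon> * \<beta> \<le> 1" "\<epsilon> * \<beta>1 \<le> \<theta> / 2"
    proof -
      have "\<epsilon> \<le> 1 / (\<beta> + 1)" "\<epsilon> \<le> \<theta> / (2 * (\<beta>1 + 1))"
        using \<epsilon> \<epsilon>0(3,4) by linarith+
      then have "\<epsilon> * (\<beta> + 1) \<le> 1" "\<epsilon> * (\<beta>1 + 1) \<le> \<theta> / 2"
        using \<beta>(1) \<beta>1(1) by (simp_all add: field_simps)
      then show "\<epsilon> * \<beta> \<le> 1" "\<epsilon> * \<beta>1 \<le> \<theta> / 2" using \<epsilon> by (simp_all add: algebra_simps)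
    qed
    define \<tau> where "\<tau> = \<delta> * \<epsilon>"
    have \<tau>: "0 < \<tau>" "\<tau> \<le> \<epsilon>" using \<delta> \<epsilon> by (auto simp: \<tau>_def)
    define h where "h = (\<lambda>x. U x + \<epsilon> * \<phi> (x - e) - w x)"
    have wW: "w \<in> W_hom p" using w by (simp add: M_aff_def)
    note ww = W_homD[OF p0 wW]
    let ?g = "weak_gradient w"
    note wm = L1_loc_measurable[OF is_weak_gradient_L1_loc(1)[OF ww(1)]]
    note gm = L1_loc_measurable[OF is_weak_gradient_L1_loc(2)[OF ww(1)]]
    have \<phi>em: "(\<lambda>x. \<phi> (x - e)) \<in> borel_measurable lebesgue"
      by (rule L1_loc_measurable[OF L1_loc_continuous[OF Cc_infinity_continuous[OF Cc_infinity_translation_minus[OF \<phi>U]]]])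
    have hm: "h \<in> borel_measurable lebesgue" unfolding h_def using Um \<phi>em wm by measurable
    have hI: "Lp_integral q h \<le> ennreal (\<tau> powr q)" using close by (simp add: h_def \<tau>_def)
    let ?D = "cball e \<rho>"
    have Dm: "?D \<in> sets lebesgue" by simp
    have far: "\<rho> < norm e / 4"
    proof (rule ccontr)
      assume "\<not> \<rho> < norm e / 4"
      then have "norm e / 4 \<le> norm (\<rho> *\<^sub>R axis i0 (1::real))" using \<rho> by (simp add: norm_axis_1)
      from Usmall[OF this] have "u0 \<le> \<epsilon>" using \<epsilon>\<epsilon> by (simp add: u0_def)
      then show False using \<epsilon> \<epsilon>0 by simp
    qed
    \<comment> \<open>Since \<rho> is below \<open>norm e / 4\<close>, every point of the ball has
      norm above three quarters of \<open>norm e\<close>, so the decay hypothesis applies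
      throughout.\<close>
    have UD: "\<bar>U x\<bar> \<le> \<epsilon>\<^sup>2" if "x \<in> ?D" for x
    proof -
      have "norm e \<le> norm x + norm (e - x)" using norm_triangle_sub[of e x] by simp
      then have "norm e / 4 \<le> norm x" using that far \<rho> by (simp add: dist_norm)
      then show ?thesis using Usmall[of x] Upos[of x] by simp
    qed
    have sub1: "ball e 1 \<subseteq> ?D" using \<rho> by auto
    have h_small: "(\<integral>\<^sup>+x. ennreal (\<bar>h x\<bar> powr r) * indicator ?D x \<partial>lebesgue) \<le> ennreal (\<tau> powr r * (\<beta> + 1))"
      if "0 \<le> r" "r \<le> q" for r
      by (rule nn_integral_powr_le_of_Lp_integral[OF hm \<tau>(1) that hI Dm \<beta>(2,1)])
    have U_small: "(\<integral>\<^sup>+x. ennreal (\<bar>U x\<bar> powr r) * indicator ?D x \<partial>lebesgue) \<le> ennreal (\<epsilon> powr r * (\<epsilon> powr r * \<beta>))"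
      if "0 \<le> r" for r
    proof -
      have "(\<integral>\<^sup>+x. ennreal (\<bar>U x\<bar> powr r) * indicator ?D x \<partial>lebesgue) \<le> (\<integral>\<^sup>+x. ennreal (\<epsilon>\<^sup>2 powr r) * indicator ?D x \<partial>lebesgue)"
      proof (rule nn_integral_mono)
        fix x
        show "ennreal (\<bar>U x\<bar> powr r) * indicator ?D x \<le> ennreal (\<epsilon>\<^sup>2 powr r) * indicator ?D x"
          using UD[of x] that by (cases "x \<in> ?D") (auto intro!: ennreal_leI powr_mono2)
      qed
      also have "\<dots> = ennreal (\<epsilon>\<^sup>2 powr r) * ennreal \<beta>"
        unfolding nn_integral_cmult_indicator[OF Dm] \<beta>(2) ..
      also have "\<dots> = ennreal (\<epsilon> powr r * (\<epsilon> powr r * \<beta>))"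
        using \<beta>(1) \<epsilon> by (simp add: power2_eq_square powr_mult ennreal_mult[symmetric] mult.assoc)
      finally show ?thesis .
    qed
    have \<phi>_pow: "Lp_integral r (\<lambda>x. \<epsilon> * \<phi> (x - e)) = ennreal (\<epsilon> powr r) * Lp_integral r \<phi>" for r
      using Lp_integral_cmult[OF \<phi>em, of \<epsilon> r] Lp_integral_translation[OF \<phi>m, of r e] \<epsilon> by simp
    have restrict: "(\<integral>\<^sup>+x. ennreal (\<bar>f x\<bar> powr r) * indicator ?D x \<partial>lebesgue) \<le> Lp_integral r f" for f :: "real^'n \<Rightarrow> real" and r
      unfolding Lp_integral_def by (intro nn_integral_mono) (auto simp: indicator_def)
    have \<phi>_small: "(\<integral>\<^sup>+x. ennreal (\<bar>\<epsilon> * \<phi> (x - e)\<bar> powr r) * indicator ?D x \<partial>lebesgue) \<le> ennreal (\<epsilon> powr r * \<Phi>)"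
      if "Lp_integral r \<phi> = ennreal \<Phi>" "0 \<le> \<Phi>" for r \<Phi>
      using restrict[of "\<lambda>x. \<epsilon> * \<phi> (x - e)" r] that by (simp add: \<phi>_pow ennreal_mult)
    have neg: "Lp_integral r (\<lambda>x. - f x) = Lp_integral r f" for f :: "real^'n \<Rightarrow> real" and r
      by (simp add: Lp_integral_def)
    have w_D: "(\<integral>\<^sup>+x. ennreal (\<bar>w x\<bar> powr r) * indicator ?D x \<partial>lebesgue)
        \<le> ennreal (3 powr r * (\<epsilon> powr r * (\<epsilon> powr r * \<beta>) + \<epsilon> powr r * \<Phi> + \<tau> powr r * (\<beta> + 1)))"
      if r: "0 \<le> r" "r \<le> q" and \<Phi>: "Lp_integral r \<phi> = ennreal \<Phi>" "0 \<le> \<Phi>" for r \<Phi>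
    proof (rule nn_integral_powr_add3_le[where x=U and y="\<lambda>x. \<epsilon> * \<phi> (x - e)" and z="\<lambda>x. - h x"])
      show "w t = U t + \<epsilon> * \<phi> (t - e) + - h t" for t by (simp add: h_def)
    qed (use Um \<phi>em hm r \<Phi> \<beta>(1) U_small[OF r(1)] \<phi>_small[OF \<Phi>] h_small[OF r] in auto)
    have \<tau>r: "\<tau> powr r * (\<beta> + 1) \<le> \<epsilon> powr r" if "1 \<le> r" for r
    proof -
      have "\<tau> powr r = \<delta> powr r * \<epsilon> powr r" using \<delta> \<epsilon> by (simp add: \<tau>_def powr_mult)
      moreover have "\<delta> powr r \<le> \<delta>" using \<delta> that powr_mono'[of 1 r \<delta>] by simp
      then have "\<delta> powr r * (\<beta> + 1) \<le> 1" using \<delta>(3) \<beta>(1) by (meson add_nonneg_nonneg mult_right_mono order_trans zero_le_one)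
      then have "\<delta> powr r * (\<beta> + 1) * \<epsilon> powr r \<le> 1 * \<epsilon> powr r" by (rule mult_right_mono) simp
      ultimately show ?thesis by (simp add: ac_simps)
    qed
    have \<epsilon>r: "\<epsilon> powr r \<le> \<epsilon>" if "1 \<le> r" for r
      using \<epsilon> \<epsilon>1 that powr_mono'[of 1 r \<epsilon>] by simp
    have wp: "(\<integral>\<^sup>+x. ennreal (\<bar>w x\<bar> powr p) * indicator ?D x \<partial>lebesgue) \<le> ennreal (3 powr p * (\<epsilon> powr p * (\<Phi>p + 2)))"
    proof (rule order_trans[OF w_D[OF _ _ \<Phi>p] ennreal_leI])
      have "\<epsilon> powr p * \<beta> \<le> \<epsilon> * \<beta>" using \<epsilon>r[OF p1] \<beta>(1) by (rule mult_right_mono)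
      then have "\<epsilon> powr p * (\<epsilon> powr p * \<beta>) \<le> \<epsilon> powr p * 1" using \<epsilon>\<beta> by (intro mult_left_mono) auto
      then have "\<epsilon> powr p * (\<epsilon> powr p * \<beta>) + \<epsilon> powr p * \<Phi>p + \<tau> powr p * (\<beta> + 1) \<le> \<epsilon> powr p * (\<Phi>p + 2)"
        using \<tau>r[OF p1] by (simp add: algebra_simps)
      then show "3 powr p * (\<epsilon> powr p * (\<epsilon> powr p * \<beta>) + \<epsilon> powr p * \<Phi>p + \<tau> powr p * (\<beta> + 1)) \<le> 3 powr p * (\<epsilon> powr p * (\<Phi>p + 2))"
        by (rule mult_left_mono) simp
    qed (use p0 pq in auto)
    have wq: "(\<integral>\<^sup>+x. ennreal (\<bar>w x\<bar> powr q) * indicator ?D x \<partial>lebesgue) \<le> ennreal (C1 * \<epsilon> powr q)"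
    proof (rule order_trans[OF w_D[OF _ _ \<Phi>q] ennreal_leI])
      have "\<epsilon> powr q * \<beta> \<le> 1 * \<beta>" using \<epsilon>r[OF q1] \<epsilon>1 \<beta>(1) by (intro mult_right_mono) auto
      then have "\<epsilon> powr q * (\<epsilon> powr q * \<beta>) \<le> \<epsilon> powr q * \<beta>" by (intro mult_left_mono) auto
      then have "\<epsilon> powr q * (\<epsilon> powr q * \<beta>) + \<epsilon> powr q * \<Phi>q + \<tau> powr q * (\<beta> + 1) \<le> \<epsilon> powr q * (\<beta> + \<Phi>q + 1)"
        using \<tau>r[OF q1] by (simp add: algebra_simps)
      then have "3 powr q * (\<epsilon> powr q * (\<epsilon> powr q * \<beta>) + \<epsilon> powr q * \<Phi>q + \<tau> powr q * (\<beta> + 1)) \<le> 3 powr q * (\<epsilon> powr q * (\<beta> + \<Phi>q + 1))"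
        by (rule mult_left_mono) simp
      then show "3 powr q * (\<epsilon> powr q * (\<epsilon> powr q * \<beta>) + \<epsilon> powr q * \<Phi>q + \<tau> powr q * (\<beta> + 1)) \<le> C1 * \<epsilon> powr q"
        by (simp add: C1_def ac_simps)
    qed (use q0 in auto)
    \<comment> \<open>On the unit ball \<open>w\<close> differs from the scaled bump by
      \<open>U - h\<close>. The part of \<open>U\<close> is of second order in \<epsilon>, that of
      \<open>h\<close> is controlled by \<delta>; each takes at most half of
      \<open>\<theta> * \<epsilon>\<close>.\<close>
    have near: "(\<integral>\<^sup>+x. ennreal \<bar>w x - \<epsilon> * \<phi> (x - e)\<bar> * indicator (ball e 1) x \<partial>lebesgue) \<le> ennreal (\<theta> * \<epsilon>)"
    proof -
      have B1: "ball e 1 \<in> sets lebesgue" by simp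
      have "(\<integral>\<^sup>+x. ennreal \<bar>w x - \<epsilon> * \<phi> (x - e)\<bar> * indicator (ball e 1) x \<partial>lebesgue)
        \<le> (\<integral>\<^sup>+x. ennreal (\<epsilon>\<^sup>2) * indicator (ball e 1) x + ennreal (\<bar>h x\<bar> powr 1) * indicator (ball e 1) x \<partial>lebesgue)"
      proof (rule nn_integral_mono)
        fix x
        show "ennreal \<bar>w x - \<epsilon> * \<phi> (x - e)\<bar> * indicator (ball e 1) x
          \<le> ennreal (\<epsilon>\<^sup>2) * indicator (ball e 1) x + ennreal (\<bar>h x\<bar> powr 1) * indicator (ball e 1) x"
        proof (cases "x \<in> ball e 1")
          case True
          have "\<bar>w x - \<epsilon> * \<phi> (x - e)\<bar> \<le> \<epsilon>\<^sup>2 + \<bar>h x\<bar>"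
            using UD[OF subsetD[OF sub1 True]] by (simp add: h_def)
          then have "ennreal \<bar>w x - \<epsilon> * \<phi> (x - e)\<bar> \<le> ennreal (\<epsilon>\<^sup>2 + \<bar>h x\<bar>)" by (rule ennreal_leI)
          then show ?thesis using True by simp
        qed simp
      qed
      also have "\<dots> = ennreal (\<epsilon>\<^sup>2) * ennreal \<beta>1 + (\<integral>\<^sup>+x. ennreal (\<bar>h x\<bar> powr 1) * indicator (ball e 1) x \<partial>lebesgue)"
      proof -
        have a: "(\<lambda>x. ennreal (\<epsilon>\<^sup>2) * indicator (ball e 1) x) \<in> borel_measurable lebesgue"
          by (intro borel_measurable_times_ennreal borel_measurable_indicator B1) simp
        have b: "(\<lambda>x. ennreal (\<bar>h x\<bar> powr 1) * indicator (ball e 1) x) \<in> borel_measurable lebesgue"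
          by (intro borel_measurable_times_ennreal borel_measurable_indicator B1) (use hm in measurable)
        show ?thesis unfolding nn_integral_add[OF a b] nn_integral_cmult_indicator[OF B1] \<beta>1(2) ..
      qed
      also have "\<dots> \<le> ennreal (\<epsilon>\<^sup>2) * ennreal \<beta>1 + ennreal (\<tau> powr 1 * (\<beta>1 + 1))"
        using nn_integral_powr_le_of_Lp_integral[OF hm \<tau>(1) _ q1 hI B1 \<beta>1(2,1)] by (intro add_left_mono) simp
      also have "\<dots> = ennreal (\<epsilon>\<^sup>2 * \<beta>1 + \<tau> * (\<beta>1 + 1))"
        using \<beta>1(1) \<tau>(1) by (simp add: ennreal_mult[symmetric] ennreal_plus[symmetric] del: ennreal_plus)
      also have "\<dots> \<le> ennreal (\<theta> * \<epsilon>)"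
      proof (rule ennreal_leI)
        have "\<epsilon>\<^sup>2 * \<beta>1 = \<epsilon> * (\<epsilon> * \<beta>1)" by (simp add: power2_eq_square)
        also have "\<dots> \<le> \<epsilon> * (\<theta> / 2)" using \<epsilon>\<beta>(2) \<epsilon> by (intro mult_left_mono) auto
        finally have "\<epsilon>\<^sup>2 * \<beta>1 \<le> \<epsilon> * (\<theta> / 2)" .
        moreover have "\<tau> * (\<beta>1 + 1) \<le> \<epsilon> * (\<theta> / 2)"
          using mult_left_mono[OF \<delta>(4) less_imp_le[OF \<epsilon>(1)]] by (simp only: \<tau>_def mult.assoc mult.left_commute)
        ultimately show "\<epsilon>\<^sup>2 * \<beta>1 + \<tau> * (\<beta>1 + 1) \<le> \<theta> * \<epsilon>" by (simp add: mult.commute)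
      qed
      finally show ?thesis .
    qed
    obtain Z where Z: "smooth Z" "\<And>x. 0 \<le> Z x" "\<And>x. Z x \<le> 1" "\<And>x. norm (grad Z x) \<le> L / M"
        "\<And>x. Z x \<noteq> 0 \<Longrightarrow> x \<in> ?D" "\<And>x. x \<in> ball e 1 \<Longrightarrow> 1 / 2 \<le> Z x ^ k"
      using cut[OF M(1), of e] unfolding \<rho>_def by blast
    define w1 where "w1 = (\<lambda>x. (1 - Z x ^ k) * w x)"
    define g1 where "g1 = (\<lambda>x. (1 - Z x ^ k) *\<^sub>R ?g x + w x *\<^sub>R grad (\<lambda>x. 1 - Z x ^ k) x)"
    have ce: "is_weak_gradient w1 g1"
      unfolding w1_def g1_def by (rule cutoff_energy(1)[OF p2 k ww(1) Z(1,2,3,4) _ Dm]) (rule Z(5))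
    have ce2: "Lp_integral p (\<lambda>x. \<xi> \<bullet> g1 x) + (\<integral>\<^sup>+x. ennreal (Z x ^ k * \<bar>\<xi> \<bullet> ?g x\<bar> powr p) \<partial>lebesgue)
      \<le> Lp_integral p (\<lambda>x. \<xi> \<bullet> ?g x) + ennreal ((real k * (L / M)) powr p) * (\<integral>\<^sup>+x. ennreal (\<bar>w x\<bar> powr p) * indicator ?D x \<partial>lebesgue)"
      if "norm \<xi> = 1" for \<xi>
      unfolding g1_def by (rule cutoff_energy(2)[OF p2 k ww(1) Z(1,2,3,4) _ Dm that]) (rule Z(5))
    have w1W: "w1 \<in> W_hom p"
    proof -
      have "(\<integral>\<^sup>+x. ennreal (\<bar>w x\<bar> powr p) * indicator ?D x \<partial>lebesgue) < \<infinity>"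
        using wp by (auto simp: le_less_trans)
      then show ?thesis
        using ce unfolding w1_def g1_def
        by (intro cutoff_W_hom[OF p2 wW Z(1,2,3,4) _ Dm k2]) (auto dest: Z(5) simp del: mem_cball)
    qed
    \<comment> \<open>Since \<open>Z x ^ k\<close> is at least one half on the unit ball, half of
      the energy forced by the bump is saved, which is \<open>d / 2 * \<epsilon> powr p\<close>; the
      truncation costs at most half of that.\<close>
    have gain: "Lp_integral p (\<lambda>x. \<xi> \<bullet> g1 x) + ennreal (d / 4 * \<epsilon> powr p) \<le> Lp_integral p (\<lambda>x. \<xi> \<bullet> ?g x)"
      if \<xi>: "norm \<xi> = 1" for \<xi>
    proof -
      have "ennreal (d / 2 * \<epsilon> powr p) = ennreal (1 / 2) * ennreal (d * \<epsilon> powr p)"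
        by (subst ennreal_mult'[symmetric]) simp_all
      also have "\<dots> \<le> ennreal (1 / 2) * (\<integral>\<^sup>+x. ennreal (\<bar>\<xi> \<bullet> ?g x\<bar> powr p) * indicator (ball e 1) x \<partial>lebesgue)"
        by (intro mult_left_mono bump[OF ww(1) \<epsilon>(1) \<xi> near]) simp
      also have "\<dots> = (\<integral>\<^sup>+x. ennreal (1 / 2) * (ennreal (\<bar>\<xi> \<bullet> ?g x\<bar> powr p) * indicator (ball e 1) x) \<partial>lebesgue)"
      proof (intro nn_integral_cmult[symmetric] borel_measurable_times_ennreal borel_measurable_indicator)
        show "(\<lambda>x. ennreal (\<bar>\<xi> \<bullet> ?g x\<bar> powr p)) \<in> borel_measurable lebesgue" using gm by measurable
      qed simp
      also have "\<dots> \<le> (\<integral>\<^sup>+x. ennreal (Z x ^ k * \<bar>\<xi> \<bullet> ?g x\<bar> powr p) \<partial>lebesgue)"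
      proof (rule nn_integral_mono)
        fix x
        show "ennreal (1 / 2) * (ennreal (\<bar>\<xi> \<bullet> ?g x\<bar> powr p) * indicator (ball e 1) x) \<le> ennreal (Z x ^ k * \<bar>\<xi> \<bullet> ?g x\<bar> powr p)"
        proof (cases "x \<in> ball e 1")
          case True
          have "1 / 2 * \<bar>\<xi> \<bullet> ?g x\<bar> powr p \<le> Z x ^ k * \<bar>\<xi> \<bullet> ?g x\<bar> powr p"
            using Z(6)[OF True] by (intro mult_right_mono) auto
          from ennreal_leI[OF this] show ?thesis using True by (subst (asm) ennreal_mult') simp_all
        qed simp
      qed
      finally have low: "ennreal (d / 2 * \<epsilon> powr p) \<le> (\<integral>\<^sup>+x. ennreal (Z x ^ k * \<bar>\<xi> \<bullet> ?g x\<bar> powr p) \<partial>lebesgue)" .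
      have "Lp_integral p (\<lambda>x. \<xi> \<bullet> g1 x) + ennreal (d / 2 * \<epsilon> powr p)
        \<le> Lp_integral p (\<lambda>x. \<xi> \<bullet> ?g x) + ennreal ((real k * (L / M)) powr p) * (\<integral>\<^sup>+x. ennreal (\<bar>w x\<bar> powr p) * indicator ?D x \<partial>lebesgue)"
        by (rule order_trans[OF add_left_mono[OF low] ce2[OF \<xi>]])
      also have "\<dots> \<le> Lp_integral p (\<lambda>x. \<xi> \<bullet> ?g x) + ennreal ((real k * (L / M)) powr p) * ennreal (3 powr p * (\<epsilon> powr p * (\<Phi>p + 2)))"
        by (intro add_left_mono mult_left_mono wp) simp
      also have "ennreal ((real k * (L / M)) powr p) * ennreal (3 powr p * (\<epsilon> powr p * (\<Phi>p + 2))) \<le> ennreal (d / 4 * \<epsilon> powr p)"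
      proof -
        have "(real k * (L / M)) powr p * (3 powr p * (\<epsilon> powr p * (\<Phi>p + 2))) \<le> d / 4 * \<epsilon> powr p"
          using mult_right_mono[OF loss, of "\<epsilon> powr p"] by (simp add: ac_simps)
        then show ?thesis using \<Phi>p(2) by (simp add: ennreal_mult'[symmetric] ennreal_leI)
      qed
      \<comment> \<open>The saving is split into two quarters so that one of them cancels against
        the cost; the cancelled summand is finite, as cancellation in the extended reals
        requires.\<close>
      finally have "Lp_integral p (\<lambda>x. \<xi> \<bullet> g1 x) + ennreal (d / 4 * \<epsilon> powr p) + ennreal (d / 4 * \<epsilon> powr p)
        \<le> Lp_integral p (\<lambda>x. \<xi> \<bullet> ?g x) + ennreal (d / 4 * \<epsilon> powr p)"
        using d by (simp add: add.assoc ennreal_plus[symmetric] add_left_mono del: ennreal_plus)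
      then show ?thesis by (simp add: add.commute[of _ "ennreal (d / 4 * \<epsilon> powr p)"] ennreal_add_left_cancel_le)
    qed
    have UNIV_pow: "Lp_integral q f = (\<integral>\<^sup>+x. ennreal (\<bar>f x\<bar> powr q) * indicator UNIV x \<partial>lebesgue)" for f :: "real^'n \<Rightarrow> real"
      by (simp add: Lp_integral_def)
    have \<phi>q_pow: "Lp_integral q (\<lambda>x. \<epsilon> * \<phi> (x - e)) = ennreal (\<epsilon> powr q * \<Phi>q)"
      using \<phi>_pow[of q] \<Phi>q by (simp add: ennreal_mult)
    have \<epsilon>q1: "\<epsilon> powr q * \<Phi>q \<le> \<Phi>q" "\<tau> powr q \<le> \<epsilon> powr q" "\<epsilon> powr q \<le> 1"
    proof -
      show a: "\<epsilon> powr q \<le> 1" using \<epsilon>r[OF q1] \<epsilon>1 by simp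
      show "\<epsilon> powr q * \<Phi>q \<le> \<Phi>q" using mult_right_mono[OF a \<Phi>q(2)] by simp
      show "\<tau> powr q \<le> \<epsilon> powr q" using \<tau> q0 by (intro powr_mono2) auto
    qed
    have "Lp_integral q w \<le> ennreal (3 powr q * (1 + \<epsilon> powr q * \<Phi>q + \<tau> powr q))"
      unfolding UNIV_pow
    proof (rule nn_integral_powr_add3_le[where x=U and y="\<lambda>x. \<epsilon> * \<phi> (x - e)" and z="\<lambda>x. - h x"])
      show "w t = U t + \<epsilon> * \<phi> (t - e) + - h t" for t by (simp add: h_def)
    qed (use Um \<phi>em hm q0 \<Phi>q(2) UI \<phi>q_pow hI in \<open>auto simp: UNIV_pow\<close>)
    also have "\<dots> \<le> ennreal m1"
      unfolding m1_def using \<epsilon>q1 by (intro ennreal_leI mult_left_mono) auto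
    finally have wm1: "Lp_integral q w \<le> ennreal m1" .
    then obtain A where A: "Lp_integral q w = ennreal A" "0 \<le> A"
      by (cases "Lp_integral q w") (auto simp: top_unique)
    have Am1: "A \<le> m1" using wm1 A m1 by (simp add: ennreal_le_iff)
    \<comment> \<open>The three-term inequality is used in reverse, with \<open>U\<close> written as
      the sum of \<open>w\<close>, \<open>h\<close> and the negative of the bump.\<close>
    have Am0: "m0 \<le> A"
    proof -
      have "Lp_integral q U \<le> ennreal (3 powr q * (\<epsilon> powr q * \<Phi>q + A + \<tau> powr q))"
        unfolding UNIV_pow
      proof (rule nn_integral_powr_add3_le[where x="\<lambda>x. - (\<epsilon> * \<phi> (x - e))" and y=w and z=h])
        show "U t = - (\<epsilon> * \<phi> (t - e)) + w t + h t" for t by (simp add: h_def)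
      qed (use \<phi>em hm wm q0 \<Phi>q(2) A \<phi>q_pow hI in \<open>auto simp: UNIV_pow\<close>)
      then have "1 \<le> 3 powr q * (\<epsilon> powr q * \<Phi>q + A + \<tau> powr q)"
        using UI by simp
      then have "3 powr (- q) * 1 \<le> 3 powr (- q) * (3 powr q * (\<epsilon> powr q * \<Phi>q + A + \<tau> powr q))"
        by (intro mult_left_mono) auto
      also have "\<dots> = \<epsilon> powr q * \<Phi>q + A + \<tau> powr q" by (simp add: mult.assoc[symmetric] powr_add[symmetric])
      also have "\<dots> \<le> A + \<epsilon> powr q * (\<Phi>q + 1)" using \<epsilon>q1(2) by (simp add: algebra_simps)
      also have "\<epsilon> powr q * (\<Phi>q + 1) \<le> \<epsilon> * (\<Phi>q + 1)" using \<epsilon>r[OF q1] \<Phi>q(2) by (intro mult_right_mono) auto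
      also have "\<epsilon> * (\<Phi>q + 1) \<le> m0"
      proof -
        have "\<epsilon> \<le> m0 / (\<Phi>q + 1)" using \<epsilon> \<epsilon>0(6) by linarith
        then show ?thesis using \<Phi>q(2) by (simp add: field_simps)
      qed
      finally show ?thesis by (simp add: m0_def)
    qed
    have w1m: "w1 \<in> borel_measurable lebesgue"
      by (rule L1_loc_measurable[OF is_weak_gradient_L1_loc(1)[OF ce]])
    have Zk: "0 \<le> 1 - Z x ^ k" "1 - Z x ^ k \<le> 1" for x
      using Z(2,3)[of x] by (auto simp: power_le_one)
    have "Lp_integral q w1 \<le> Lp_integral q w"
      unfolding Lp_integral_def
    proof (intro nn_integral_mono ennreal_leI powr_mono2)
      fix x
      have "\<bar>1 - Z x ^ k\<bar> * \<bar>w x\<bar> \<le> 1 * \<bar>w x\<bar>" using Zk[of x] by (intro mult_right_mono) auto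
      then show "norm (w1 x) \<le> norm (w x)" by (simp add: w1_def abs_mult)
    qed (use q0 in auto)
    then obtain A1 where A1: "Lp_integral q w1 = ennreal A1" "0 \<le> A1"
      using A by (cases "Lp_integral q w1") (auto simp: top_unique)
    \<comment> \<open>Outside the cutoff ball the truncation changes nothing, so the lost mass is at
      most the mass of \<open>w\<close> inside it.\<close>
    have AA1: "A \<le> A1 + C1 * \<epsilon> powr q"
    proof -
      have "Lp_integral q w \<le> (\<integral>\<^sup>+x. ennreal (norm (w1 x) powr q) + ennreal (\<bar>w x\<bar> powr q) * indicator ?D x \<partial>lebesgue)"
        unfolding Lp_integral_def
      proof (rule nn_integral_mono)
        fix x
        show "ennreal (norm (w x) powr q) \<le> ennreal (norm (w1 x) powr q) + ennreal (\<bar>w x\<bar> powr q) * indicator ?D x"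
        proof (cases "x \<in> ?D")
          case False
          then have "Z x = 0" using Z(5) by blast
          then have "w1 x = w x" using k2 by (simp add: w1_def power_0_left)
          then show ?thesis by simp
        qed simp
      qed
      also have "\<dots> = Lp_integral q w1 + (\<integral>\<^sup>+x. ennreal (\<bar>w x\<bar> powr q) * indicator ?D x \<partial>lebesgue)"
      proof -
        have a: "(\<lambda>x. ennreal (norm (w1 x) powr q)) \<in> borel_measurable lebesgue" using w1m by measurable
        have b: "(\<lambda>x. ennreal (\<bar>w x\<bar> powr q) * indicator ?D x) \<in> borel_measurable lebesgue"
          by (intro borel_measurable_times_ennreal borel_measurable_indicator Dm) (use wm in measurable)
        show ?thesis unfolding nn_integral_add[OF a b] Lp_integral_def ..
      qed
      also have "\<dots> \<le> ennreal A1 + ennreal (C1 * \<epsilon> powr q)"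
        unfolding A1(1) by (rule add_left_mono[OF wq])
      finally show ?thesis
        using A A1 C1 by (simp add: ennreal_plus[symmetric] ennreal_le_iff del: ennreal_plus)
    qed
    have A0: "0 < A" using Am0 m0 by simp
    have small: "real N * (C1 / m0) * (1 + \<kappa>' * m1 powr (- p / q)) * \<epsilon> powr (q - p) < \<kappa>' * m1 powr (- p / q)"
    proof -
      have "\<epsilon> powr (q - p) < ((T / (B + 1)) powr (1 / (q - p))) powr (q - p)"
        using \<epsilon> \<epsilon>0(7) pq by (intro powr_less_mono2) auto
      also have "\<dots> = T / (B + 1)" using pq T B by (simp add: powr_powr)
      finally have "(B + 1) * \<epsilon> powr (q - p) < T" using B by (simp add: field_simps)
      moreover have "B * \<epsilon> powr (q - p) \<le> (B + 1) * \<epsilon> powr (q - p)" by (intro mult_right_mono) auto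
      ultimately show ?thesis by (simp add: B_def T_def)
    qed
    \<comment> \<open>\<open>M_aff_gain\<close> needs a competitor of positive norm. If the
      truncation removed everything, the loss would be at least \<open>m0\<close>, which contradicts
      the smallness condition.\<close>
    have A1pos: "0 < A1"
    proof (rule ccontr)
      assume "\<not> 0 < A1"
      then have le: "m0 \<le> C1 * \<epsilon> powr q" using AA1 Am0 A1 by simp
      have n_q: "0 < ?n / q" using q0 n1 by simp
      then have N1: "1 \<le> real N" using N by (cases N) auto
      have "\<epsilon> powr q \<le> \<epsilon> powr (q - p)" using \<epsilon> \<epsilon>1 p0 by (intro powr_mono') auto
      then have "C1 * \<epsilon> powr q \<le> C1 * \<epsilon> powr (q - p)" using C1 by (rule mult_left_mono)
      then have "1 \<le> C1 / m0 * \<epsilon> powr (q - p)" using le m0 by (simp add: pos_le_divide_eq)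
      then have "1 * (1 + T) \<le> (real N * (C1 / m0 * \<epsilon> powr (q - p))) * (1 + T)"
        using mult_mono[OF N1 \<open>1 \<le> C1 / m0 * \<epsilon> powr (q - p)\<close>] T by (intro mult_right_mono) auto
      also have "\<dots> < T" using small by (simp add: T_def ac_simps)
      finally show False by simp
    qed
    define F where "F = A powr (1 / q)"
    define F1 where "F1 = A1 powr (1 / q)"
    have F: "Lp_norm q w = ennreal F" "0 < F"
      using A A0 q0 by (simp_all add: F_def Lp_norm_eq epowr_ennreal_pos)
    have F1: "Lp_norm q w1 = ennreal F1" "0 < F1"
      using A1 A1pos q0 by (simp_all add: F1_def Lp_norm_eq epowr_ennreal_pos)
    have dpos: "0 < d / 4 * \<epsilon> powr p" using d \<epsilon> by simp
    have "(1 + \<kappa> * (d / 4 * \<epsilon> powr p) * F powr (- p)) * F1 powr ?n \<le> F powr ?n"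
      by (rule \<kappa>(2)[OF w ww(1) w1W ce dpos gain F F1])
    then have main: "(1 + \<kappa>' * \<epsilon> powr p * A powr (- p / q)) * A1 powr (?n / q) \<le> A powr (?n / q)"
      by (simp add: F_def F1_def powr_powr \<kappa>'_def mult.assoc)
    show False
      by (rule gain_beats_loss[OF p0 pq _ N \<epsilon>(1) less_imp_le[OF \<epsilon>1] m0 Am0 Am1 A1pos AA1 C1 \<kappa>' main small])
         (use q0 n1 in simp)
  qed
qed

section \<open>From closeness of functions to distance of gradients\<close>

lemma SL_inverse:
  fixes B :: "real ^ 'n ^ 'n"
  assumes "det B = 1"
  obtains B' where "det B' = 1" "B' ** B = mat 1" "B ** B' = mat 1"
proof -
  obtain B' where B': "B ** B' = mat 1" "B' ** B = mat 1"
    using assms invertible_det_nz[of B] unfolding invertible_def by auto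
  have "det B' * det B = 1" using B' by (metis det_I det_mul)
  then show ?thesis using that[of B'] B' assms by simp
qed

lemma M_aff_S_aff:
  fixes f :: "real ^ 'n \<Rightarrow> real"
  assumes p: "0 < p" "p < real CARD('n)" and f: "f \<in> M_aff p"
  obtains S where "0 < S" "S_aff TYPE('n) p = ennreal S"
proof -
  let ?q = "sobolev_exp (real CARD('n)) p"
  have q: "0 < ?q" using sobolev_exp_gt[OF p] p by simp
  have fW: "f \<in> W_hom p" and nz: "\<not> (AE x in lebesgue. f x = 0)"
    and eq: "affine_energy p f = S_aff TYPE('n) p * Lp_norm ?q f"
    using f by (auto simp: M_aff_def)
  note w = W_homD[OF p(1) fW]
  have 0: "affine_energy p f \<noteq> 0" by (rule affine_energy_pos[OF p(1) fW nz])
  obtain C where C: "0 < C" "\<And>(f :: real ^ 'n \<Rightarrow> real) g. is_weak_gradient f g \<Longrightarrow> affine_energy p f \<le> ennreal C * Lp_norm p g"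
    using affine_energy_le[OF p(1)] by blast
  have "affine_energy p f \<le> ennreal C * Lp_norm p (weak_gradient f)" by (rule C(2)[OF w(1)])
  also have "\<dots> < top" using w(2) p by (simp add: ennreal_mult_less_top Lp_norm_eq epowr_less_top)
  finally have fin: "affine_energy p f < top" .
  have "S_aff TYPE('n) p \<noteq> 0" using 0 eq by auto
  \<comment> \<open>In the extended reals \<open>0 * \<infinity>\<close> is 0, so an infinite best
    constant is excluded only once the norm is known to be nonzero; then the product would be
    infinite, against the finite energy.\<close>
  moreover have "Lp_norm ?q f \<noteq> 0" using 0 eq by auto
  then have "S_aff TYPE('n) p \<noteq> top" using fin eq by (auto simp: ennreal_top_mult)
  ultimately show ?thesis using that by (cases "S_aff TYPE('n) p" rule: ennreal_cases3) auto
qed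

lemma bump_distance_lower_bound:
  fixes \<phi> U :: "real ^ 'n \<Rightarrow> real" and p c\<^sub>0 S :: real
  assumes p2: "2 \<le> p" and pn: "p < real CARD('n)"
    and \<phi>: "\<phi> \<in> Cc_infinity (ball 0 1)" "\<phi> \<noteq> (\<lambda>_. 0)"
    and c0: "0 < c\<^sub>0" and U: "U = U_profile c\<^sub>0 p"
    and U1: "Lp_norm (sobolev_exp (real CARD('n)) p) U = 1"
    and S: "S_aff TYPE('n) p = ennreal S" "0 < S"
  obtains C \<epsilon>0 where "0 < C" "0 < \<epsilon>0" "\<epsilon>0 \<le> 1"
    "\<And>\<epsilon> e v B. 0 < \<epsilon> \<Longrightarrow> \<epsilon> < \<epsilon>0 \<Longrightarrow> (\<And>y. norm e / 4 \<le> norm y \<Longrightarrow> U y \<le> \<epsilon>\<^sup>2) \<Longrightarrow> v \<in> M_aff p \<Longrightarrow> det B = 1 \<Longrightarrow>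
      ennreal (C * \<epsilon>) \<le> Lp_norm p (weak_gradient (\<lambda>x. (U (B *v x) + \<epsilon> * \<phi> (B *v x - e)) - v x))"
proof -
  let ?q = "sobolev_exp (real CARD('n)) p"
  have p0: "0 < p" using p2 by simp
  have q: "0 < ?q" using sobolev_exp_gt[OF p0 pn] p0 by simp
  obtain \<delta> \<epsilon>0 where \<delta>: "0 < \<delta>" "0 < \<epsilon>0" "\<epsilon>0 \<le> 1"
    "\<And>\<epsilon> e w. 0 < \<epsilon> \<Longrightarrow> \<epsilon> < \<epsilon>0 \<Longrightarrow> (\<And>y. norm e / 4 \<le> norm y \<Longrightarrow> U y \<le> \<epsilon>\<^sup>2) \<Longrightarrow> w \<in> M_aff p \<Longrightarrow>
      Lp_integral ?q (\<lambda>x. U x + \<epsilon> * \<phi> (x - e) - w x) \<le> ennreal ((\<delta> * \<epsilon>) powr ?q) \<Longrightarrow> False"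
    using no_extremal_near_bump[OF p2 pn \<phi> c0 U U1 S] by blast
  obtain K where K: "0 < K" "\<And>(f :: real ^ 'n \<Rightarrow> real) g. is_weak_gradient f g \<Longrightarrow> affine_energy p f \<le> ennreal K * Lp_norm p g"
    using affine_energy_le[OF p0] by blast
  \<comment> \<open>A gradient norm below \<open>C * \<epsilon>\<close> gives an affine energy at
    most \<open>K * C * \<epsilon> = S * \<delta> * \<epsilon>\<close>, and the Sobolev inequality
    divides by \<open>S\<close>.\<close>
  define C where "C = S * \<delta> / K"
  show ?thesis
  proof (rule that[of C \<epsilon>0])
    show "0 < C" "0 < \<epsilon>0" "\<epsilon>0 \<le> 1" using \<delta> S K by (auto simp: C_def)
    fix \<epsilon> :: real and e :: "real^'n" and v :: "real^'n \<Rightarrow> real" and B :: "real^'n^'n"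
    assume \<epsilon>: "0 < \<epsilon>" "\<epsilon> < \<epsilon>0" and Usmall: "\<And>y. norm e / 4 \<le> norm y \<Longrightarrow> U y \<le> \<epsilon>\<^sup>2"
      and v: "v \<in> M_aff p" and B: "det B = 1"
    show "ennreal (C * \<epsilon>) \<le> Lp_norm p (weak_gradient (\<lambda>x. (U (B *v x) + \<epsilon> * \<phi> (B *v x - e)) - v x))"
    proof (rule ccontr)
      let ?G = "\<lambda>x. (U (B *v x) + \<epsilon> * \<phi> (B *v x - e)) - v x"
      assume "\<not> ennreal (C * \<epsilon>) \<le> Lp_norm p (weak_gradient ?G)"
      then have less: "Lp_norm p (weak_gradient ?G) < ennreal (C * \<epsilon>)" by simp
      obtain B' where B': "det B' = 1" "B' ** B = mat 1" "B ** B' = mat 1"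
        using SL_inverse[OF B] by blast
      define w where "w = (\<lambda>x. v (B' *v x))"
      have wM: "w \<in> M_aff p" unfolding w_def by (rule M_aff_unimodular[OF p0 v B'(1) q])
      have wW: "w \<in> W_hom p" using wM by (simp add: M_aff_def)
      have vW: "v \<in> W_hom p" using v by (simp add: M_aff_def)
      have wB: "w (B *v x) = v x" for x
        using B' by (simp add: w_def matrix_vector_mul_assoc)
      define F where "F = (\<lambda>x. U x + \<epsilon> * \<phi> (x - e))"
      define h where "h = (\<lambda>x. F x + (- 1) * w x)"
      have hB: "?G = (\<lambda>x. h (B *v x))" by (simp add: h_def F_def wB)
      have \<phi>e: "(\<lambda>x. \<phi> (x - e)) \<in> Cc_infinity UNIV"
        by (rule Cc_infinity_translation_minus[OF Cc_infinity_mono[OF \<phi>(1)]])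
      have CkU: "Ck (Suc 0) U" unfolding U by (rule U_profile_Ck) (use p2 in simp)
      have Ck\<phi>: "Ck (Suc 0) (\<lambda>x. \<phi> (x - e))"
        using \<phi>e unfolding Cc_infinity_UNIV_iff by (intro smooth_Ck) simp
      have wF: "is_weak_gradient F (\<lambda>x. grad U x + \<epsilon> *\<^sub>R grad (\<lambda>x. \<phi> (x - e)) x)"
        unfolding F_def by (rule is_weak_gradient_lincomb[OF is_weak_gradient_grad[OF CkU] is_weak_gradient_grad[OF Ck\<phi>]])
      obtain gh where gh: "is_weak_gradient h gh"
        unfolding h_def using is_weak_gradient_lincomb[OF wF W_homD(1)[OF p0 wW], of "-1"] by blast
      have hm: "h \<in> borel_measurable lebesgue" by (rule L1_loc_measurable[OF is_weak_gradient_L1_loc(1)[OF gh]])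
      have Fm: "F \<in> borel_measurable lebesgue" by (rule L1_loc_measurable[OF is_weak_gradient_L1_loc(1)[OF wF]])
      have wG: "is_weak_gradient ?G (weak_gradient ?G)"
        unfolding hB using is_weak_gradient_unimodular[OF gh B]
        by (intro weakly_differentiable_weak_gradient) (auto simp: weakly_differentiable_def)
      \<comment> \<open>The Sobolev inequality may be applied only to members of the space. The
        gradient norm is finite by the assumption for contradiction; for the superlevel sets the
        level is halved, with Chebyshev for the transformed perturbed profile and membership in the
        space for \<open>v\<close>.\<close>
      have GW: "?G \<in> W_hom p"
      proof (rule W_homI[OF p0 wG])
        have "Lp_norm p (weak_gradient ?G) < top" using less by (rule less_trans) simp
        then show "Lp_integral p (weak_gradient ?G) < \<infinity>" using p0 by (simp add: Lp_norm_eq epowr_less_top)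
        fix t :: real assume t: "0 < t"
        have FBm: "(\<lambda>x. F (B *v x)) \<in> borel_measurable lebesgue"
          using measurable_compose[OF lebesgue_measurable_unimodular[OF B] Fm] .
        have vm: "v \<in> borel_measurable lebesgue"
          by (rule L1_loc_measurable[OF is_weak_gradient_L1_loc(1)[OF W_homD(1)[OF p0 vW]]])
        have "Lp_integral ?q F < \<infinity>"
        proof -
          have Uq: "Lp_integral ?q U < top"
          proof -
            have "Lp_norm ?q U < top" using U1 by simp
            then show ?thesis using q by (simp add: Lp_norm_eq epowr_less_top)
          qed
          have \<phi>q: "Lp_integral ?q (\<lambda>x. \<epsilon> * \<phi> (x - e)) < top"
            using Cc_infinity_Lp_integral_finite[OF q Cc_infinity_mult[OF _ \<phi>e, of "\<lambda>_. \<epsilon>"]]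
            by (simp add: smooth_def Ck_const)
          obtain a b where ab: "Lp_integral ?q U = ennreal a" "0 \<le> a" "Lp_integral ?q (\<lambda>x. \<epsilon> * \<phi> (x - e)) = ennreal b" "0 \<le> b"
            using Uq \<phi>q by (cases "Lp_integral ?q U"; cases "Lp_integral ?q (\<lambda>x. \<epsilon> * \<phi> (x - e))") auto
          have "(\<integral>\<^sup>+x. ennreal (\<bar>F x\<bar> powr ?q) * indicator UNIV x \<partial>lebesgue) \<le> ennreal (3 powr ?q * (a + b + 0))"
          proof (rule nn_integral_powr_add3_le[where x=U and y="\<lambda>x. \<epsilon> * \<phi> (x - e)" and z="\<lambda>_. 0"])
            show "U \<in> borel_measurable lebesgue" "(\<lambda>x. \<epsilon> * \<phi> (x - e)) \<in> borel_measurable lebesgue"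
              using L1_loc_measurable[OF L1_loc_continuous[OF Ck_continuous_on[OF CkU]]]
                L1_loc_measurable[OF L1_loc_continuous[OF Ck_continuous_on[OF Ck\<phi>]]] by simp_all
          qed (use ab q in \<open>auto simp: F_def Lp_integral_def\<close>)
          then show ?thesis by (auto simp: Lp_integral_def le_less_trans)
        qed
        then have "Lp_integral ?q (\<lambda>x. F (B *v x)) < \<infinity>" by (simp add: Lp_integral_unimodular[OF B Fm])
        then have 1: "emeasure lebesgue {x. \<bar>F (B *v x)\<bar> > t / 2} < \<infinity>"
          using t by (intro emeasure_superlevel_finite[OF FBm q]) auto
        have 2: "emeasure lebesgue {x. \<bar>v x\<bar> > t / 2} < \<infinity>" using W_homD(3)[OF p0 vW, of "t / 2"] t by simp
        have s: "{x. \<bar>F (B *v x)\<bar> > t / 2} \<in> sets lebesgue" "{x. \<bar>v x\<bar> > t / 2} \<in> sets lebesgue"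
          using measurable_sets[OF borel_measurable_abs[OF FBm], of "{t / 2<..}"]
            measurable_sets[OF borel_measurable_abs[OF vm], of "{t / 2<..}"] by (simp_all add: vimage_def)
        have "emeasure lebesgue {x. \<bar>?G x\<bar> > t} \<le> emeasure lebesgue ({x. \<bar>F (B *v x)\<bar> > t / 2} \<union> {x. \<bar>v x\<bar> > t / 2})"
        proof (rule emeasure_mono)
          show "{x. \<bar>?G x\<bar> > t} \<subseteq> {x. \<bar>F (B *v x)\<bar> > t / 2} \<union> {x. \<bar>v x\<bar> > t / 2}"
          proof
            fix x assume "x \<in> {x. \<bar>?G x\<bar> > t}"
            then have "t < \<bar>F (B *v x) - v x\<bar>" by (simp add: F_def)
            then have "t / 2 < \<bar>F (B *v x)\<bar> \<or> t / 2 < \<bar>v x\<bar>" by linarith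
            then show "x \<in> {x. \<bar>F (B *v x)\<bar> > t / 2} \<union> {x. \<bar>v x\<bar> > t / 2}" by blast
          qed
        qed (rule sets.Un[OF s])
        also have "\<dots> \<le> emeasure lebesgue {x. \<bar>F (B *v x)\<bar> > t / 2} + emeasure lebesgue {x. \<bar>v x\<bar> > t / 2}"
          by (rule emeasure_subadditive[OF s])
        also have "\<dots> < \<infinity>" using 1 2 by simp
        finally show "emeasure lebesgue {x. \<bar>?G x\<bar> > t} < \<infinity>" .
      qed
      have "ennreal S * Lp_norm ?q ?G \<le> affine_energy p ?G"
        using S_aff_mult_Lp_norm_le[OF GW] by (simp add: S)
      also have "\<dots> \<le> ennreal K * Lp_norm p (weak_gradient ?G)" by (rule K(2)[OF wG])
      also have "\<dots> \<le> ennreal K * ennreal (C * \<epsilon>)" using less by (intro mult_left_mono) auto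
      also have "\<dots> = ennreal S * ennreal (\<delta> * \<epsilon>)"
        using K(1) S(2) \<delta>(1) \<epsilon>(1) by (simp add: ennreal_mult'[symmetric] C_def)
      finally have "Lp_norm ?q ?G \<le> ennreal (\<delta> * \<epsilon>)"
        using S(2) by (simp add: ennreal_mult_le_mult_iff)
      then have "Lp_norm ?q ?G epowr ?q \<le> ennreal (\<delta> * \<epsilon>) epowr ?q"
        using q by (intro epowr_mono) auto
      then have "Lp_integral ?q ?G \<le> ennreal ((\<delta> * \<epsilon>) powr ?q)"
        using q \<delta>(1) \<epsilon>(1) by (simp add: Lp_norm_epowr epowr_ennreal_pos)
      then have "Lp_integral ?q h \<le> ennreal ((\<delta> * \<epsilon>) powr ?q)"
        unfolding hB by (simp add: Lp_integral_unimodular[OF B hm])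
      then have "Lp_integral ?q (\<lambda>x. U x + \<epsilon> * \<phi> (x - e) - w x) \<le> ennreal ((\<delta> * \<epsilon>) powr ?q)"
        by (simp add: h_def F_def)
      then show False using \<delta>(4)[OF \<epsilon> Usmall wM] by blast
    qed
  qed
qed

theorem lemma7p2:
  fixes p c\<^sub>0 :: real and \<phi> U :: "real ^ 'n \<Rightarrow> real" and i\<^sub>1 :: 'n
  assumes "2 \<le> p" and "p < real CARD('n)"
    and "\<phi> \<in> Cc_infinity (ball 0 1)" and "\<phi> \<noteq> (\<lambda>_. 0)"
    and "0 < c\<^sub>0" and "U = U_profile c\<^sub>0 p"
    and "Lp_norm (sobolev_exp (real CARD('n)) p) U = 1"
  shows "\<exists>c C. 0 < c \<and> c \<le> 1 \<and> 0 < C \<and>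
    (\<forall>R :: real \<Rightarrow> real.
       (\<forall>\<epsilon>. 0 < \<epsilon> \<and> \<epsilon> < 1 \<longrightarrow> 0 < R \<epsilon> \<and> (SUP y\<in>{y. norm y \<ge> R \<epsilon> / 4}. \<bar>U y\<bar>) \<le> \<epsilon>\<^sup>2) \<longrightarrow>
       (\<forall>\<epsilon>. 0 < \<epsilon> \<and> \<epsilon> < c \<longrightarrow>
          (let f = (\<lambda>x. U x + \<epsilon> * \<phi> (x - R \<epsilon> *\<^sub>R axis i\<^sub>1 1));
               d = (\<lambda>v (B :: real ^ 'n ^ 'n). Lp_norm p (weak_gradient (\<lambda>x. f (B *v x) - v x)))
           in (INF (v, B) \<in> M_aff1 p \<times> SL. d v B) \<ge> (INF (v, B) \<in> M_aff p \<times> SL. d v B) \<and>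
              (INF (v, B) \<in> M_aff p \<times> SL. d v B) \<ge> ennreal (C * \<epsilon>))))"
proof -
  have p0: "0 < p" using assms(1) by simp
  obtain C \<epsilon>0 where C: "0 < C" "0 < \<epsilon>0" "\<epsilon>0 \<le> 1"
    "\<And>\<epsilon> e v B. 0 < \<epsilon> \<Longrightarrow> \<epsilon> < \<epsilon>0 \<Longrightarrow> (\<And>y. norm e / 4 \<le> norm y \<Longrightarrow> U y \<le> \<epsilon>\<^sup>2) \<Longrightarrow> v \<in> M_aff p \<Longrightarrow> det B = 1 \<Longrightarrow>
      ennreal (C * \<epsilon>) \<le> Lp_norm p (weak_gradient (\<lambda>x. (U (B *v x) + \<epsilon> * \<phi> (B *v x - e)) - v x))"
  \<comment> \<open>Without extremals the claim about all \<open>v\<close> is vacuous and any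
    positive constants serve. Otherwise an extremal exists, which makes the best constant positive
    and finite.\<close>
  proof (cases "M_aff p = ({} :: (real^'n \<Rightarrow> real) set)")
    case True
    then show ?thesis using that[of 1 1] by simp
  next
    case False
    then obtain f :: "real^'n \<Rightarrow> real" where "f \<in> M_aff p" by blast
    then obtain S where "0 < S" "S_aff TYPE('n) p = ennreal S"
      using M_aff_S_aff[OF p0 assms(2)] by blast
    with bump_distance_lower_bound[OF assms] that show ?thesis by blast
  qed
  have lower: "ennreal (C * \<epsilon>) \<le> Lp_norm p (weak_gradient (\<lambda>x. (U (B *v x) + \<epsilon> * \<phi> (B *v x - R \<epsilon> *\<^sub>R axis i\<^sub>1 1)) - v x))"
    if R: "\<forall>\<epsilon>. 0 < \<epsilon> \<and> \<epsilon> < 1 \<longrightarrow> 0 < R \<epsilon> \<and> (SUP y\<in>{y. norm y \<ge> R \<epsilon> / 4}. \<bar>U y\<bar>) \<le> \<epsilon>\<^sup>2"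
      and \<epsilon>: "0 < \<epsilon>" "\<epsilon> < \<epsilon>0" and v: "v \<in> M_aff p" and B: "B \<in> SL" for R \<epsilon> v B
  proof (rule C(4)[OF \<epsilon> _ v])
    show "det B = 1" using B by (simp add: SL_def)
    have \<epsilon>1: "\<epsilon> < 1" using \<epsilon> C(3) by simp
    fix y :: "real^'n" assume "norm (R \<epsilon> *\<^sub>R axis i\<^sub>1 (1::real)) / 4 \<le> norm y"
    then have y: "y \<in> {y. norm y \<ge> R \<epsilon> / 4}" using R \<epsilon> \<epsilon>1 by (simp add: norm_axis_1)
    \<comment> \<open>The supremum in the choice of \<open>R\<close> is taken in the reals, where it
      bounds the values only if they are bounded above; the profile is largest at the
      origin.\<close>
    have "bdd_above ((\<lambda>y. \<bar>U y\<bar>) ` {y. norm y \<ge> R \<epsilon> / 4})"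
    proof (rule bdd_aboveI2)
      fix x
      show "\<bar>U x\<bar> \<le> U 0"
        using U_profile_antimono[of p c\<^sub>0 0 x] U_profile_pos[of c\<^sub>0 p x] assms by simp
    qed
    from cSUP_upper[OF y this] have "\<bar>U y\<bar> \<le> \<epsilon>\<^sup>2" using R \<epsilon> \<epsilon>1 by fastforce
    then show "U y \<le> \<epsilon>\<^sup>2" by simp
  qed
  have sub: "M_aff1 p \<times> SL \<subseteq> (M_aff p \<times> SL :: ((real^'n \<Rightarrow> real) \<times> (real^'n^'n)) set)"
    by (auto simp: M_aff1_def)
  show ?thesis
    unfolding Let_def
    using C(1,2,3) lower
    by (intro exI[of _ \<epsilon>0] exI[of _ C] conjI allI impI INF_superset_mono[OF sub] INF_greatest) auto
qed

end
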